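(* Let $\sigma>0$, $\beta\in\mathbb{R}$, and let the kernel $K$ satisfy condition (K) of the context. Suppose that $K$ is regularly varying at $t=0$, that is, $$K(t)=\frac{t^{\alpha-1}}{\Gamma(\alpha)}\ell(t),\qquad t>0,$$ where $\alpha\in(0,1)$ and $\ell>0$ is slowly varying at $0$. Let $\mu$ be a locally finite measure on $\mathbb{R}_+=[0,\infty)$ with values in $\mathbb{C}_-=\{u\in\mathbb{C}:\mathrm{Re}(u)\le 0\}$, and let $\psi(\cdot;\mu)\in L^2_{\mathrm{loc}}(\mathbb{R}_+;\mathbb{C}_-)$ be the unique solution of $$\psi(t;\mu)=\int_{[0,t]}K(t-s)\,\mu(\mathrm{d}s)+\int_0^tK(t-s)R(\psi(s;\mu))\,\mathrm{d}s,\qquad R(u)=\beta u+\frac{\sigma^2}{2}u^2 .$$ Write $(K\ast\mu)(t)=\int_{[0,t]}K(t-s)\,\mu(\mathrm{d}s)$. Let $m\ge 0$ be an integer and $\eta\in(0,1)$. Then $$K\ast\mu\in C^{m,\eta}((0,\infty);\mathbb{C}_-)\ \Longrightarrow\ \psi(\cdot;\mu)\in C^{m,\eta}((0,\infty);\mathbb{C}_-).$$ In particular, if $K\ast\mu$ is $C^\infty$ on $(0,\infty)$, then $\psi(\cdot;\mu)$ is $C^\infty$ on $(0,\infty)$.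
   Context: Condition (K): $0\not\equiv K\in L^2_{\mathrm{loc}}(\mathbb{R}_+)$ is completely monotone on $(0,\infty)$, and there exist $\gamma\in(0,1]$ and, for each $T>0$, a constant $C_T>0$ such that $\int_0^hK(t)^2\,\mathrm{d}t+\int_0^T|K(t+h)-K(t)|^2\,\mathrm{d}t\le C_Th^{2\gamma}$ for all $h>0$. Under (K), the equation for $\psi(\cdot;\mu)$ is known to have a unique solution in $L^2_{\mathrm{loc}}(\mathbb{R}_+;\mathbb{C}_-)$, and this solution is such that $\psi(\cdot;\mu)-K\ast\mu$ is continuous on $(0,\infty)$. A function belongs to $C^{m,\eta}((0,\infty))$ if on every compact interval $[a,b]\subset(0,\infty)$ it is $m$ times continuously differentiable with $\eta$-Hölder continuous $m$-th derivative. *)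

theory Defs
  imports "HOL-Analysis.Analysis"
begin

definition Cminus :: "complex set" where
  "Cminus = {u. Re u \<le> 0}"

subsection \<open>Local square integrability and kernels\<close>

definition L2_loc :: "(real \<Rightarrow> 'a::{banach, second_countable_topology}) \<Rightarrow> bool" where
  "L2_loc f \<longleftrightarrow> (\<forall>T>0. set_borel_measurable lborel {0..T} f \<and>
                        set_integrable lborel {0..T} (\<lambda>t. (norm (f t))\<^sup>2))"

definition completely_monotone :: "(real \<Rightarrow> real) \<Rightarrow> bool" where
  "completely_monotone K \<longleftrightarrow>
     (\<forall>n. \<forall>t>0. (deriv ^^ n) K differentiable (at t) \<and> (-1) ^ n * (deriv ^^ n) K t \<ge> 0)"

text \<open>Condition (K).  Only the values of the kernel on the open half-line matter; the value
  that the total function assigns to \<open>0\<close> is arbitrary.\<close>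

definition condition_K :: "(real \<Rightarrow> real) \<Rightarrow> bool" where
  "condition_K K \<longleftrightarrow>
     (\<exists>t>0. K t \<noteq> 0) \<and> L2_loc K \<and> completely_monotone K \<and>
     (\<exists>\<gamma>. 0 < \<gamma> \<and> \<gamma> \<le> 1 \<and> (\<forall>T>0. \<exists>C>0. \<forall>h>0.
        (LINT t:{0..h}|lborel. (K t)\<^sup>2) + (LINT t:{0..T}|lborel. \<bar>K (t + h) - K t\<bar>\<^sup>2)
          \<le> C * h powr (2 * \<gamma>)))"

definition slowly_varying_at_0 :: "(real \<Rightarrow> real) \<Rightarrow> bool" where
  "slowly_varying_at_0 l \<longleftrightarrow>
     set_borel_measurable borel {0<..} l \<and> (\<forall>t>0. l t > 0) \<and>
     (\<forall>c>0. ((\<lambda>t. l (c * t) / l t) \<longlongrightarrow> 1) (at_right 0))"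

subsection \<open>Locally finite complex-valued measures on the half-line\<close>

text \<open>Such a measure is a complex-valued set function that is defined on the bounded Borel subsets
  of \<open>[0, \<infinity>)\<close> only and is countably additive there; the total variation, and even the value, may
  fail to exist on unbounded sets.  (Finiteness of the total variation on bounded sets is automatic.)\<close>

definition bounded_borel :: "real set set" where
  "bounded_borel = {A \<in> sets borel. A \<subseteq> {0..} \<and> bounded A}"

definition loc_finite_measure :: "(real set \<Rightarrow> complex) \<Rightarrow> bool" where
  "loc_finite_measure \<mu> \<longleftrightarrow> \<mu> {} = 0 \<and>
     (\<forall>A::nat \<Rightarrow> real set. range A \<subseteq> bounded_borel \<and> disjoint_family A \<and> bounded (\<Union>n. A n)
        \<longrightarrow> (\<lambda>n. \<mu> (A n)) sums \<mu> (\<Union>n. A n))"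

text \<open>The positive part \<open>\<nu>\<^sup>+\<close> of the Jordan decomposition of a real-valued locally finite measure
  \<open>\<nu>\<close>, as a library measure.  The negative part is \<open>(- \<nu>)\<^sup>+\<close>.  Negative values of \<open>\<nu> B\<close> are
  truncated to \<open>0\<close> by \<open>ennreal\<close>, which does not change the supremum since \<open>B = {}\<close> is allowed.\<close>

definition jordan_pos :: "(real set \<Rightarrow> real) \<Rightarrow> real measure" where
  "jordan_pos \<nu> = measure_of UNIV (sets borel)
     (\<lambda>A. SUP B\<in>{B \<in> bounded_borel. B \<subseteq> A}. ennreal (\<nu> B))"

definition signed_integral :: "(real set \<Rightarrow> real) \<Rightarrow> real set \<Rightarrow> (real \<Rightarrow> real) \<Rightarrow> real" where
  "signed_integral \<nu> A f =
     (LINT s:A|jordan_pos \<nu>. f s) - (LINT s:A|jordan_pos (\<lambda>B. - \<nu> B). f s)"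

definition cmeasure_integral :: "(real set \<Rightarrow> complex) \<Rightarrow> real set \<Rightarrow> (real \<Rightarrow> real) \<Rightarrow> complex" where
  "cmeasure_integral \<mu> A f =
     Complex (signed_integral (\<lambda>B. Re (\<mu> B)) A f) (signed_integral (\<lambda>B. Im (\<mu> B)) A f)"

text \<open>The convolution with a measure is meaningful for almost every \<open>t\<close> only: the integral may
  diverge on a null set (in particular at the atoms of \<open>\<mu>\<close>, where the kernel would be evaluated
  at \<open>0\<close>).\<close>

definition conv_measure :: "(real \<Rightarrow> real) \<Rightarrow> (real set \<Rightarrow> complex) \<Rightarrow> real \<Rightarrow> complex" where
  "conv_measure K \<mu> t = cmeasure_integral \<mu> {0..t} (\<lambda>s. K (t - s))"

subsection \<open>The Riccati--Volterra equation\<close>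

definition riccati :: "real \<Rightarrow> real \<Rightarrow> complex \<Rightarrow> complex" where
  "riccati \<beta> \<sigma> u = complex_of_real \<beta> * u + complex_of_real (\<sigma>\<^sup>2 / 2) * u\<^sup>2"

text \<open>Solutions are elements of \<open>L\<^sup>2\<^sub>l\<^sub>o\<^sub>c\<close>, so membership in \<open>Cminus\<close> and the equation are
  required almost everywhere.\<close>

definition riccati_volterra_solution ::
  "(real \<Rightarrow> real) \<Rightarrow> real \<Rightarrow> real \<Rightarrow> (real set \<Rightarrow> complex) \<Rightarrow> (real \<Rightarrow> complex) \<Rightarrow> bool" where
  "riccati_volterra_solution K \<beta> \<sigma> \<mu> \<psi> \<longleftrightarrow>
     L2_loc \<psi> \<and> (AE t in lborel. t \<ge> 0 \<longrightarrow> \<psi> t \<in> Cminus) \<and>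
     (AE t in lborel. t \<ge> 0 \<longrightarrow>
        \<psi> t = conv_measure K \<mu> t
              + (LINT s:{0..t}|lborel. complex_of_real (K (t - s)) * riccati \<beta> \<sigma> (\<psi> s)))"

subsection \<open>Hoelder and smooth functions on the open half-line\<close>

definition nth_deriv :: "nat \<Rightarrow> (real \<Rightarrow> complex) \<Rightarrow> real \<Rightarrow> complex" where
  "nth_deriv n f = ((\<lambda>g t. vector_derivative g (at t)) ^^ n) f"

definition C_class :: "nat \<Rightarrow> (real \<Rightarrow> complex) \<Rightarrow> bool" where
  "C_class m f \<longleftrightarrow>
     (\<forall>k<m. \<forall>t>0. nth_deriv k f differentiable (at t)) \<and> continuous_on {0<..} (nth_deriv m f)"

definition C_holder :: "nat \<Rightarrow> real \<Rightarrow> (real \<Rightarrow> complex) \<Rightarrow> bool" where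
  "C_holder m \<eta> f \<longleftrightarrow> C_class m f \<and>
     (\<forall>a b. 0 < a \<and> a \<le> b \<longrightarrow> (\<exists>C. \<forall>s\<in>{a..b}. \<forall>t\<in>{a..b}.
        norm (nth_deriv m f s - nth_deriv m f t) \<le> C * \<bar>s - t\<bar> powr \<eta>))"

text \<open>Both \<open>K \<star> \<mu>\<close> and \<open>\<psi>\<close> are determined up to null sets, so regularity of either of them means
  that its equivalence class has a representative with that regularity on \<open>(0, \<infinity>)\<close>; this
  representative is unique there, being continuous.\<close>

definition in_C_holder_Cminus :: "nat \<Rightarrow> real \<Rightarrow> (real \<Rightarrow> complex) \<Rightarrow> bool" where
  "in_C_holder_Cminus m \<eta> f \<longleftrightarrow>
     (\<exists>g. C_holder m \<eta> g \<and> (\<forall>t>0. g t \<in> Cminus) \<and> (AE t in lborel. t > 0 \<longrightarrow> f t = g t))"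

definition in_C_infinity :: "(real \<Rightarrow> complex) \<Rightarrow> bool" where
  "in_C_infinity f \<longleftrightarrow>
     (\<exists>g. (\<forall>m. C_class m g) \<and> (AE t in lborel. t > 0 \<longrightarrow> f t = g t))"

end

theory Submission
  imports Defs
begin

text \<open>
  Let \<open>g\<close> be the regular representative of \<open>K * \<mu>\<close> and write \<open>R\<close> for the quadratic nonlinearity, so that
  $\psi = g + K * R(\psi)$ almost everywhere with $\psi \in L^2_{loc}$.  The proof is a bootstrap in
  this equation, carried by two properties of the kernel.  First, \<open>K\<close> is non-increasing and
  $\int_0^h K^2 \le C h^{2\gamma}$, hence $K(r) \le c\, r^{\kappa-1}$ with $\kappa = \gamma + 1/2 > 1/2$.
  Second, by complete monotonicity the derivatives obey $|K^{(n)}(r)| \le c_n r^{\kappa-1-n}$ (lemma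
  \<open>kderiv_bound\<close>); in particular \<open>K\<close> is smooth away from \<open>0\<close>.

  Splitting at \<open>a > 0\<close>, the integral over \<open>(0, a]\<close> is a smooth function of \<open>t > a\<close> for every
  integrable integrand (\<open>kconv_past_smooth\<close>), so only the integral over \<open>(a, t)\<close> matters.
  There, convolution with \<open>K\<close> improves regularity by almost \<open>\<kappa>\<close>: locally bounded functions
  become continuous, Hoelder exponent \<open>\<theta>\<close> becomes any exponent below \<open>\<theta> + \<kappa>\<close> up to \<open>1\<close>
  (\<open>kconv_gain_holder\<close>), and if \<open>\<theta> + \<kappa> > 1\<close> one derivative is gained
  (\<open>kconv_gain_derivative\<close>).  Both gains come from one estimate of the increment of a
  convolution (\<open>kconv_increment_core\<close>) and pass to higher orders by differentiating the
  convolution, which for differentiable integrands produces only an extra smooth term.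

  The starting point of the bootstrap is local boundedness of \<open>\<psi>\<close> on \<open>(0, \<infinity>)\<close>
  (\<open>solution_locally_bounded\<close>).  It is not obvious, since \<open>R(\<psi>)\<close> is only locally integrable.  The
  equation is restarted at a time \<open>\<epsilon>\<close> where the contribution of the past is not too large; such
  times exist in every interval of length \<open>\<delta>\<close>, with a bound of order $\delta^{-1/2}$, because that
  contribution is square integrable.  After the restart, the distance of \<open>\<psi>\<close> to a
  disc satisfies a homogeneous convolution inequality on a short interval and hence vanishes by a
  contraction argument in $L^2$; here \<open>\<kappa> > 1/2\<close> is exactly what makes the short interval long enough.

  Given boundedness, $f = g + K * R(\psi)$ is a continuous representative of \<open>\<psi>\<close> that satisfies the
  equation at every \<open>t > 0\<close>.  As \<open>R\<close> preserves all Hoelder classes, the gains of regularity raise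
  the regularity of \<open>f\<close> step by step to that of \<open>g\<close>.  The values of \<open>f\<close> lie in the closed
  half-plane, since almost all of them do.
\<close>

section \<open>Hoelder classes on half-lines\<close>

text \<open>The class $C^{m,\theta}$ on a half-line \<open>(a, \<infinity>)\<close>.  Convolution is studied on
  such half-lines because the part of the integral before time \<open>a\<close> is smooth after \<open>a\<close>.  For
  \<open>\<theta> = 0\<close> the Hoelder condition only bounds the oscillation on compact intervals, which
  continuity already gives, so \<open>\<theta> = 0\<close> stands for plain $C^m$; this is compatible with the
  convention \<open>0 powr 0 = 0\<close>, since the left-hand side vanishes on the diagonal.\<close>

definition C_holder_above :: "real \<Rightarrow> nat \<Rightarrow> real \<Rightarrow> (real \<Rightarrow> complex) \<Rightarrow> bool" where
  "C_holder_above a m \<theta> f \<longleftrightarrow>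
     (\<forall>k<m. \<forall>t>a. nth_deriv k f differentiable (at t)) \<and> continuous_on {a<..} (nth_deriv m f) \<and>
     (\<forall>p q. a < p \<and> p \<le> q \<longrightarrow> (\<exists>C. \<forall>s\<in>{p..q}. \<forall>t\<in>{p..q}.
        norm (nth_deriv m f s - nth_deriv m f t) \<le> C * \<bar>s - t\<bar> powr \<theta>))"

lemma C_holder_iff_above: "C_holder m \<eta> f \<longleftrightarrow> C_holder_above 0 m \<eta> f"
  by (auto simp: C_holder_def C_holder_above_def C_class_def)

lemma bounded_on_Icc_above:
  fixes f :: "real \<Rightarrow> complex"
  assumes "continuous_on {a<..} f" "a < p"
  obtains B where "B > 0" "\<And>t. t \<in> {p..q} \<Longrightarrow> norm (f t) \<le> B"
proof -
  have "compact (f ` {p..q})"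
    using assms by (intro compact_continuous_image continuous_on_subset[OF assms(1)]) auto
  then have "bounded (f ` {p..q})" by (rule compact_imp_bounded)
  then obtain B where "B > 0" "\<forall>x\<in>f ` {p..q}. norm x \<le> B"
    by (auto simp: bounded_pos)
  then show ?thesis by (intro that) auto
qed

lemma C_holder_above_0E:
  assumes "C_holder_above a 0 \<theta> f" "a < p"
  obtains C where "C \<ge> 0"
    "\<And>s t. s\<in>{p..q} \<Longrightarrow> t\<in>{p..q} \<Longrightarrow> norm (f s - f t) \<le> C * \<bar>s - t\<bar> powr \<theta>"
proof (cases "p \<le> q")
  case True
  then obtain C where C: "\<forall>s\<in>{p..q}. \<forall>t\<in>{p..q}. norm (f s - f t) \<le> C * \<bar>s - t\<bar> powr \<theta>"
    using assms unfolding C_holder_above_def nth_deriv_def funpow_0 by blast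
  show ?thesis
  proof (rule that[of "\<bar>C\<bar>"])
    show "norm (f s - f t) \<le> \<bar>C\<bar> * \<bar>s - t\<bar> powr \<theta>" if "s\<in>{p..q}" "t\<in>{p..q}" for s t
      using C that by (meson abs_ge_self mult_right_mono order_trans powr_ge_zero)
  qed auto
qed (auto intro: that[of 0])

lemma C_holder_above_exponent_0_iff:
  "C_holder_above a m 0 f \<longleftrightarrow>
     (\<forall>k<m. \<forall>t>a. nth_deriv k f differentiable (at t)) \<and> continuous_on {a<..} (nth_deriv m f)"
proof -
  have "\<exists>C. \<forall>s\<in>{p..q}. \<forall>t\<in>{p..q}. norm (nth_deriv m f s - nth_deriv m f t) \<le> C * \<bar>s - t\<bar> powr 0"
    if cont: "continuous_on {a<..} (nth_deriv m f)" and pq: "a < p \<and> p \<le> q" for p q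
  proof -
    obtain B where B: "\<And>t. t \<in> {p..q} \<Longrightarrow> norm (nth_deriv m f t) \<le> B"
      using bounded_on_Icc_above[OF cont] pq by metis
    have "norm (nth_deriv m f s - nth_deriv m f t) \<le> 2 * B * \<bar>s - t\<bar> powr 0"
      if "s \<in> {p..q}" "t \<in> {p..q}" for s t
      using norm_triangle_ineq4[of "nth_deriv m f s" "nth_deriv m f t"] B[OF that(1)] B[OF that(2)]
      by (cases "s = t") auto
    then show ?thesis by blast
  qed
  then show ?thesis unfolding C_holder_above_def by blast
qed

lemma C_class_iff_above: "C_class m f \<longleftrightarrow> C_holder_above 0 m 0 f"
  by (simp add: C_class_def C_holder_above_exponent_0_iff)

lemma nth_deriv_Suc: "nth_deriv (Suc n) f = nth_deriv n (\<lambda>t. vector_derivative f (at t))"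
  unfolding nth_deriv_def funpow_Suc_right by simp

lemma nth_deriv_0 [simp]: "nth_deriv 0 f = f"
  by (simp add: nth_deriv_def)

lemma C_holder_above_0_0_iff: "C_holder_above a 0 0 f \<longleftrightarrow> continuous_on {a<..} f"
  by (simp add: C_holder_above_exponent_0_iff)

text \<open>Peeling off the innermost derivative makes inductions on the order possible.\<close>

lemma C_holder_above_Suc:
  "C_holder_above a (Suc m) \<theta> f \<longleftrightarrow>
     (\<forall>t>a. f differentiable (at t)) \<and> C_holder_above a m \<theta> (\<lambda>t. vector_derivative f (at t))"
  unfolding C_holder_above_def nth_deriv_Suc All_less_Suc2 by auto

lemma nth_deriv_cong:
  assumes "\<And>t. t > a \<Longrightarrow> f t = g t" "t > a"
  shows "nth_deriv m f t = nth_deriv m g t"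
  using assms
proof (induction m arbitrary: f g t)
  case (Suc m)
  show ?case unfolding nth_deriv_Suc
  proof (rule Suc.IH[OF _ \<open>t > a\<close>])
    fix s :: real assume "s > a"
    show "vector_derivative f (at s) = vector_derivative g (at s)"
      by (rule vector_derivative_cong_eq[OF _ refl refl])
        (use Suc.prems \<open>s > a\<close> in \<open>auto intro!: eventually_mono[OF eventually_gt_at_top] 
           simp: eventually_at_filter intro: eventually_mono[OF eventually_nhds_in_open[of "{a<..}"]]\<close>)
  qed
qed simp

lemma differentiable_cong_above:
  fixes f g :: "real \<Rightarrow> complex"
  assumes "\<And>t. t > a \<Longrightarrow> f t = g t" "t > a" "f differentiable (at t)"
  shows "g differentiable (at t)"
  using assms(3) unfolding differentiable_def
  by (metis assms(1,2) has_derivative_transform_within_open greaterThan_iff open_greaterThan)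

lemma C_holder_above_cong:
  assumes "\<And>t. t > a \<Longrightarrow> f t = g t" "C_holder_above a m \<theta> f"
  shows "C_holder_above a m \<theta> g"
  unfolding C_holder_above_def
proof (intro conjI allI impI)
  have eq: "nth_deriv k f t = nth_deriv k g t" if "t > a" for k t
    using nth_deriv_cong[OF assms(1) that] .
  show "nth_deriv k g differentiable at t" if "k < m" "a < t" for k t
    using assms(2) that by (intro differentiable_cong_above[OF eq]) (auto simp: C_holder_above_def)
  show "continuous_on {a<..} (nth_deriv m g)"
    using assms(2) continuous_on_cong[of "{a<..}" "{a<..}" "nth_deriv m f" "nth_deriv m g"] eq
    by (simp add: C_holder_above_def)
  fix p q assume pq: "a < p \<and> p \<le> q"
  then obtain C where "\<forall>s\<in>{p..q}. \<forall>t\<in>{p..q}.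
        norm (nth_deriv m f s - nth_deriv m f t) \<le> C * \<bar>s - t\<bar> powr \<theta>"
    using assms(2) unfolding C_holder_above_def by blast
  then show "\<exists>C. \<forall>s\<in>{p..q}. \<forall>t\<in>{p..q}.
        norm (nth_deriv m g s - nth_deriv m g t) \<le> C * \<bar>s - t\<bar> powr \<theta>"
    using pq eq by (intro exI[of _ C]) auto
qed

lemma C_holder_above_SucI:
  assumes "\<And>t. t > a \<Longrightarrow> (f has_vector_derivative f' t) (at t)" "C_holder_above a m \<theta> f'"
  shows "C_holder_above a (Suc m) \<theta> f"
  unfolding C_holder_above_Suc
proof
  show "\<forall>t>a. f differentiable (at t)"
    using assms(1) differentiableI_vector by blast
  show "C_holder_above a m \<theta> (\<lambda>t. vector_derivative f (at t))"
    by (rule C_holder_above_cong[OF _ assms(2)]) (metis assms(1) vector_derivative_at)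
qed

lemma C_holder_above_SucE:
  assumes "C_holder_above a (Suc m) \<theta> f"
  obtains f' where "\<And>t. t > a \<Longrightarrow> (f has_vector_derivative f' t) (at t)" "C_holder_above a m \<theta> f'"
proof (rule that[of "\<lambda>t. vector_derivative f (at t)"])
  show "(f has_vector_derivative vector_derivative f (at t)) (at t)" if "t > a" for t
    using assms that unfolding C_holder_above_Suc by (auto simp: vector_derivative_works)
  show "C_holder_above a m \<theta> (\<lambda>t. vector_derivative f (at t))"
    using assms unfolding C_holder_above_Suc by blast
qed

text \<open>Every compact subset of \<open>(0, \<infinity>)\<close> lies in some \<open>(a, \<infinity>)\<close> with \<open>a > 0\<close>.\<close>

lemma C_holder_above_local:
  assumes "\<And>a. a > 0 \<Longrightarrow> C_holder_above a m \<theta> f"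
  shows "C_holder_above 0 m \<theta> f"
  unfolding C_holder_above_def
proof (intro conjI allI impI)
  show "nth_deriv k f differentiable at t" if "k < m" "0 < t" for k t
    using assms[of "t / 2"] that by (auto simp: C_holder_above_def)
  show "continuous_on {0<..} (nth_deriv m f)"
  proof (rule continuous_at_imp_continuous_on, rule ballI)
    fix t :: real assume t: "t \<in> {0<..}"
    have "continuous_on {t/2<..} (nth_deriv m f)"
      using assms[of "t / 2"] t by (auto simp: C_holder_above_def)
    then show "isCont (nth_deriv m f) t"
      using t by (auto simp: continuous_on_eq_continuous_at)
  qed
  show "\<exists>C. \<forall>s\<in>{p..q}. \<forall>t\<in>{p..q}.
        norm (nth_deriv m f s - nth_deriv m f t) \<le> C * \<bar>s - t\<bar> powr \<theta>"
    if "0 < p \<and> p \<le> q" for p q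
    using assms[of "p / 2"] that by (auto simp: C_holder_above_def)
qed

lemma abs_powr_weaken:
  fixes s t :: real
  assumes "s \<in> {p..q}" "t \<in> {p..q}" "\<rho> \<le> \<theta>"
  shows "\<bar>s - t\<bar> powr \<theta> \<le> (q - p) powr (\<theta> - \<rho>) * \<bar>s - t\<bar> powr \<rho>"
proof (cases "s = t")
  case False
  then have "\<bar>s - t\<bar> powr \<theta> = \<bar>s - t\<bar> powr (\<theta> - \<rho>) * \<bar>s - t\<bar> powr \<rho>"
    by (simp flip: powr_add)
  also have "\<dots> \<le> (q - p) powr (\<theta> - \<rho>) * \<bar>s - t\<bar> powr \<rho>"
    using assms by (intro mult_right_mono powr_mono2) auto
  finally show ?thesis .
qed simp

lemma C_holder_above_weaken:
  assumes f: "C_holder_above a m \<theta> f" and "\<rho> \<le> \<theta>"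
  shows "C_holder_above a m \<rho> f"
  unfolding C_holder_above_def
proof (intro conjI allI impI)
  fix p q assume pq: "a < p \<and> p \<le> q"
  then obtain C where C: "\<And>s t. s\<in>{p..q} \<Longrightarrow> t\<in>{p..q} \<Longrightarrow>
        norm (nth_deriv m f s - nth_deriv m f t) \<le> C * \<bar>s - t\<bar> powr \<theta>"
    using assms(1) unfolding C_holder_above_def by blast
  have "norm (nth_deriv m f s - nth_deriv m f t) \<le> (\<bar>C\<bar> * (q - p) powr (\<theta> - \<rho>)) * \<bar>s - t\<bar> powr \<rho>"
    if st: "s\<in>{p..q}" "t\<in>{p..q}" for s t
  proof -
    have "norm (nth_deriv m f s - nth_deriv m f t) \<le> \<bar>C\<bar> * \<bar>s - t\<bar> powr \<theta>"
      using C[OF st] by (meson abs_ge_self mult_right_mono order_trans powr_ge_zero)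
    also have "\<dots> \<le> \<bar>C\<bar> * ((q - p) powr (\<theta> - \<rho>) * \<bar>s - t\<bar> powr \<rho>)"
      by (intro mult_left_mono abs_powr_weaken[OF st \<open>\<rho> \<le> \<theta>\<close>]) auto
    finally show ?thesis by (simp add: mult_ac)
  qed
  then show "\<exists>C. \<forall>s\<in>{p..q}. \<forall>t\<in>{p..q}.
        norm (nth_deriv m f s - nth_deriv m f t) \<le> C * \<bar>s - t\<bar> powr \<rho>" by blast
qed (use f in \<open>auto simp: C_holder_above_def\<close>)

lemma C_holder_above_0_if_C1:
  assumes der: "\<And>t. t > a \<Longrightarrow> (f has_vector_derivative f' t) (at t)"
    and cont: "continuous_on {a<..} f'" and "\<rho> \<le> 1"
  shows "C_holder_above a 0 \<rho> f"
proof -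
  have "C_holder_above a 0 1 f"
    unfolding C_holder_above_def
  proof (intro conjI allI impI)
    show "continuous_on {a<..} (nth_deriv 0 f)"
      by (auto intro!: continuous_at_imp_continuous_on der has_vector_derivative_continuous)
    fix p q assume pq: "a < p \<and> p \<le> q"
    obtain B where B: "\<And>t. t \<in> {p..q} \<Longrightarrow> norm (f' t) \<le> B"
      using bounded_on_Icc_above[OF cont] pq by blast
    have B0: "0 \<le> B" if "x \<in> {p..q}" for x
      using B[OF that] norm_ge_zero[of "f' x"] by linarith
    have "norm (f s - f t) \<le> B * norm (s - t)" if "s\<in>{p..q}" "t\<in>{p..q}" for s t
      by (rule differentiable_bound[of "{p..q}" f "\<lambda>t h. h *\<^sub>R f' t"])
        (use that pq B in \<open>auto intro!: onorm_bound has_vector_derivative_at_within[OF der, unfolded has_vector_derivative_def] simp: mult.commute[of B] mult_left_mono intro: B0\<close>)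
    then show "\<exists>C. \<forall>s\<in>{p..q}. \<forall>t\<in>{p..q}.
        norm (nth_deriv 0 f s - nth_deriv 0 f t) \<le> C * \<bar>s - t\<bar> powr 1"
      by (intro exI[of _ B]) auto
  qed auto
  then show ?thesis using assms(3) by (rule C_holder_above_weaken)
qed

lemma continuous_on_if_C_holder_above:
  assumes "C_holder_above a m \<theta> f" shows "continuous_on {a<..} f"
proof (cases m)
  case 0 then show ?thesis using assms by (auto simp: C_holder_above_def)
next
  case (Suc n)
  have "isCont f t" if "t > a" for t
    using assms that unfolding Suc C_holder_above_Suc
    by (auto intro: differentiable_imp_continuous_within)
  then show ?thesis by (auto intro: continuous_at_imp_continuous_on)
qed

lemma C_holder_above_lower:
  assumes "C_holder_above a (Suc m) \<theta> f" "\<rho> \<le> 1"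
  shows "C_holder_above a m \<rho> f"
  using assms(1)
proof (induction m arbitrary: f)
  case 0
  then obtain f' where "\<And>t. t > a \<Longrightarrow> (f has_vector_derivative f' t) (at t)" "C_holder_above a 0 \<theta> f'"
    by (rule C_holder_above_SucE) blast
  then show ?case
    using C_holder_above_0_if_C1[OF _ continuous_on_if_C_holder_above assms(2)] by blast
next
  case (Suc m)
  obtain f' where "\<And>t. t > a \<Longrightarrow> (f has_vector_derivative f' t) (at t)" "C_holder_above a (Suc m) \<theta> f'"
    using Suc.prems by (rule C_holder_above_SucE) blast
  then show ?case using C_holder_above_SucI Suc.IH by blast
qed

text \<open>A convenient form of smoothness: the derivatives are given in advance, as a sequence.\<close>

lemma C_holder_above_smooth_family:
  assumes "\<And>n t. t > a \<Longrightarrow> (F n has_vector_derivative F (Suc n) t) (at t)" "\<theta> \<le> 1"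
  shows "C_holder_above a m \<theta> (F n)"
proof (induction m arbitrary: n)
  case 0
  show ?case
    by (rule C_holder_above_0_if_C1[of a "F n" "F (Suc n)"])
      (auto intro!: continuous_at_imp_continuous_on assms has_vector_derivative_continuous)
next
  case (Suc m)
  show ?case by (rule C_holder_above_SucI[of a "F n" "F (Suc n)"]) (auto intro: assms Suc)
qed

lemma C_holder_above_add:
  assumes "C_holder_above a m \<theta> f" "C_holder_above a m \<theta> g"
  shows "C_holder_above a m \<theta> (\<lambda>t. f t + g t)"
  using assms
proof (induction m arbitrary: f g)
  case 0
  show ?case unfolding C_holder_above_def nth_deriv_0
  proof (intro conjI allI impI)
    show "continuous_on {a<..} (\<lambda>t. f t + g t)"
      using 0 by (auto simp: C_holder_above_def intro!: continuous_intros)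
    fix p q assume pq: "a < p \<and> p \<le> q"
    obtain C1 where C1: "\<And>s t. s\<in>{p..q} \<Longrightarrow> t\<in>{p..q} \<Longrightarrow> norm (f s - f t) \<le> C1 * \<bar>s - t\<bar> powr \<theta>"
      using C_holder_above_0E[OF 0(1)] pq by blast
    obtain C2 where C2: "\<And>s t. s\<in>{p..q} \<Longrightarrow> t\<in>{p..q} \<Longrightarrow> norm (g s - g t) \<le> C2 * \<bar>s - t\<bar> powr \<theta>"
      using C_holder_above_0E[OF 0(2)] pq by blast
    have "norm (f s + g s - (f t + g t)) \<le> (C1 + C2) * \<bar>s - t\<bar> powr \<theta>"
      if st: "s\<in>{p..q}" "t\<in>{p..q}" for s t
      using norm_diff_triangle_ineq[of "f s" "g s" "f t" "g t"] C1[OF st] C2[OF st]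
      by (simp add: distrib_right)
    then show "\<exists>C. \<forall>s\<in>{p..q}. \<forall>t\<in>{p..q}. norm (f s + g s - (f t + g t)) \<le> C * \<bar>s - t\<bar> powr \<theta>"
      by blast
  qed auto
next
  case (Suc m)
  obtain f' where f': "\<And>t. t > a \<Longrightarrow> (f has_vector_derivative f' t) (at t)" "C_holder_above a m \<theta> f'"
    using Suc.prems(1) by (rule C_holder_above_SucE) blast
  obtain g' where g': "\<And>t. t > a \<Longrightarrow> (g has_vector_derivative g' t) (at t)" "C_holder_above a m \<theta> g'"
    using Suc.prems(2) by (rule C_holder_above_SucE) blast
  show ?case
    by (rule C_holder_above_SucI[of a _ "\<lambda>t. f' t + g' t"])
      (auto intro!: derivative_intros f' g' Suc.IH)
qed

lemma C_holder_above_mult: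
  assumes "C_holder_above a m \<theta> f" "C_holder_above a m \<theta> g" "\<theta> \<le> 1"
  shows "C_holder_above a m \<theta> (\<lambda>t. f t * g t)"
  using assms(1,2)
proof (induction m arbitrary: f g)
  case 0
  show ?case unfolding C_holder_above_def nth_deriv_0
  proof (intro conjI allI impI)
    have cont: "continuous_on {a<..} f" "continuous_on {a<..} g"
      using 0 by (auto simp: C_holder_above_def)
    then show "continuous_on {a<..} (\<lambda>t. f t * g t)"
      by (auto intro!: continuous_intros)
    fix p q assume pq: "a < p \<and> p \<le> q"
    obtain C1 where C1: "\<And>s t. s\<in>{p..q} \<Longrightarrow> t\<in>{p..q} \<Longrightarrow> norm (f s - f t) \<le> C1 * \<bar>s - t\<bar> powr \<theta>"
      using C_holder_above_0E[OF 0(1)] pq by blast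
    obtain C2 where C2: "\<And>s t. s\<in>{p..q} \<Longrightarrow> t\<in>{p..q} \<Longrightarrow> norm (g s - g t) \<le> C2 * \<bar>s - t\<bar> powr \<theta>"
      using C_holder_above_0E[OF 0(2)] pq by blast
    obtain B1 where B1: "B1 > 0" "\<And>t. t \<in> {p..q} \<Longrightarrow> norm (f t) \<le> B1"
      using bounded_on_Icc_above[OF cont(1)] pq by blast
    obtain B2 where B2: "B2 > 0" "\<And>t. t \<in> {p..q} \<Longrightarrow> norm (g t) \<le> B2"
      using bounded_on_Icc_above[OF cont(2)] pq by blast
    have "norm (f s * g s - f t * g t) \<le> (B1 * C2 + C1 * B2) * \<bar>s - t\<bar> powr \<theta>"
      if st: "s\<in>{p..q}" "t\<in>{p..q}" for s t
    proof -
      have "f s * g s - f t * g t = f s * (g s - g t) + (f s - f t) * g t"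
        by (simp add: algebra_simps)
      also have "norm \<dots> \<le> norm (f s) * norm (g s - g t) + norm (f s - f t) * norm (g t)"
        by (metis norm_mult norm_triangle_ineq)
      also have "\<dots> \<le> B1 * (C2 * \<bar>s - t\<bar> powr \<theta>) + (C1 * \<bar>s - t\<bar> powr \<theta>) * B2"
        using B1(1) B1(2)[OF st(1)] B2(2)[OF st(2)] C1[OF st] C2[OF st]
        by (intro add_mono mult_mono) (auto intro: order_trans[OF norm_ge_zero])
      finally show ?thesis by (simp add: algebra_simps)
    qed
    then show "\<exists>C. \<forall>s\<in>{p..q}. \<forall>t\<in>{p..q}. norm (f s * g s - f t * g t) \<le> C * \<bar>s - t\<bar> powr \<theta>"
      by blast
  qed auto
next
  case (Suc m)
  obtain f' where f': "\<And>t. t > a \<Longrightarrow> (f has_vector_derivative f' t) (at t)" "C_holder_above a m \<theta> f'"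
    using Suc.prems(1) by (rule C_holder_above_SucE) blast
  obtain g' where g': "\<And>t. t > a \<Longrightarrow> (g has_vector_derivative g' t) (at t)" "C_holder_above a m \<theta> g'"
    using Suc.prems(2) by (rule C_holder_above_SucE) blast
  have "C_holder_above a m \<theta> f" "C_holder_above a m \<theta> g"
    using Suc.prems assms(3) C_holder_above_lower by blast+
  then show ?case
    by (intro C_holder_above_SucI[of a _ "\<lambda>t. f t * g' t + f' t * g t"])
      (auto intro!: has_vector_derivative_mult f' g' Suc.IH C_holder_above_add)
qed

lemma C_holder_above_const: "\<theta> \<le> 1 \<Longrightarrow> C_holder_above a m \<theta> (\<lambda>t. c)"
  using C_holder_above_smooth_family[of a "\<lambda>n t. if n = 0 then c else 0" \<theta> m 0] by auto

lemma C_holder_above_riccati: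
  assumes "C_holder_above a m \<theta> f" "\<theta> \<le> 1"
  shows "C_holder_above a m \<theta> (\<lambda>t. riccati \<beta> \<sigma> (f t))"
  unfolding riccati_def power2_eq_square
  by (intro C_holder_above_add C_holder_above_mult C_holder_above_const assms)

section \<open>Power integrals and interpolation\<close>

lemma has_bochner_integral_powr_from_0:
  fixes b p :: real
  assumes "p > -1" "b \<ge> 0"
  shows "has_bochner_integral lborel (\<lambda>r. indicator {0<..<b} r * r powr p) (b powr (p + 1) / (p + 1))"
proof (rule has_bochner_integral_nn_integral)
  have "(\<integral>\<^sup>+x. ennreal (indicator {0<..<b} x * x powr p) \<partial>lborel) = (\<integral>\<^sup>+x. ennreal (indicator {0..b} x * x powr p) \<partial>lborel)"
  proof (rule nn_integral_cong_AE)
    have "AE x in lborel. x \<noteq> (0::real)" "AE x in lborel. x \<noteq> b"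
      by (rule AE_lborel_singleton)+
    then show "AE x in lborel. ennreal (indicator {0<..<b} x * x powr p) = ennreal (indicator {0..b} x * x powr p)"
      by eventually_elim (auto simp: indicator_def)
  qed
  also have "\<dots> = ennreal (b powr (p + 1) / (p + 1))"
  proof (rule nn_integral_has_integral_lborel)
    have "(\<lambda>x. indicator {0..b} x * x powr p) = (\<lambda>x. if x \<in> {0..b} then x powr p else 0)"
      by (auto simp: fun_eq_iff)
    then show "((\<lambda>x. indicator {0..b} x * x powr p) has_integral b powr (p + 1) / (p + 1)) UNIV"
      using has_integral_powr_from_0[OF assms] by (simp only: has_integral_restrict_UNIV)
  qed auto
  finally show "(\<integral>\<^sup>+x. ennreal (indicator {0<..<b} x * x powr p) \<partial>lborel) = ennreal (b powr (p + 1) / (p + 1))" .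
qed (use assms in auto)

text \<open>All singular integrands below are dominated by powers of the distance to the right end point.\<close>

lemma has_bochner_integral_powr_reflected:
  fixes a t p :: real
  assumes "p > -1" "a \<le> t"
  shows "has_bochner_integral lborel (\<lambda>s. indicator {a<..<t} s * (t - s) powr p)
           ((t - a) powr (p + 1) / (p + 1))"
proof -
  have "has_bochner_integral lborel
      (\<lambda>s. indicator {0<..<t - a} (t + (-1) * s) * (t + (-1) * s) powr p)
      (((t - a) powr (p + 1) / (p + 1)) /\<^sub>R \<bar>- 1\<bar>)"
    by (subst lborel_has_bochner_integral_real_affine_iff[symmetric])
       (use has_bochner_integral_powr_from_0[of p "t - a"] assms in auto)
  also have "(\<lambda>s. indicator {0<..<t - a} (t + (-1) * s) * (t + (-1) * s) powr p) =
      (\<lambda>s. indicator {a<..<t} s * (t - s) powr p)"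
    by (auto simp: fun_eq_iff indicator_def)
  finally show ?thesis by simp
qed

text \<open>If \<open>h \<le> r\<close> the second bound is used, otherwise the first.\<close>

lemma le_mult_powr_interpolate:
  fixes x A h r \<rho> :: real
  assumes "x \<le> A" "x \<le> A * (h / r)" "0 \<le> A" "0 < h" "0 < r" "0 \<le> \<rho>" "\<rho> \<le> 1"
  shows "x \<le> A * (h powr \<rho> * r powr (- \<rho>))"
proof -
  have eq: "h powr \<rho> * r powr (- \<rho>) = (h / r) powr \<rho>"
    using assms by (simp add: powr_divide powr_minus field_simps)
  show ?thesis
  proof (cases "h \<le> r")
    case True
    then have "(h / r) powr 1 \<le> (h / r) powr \<rho>"
      using assms by (intro powr_mono') auto
    then have "A * (h / r) \<le> A * (h / r) powr \<rho>"
      using assms by (intro mult_left_mono) auto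
    then show ?thesis using assms eq by auto
  next
    case False
    then have "1 \<le> (h / r) powr \<rho>" using assms by (intro ge_one_powr_ge_zero) auto
    then have "A * 1 \<le> A * (h / r) powr \<rho>"
      using assms by (intro mult_left_mono) auto
    then show ?thesis using assms eq by auto
  qed
qed

section \<open>Completely monotone kernels with a power bound\<close>

locale cm_kernel =
  fixes K :: "real \<Rightarrow> real" and c \<kappa> :: real
  assumes cm: "completely_monotone K"
    and K_le: "r > 0 \<Longrightarrow> K r \<le> c * r powr (\<kappa> - 1)"
    and \<kappa>_pos: "\<kappa> > 0"
begin

text \<open>The \<open>n\<close>-th derivative of the kernel, extended by \<open>0\<close> to \<open>r \<le> 0\<close>.  With this extension the
  convolution over \<open>(a, t)\<close> becomes an integral over the fixed set \<open>(a, \<infinity>)\<close>, the kernel is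
  Borel measurable, and the arbitrary value \<open>K 0\<close> disappears.\<close>

definition kderiv :: "nat \<Rightarrow> real \<Rightarrow> real" where
  "kderiv n r = (if r > 0 then (deriv ^^ n) K r else 0)"

lemma kderiv_nonpos [simp]: "r \<le> 0 \<Longrightarrow> kderiv n r = 0"
  by (simp add: kderiv_def)

lemma kderiv_sign: "0 \<le> (-1) ^ n * kderiv n r"
  using cm by (auto simp: kderiv_def completely_monotone_def)

lemma kderiv_has_real_derivative:
  assumes "r > 0"
  shows "(kderiv n has_real_derivative kderiv (Suc n) r) (at r)"
proof -
  have "(deriv ^^ n) K differentiable (at r)"
    using cm assms by (auto simp: completely_monotone_def)
  then have "((deriv ^^ n) K has_real_derivative deriv ((deriv ^^ n) K) r) (at r)"
    by (simp add: DERIV_deriv_iff_real_differentiable)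
  then have "(kderiv n has_real_derivative deriv ((deriv ^^ n) K) r) (at r)"
    by (rule has_field_derivative_transform_within_open[of _ _ _ "{0<..}"])
       (use assms in \<open>auto simp: kderiv_def\<close>)
  then show ?thesis using assms by (simp add: kderiv_def)
qed

lemma continuous_on_kderiv: "continuous_on {0<..} (kderiv n)"
  by (auto intro!: continuous_at_imp_continuous_on DERIV_isCont[OF kderiv_has_real_derivative])

lemma kderiv_measurable [measurable]: "kderiv n \<in> borel_measurable borel"
proof -
  have "(\<lambda>r. indicator {0<..} r *\<^sub>R kderiv n r) \<in> borel_measurable borel"
    by (rule borel_measurable_continuous_on_indicator[OF _ continuous_on_kderiv]) auto
  also have "(\<lambda>r. indicator {0<..} r *\<^sub>R kderiv n r) = kderiv n"
    by (auto simp: indicator_def fun_eq_iff)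
  finally show ?thesis .
qed

lemma kderiv_abs: "\<bar>kderiv n r\<bar> = (-1) ^ n * kderiv n r"
proof -
  have "\<bar>kderiv n r\<bar> = \<bar>(-1) ^ n * kderiv n r\<bar>" by (simp add: abs_mult)
  then show ?thesis using kderiv_sign by simp
qed

lemma kderiv_mvt:
  assumes "0 < r" "r < s"
  obtains z where "r < z" "z < s" "kderiv n s - kderiv n r = (s - r) * kderiv (Suc n) z"
  using MVT2[of r s "kderiv n" "kderiv (Suc n)"] assms kderiv_has_real_derivative by fastforce

lemma kderiv_abs_antimono:
  assumes "0 < r" "r \<le> s"
  shows "\<bar>kderiv n s\<bar> \<le> \<bar>kderiv n r\<bar>"
proof (cases "r = s")
  case False
  then obtain z where z: "r < z" "z < s" "kderiv n s - kderiv n r = (s - r) * kderiv (Suc n) z"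
    using kderiv_mvt assms by (metis order_le_less)
  have "\<bar>kderiv n s\<bar> - \<bar>kderiv n r\<bar> = (-1) ^ n * (kderiv n s - kderiv n r)"
    by (simp add: kderiv_abs algebra_simps)
  also have "\<dots> = - ((s - r) * ((-1) ^ Suc n * kderiv (Suc n) z))"
    by (simp add: z)
  also have "\<dots> \<le> 0" using kderiv_sign[of "Suc n" z] assms by (simp add: mult_nonneg_nonneg del: power_Suc)
  finally show ?thesis by simp
qed simp

lemma kderiv_0_nonneg: "0 \<le> kderiv 0 r" using kderiv_sign[of 0 r] by simp

lemma kderiv_0_antimono: "0 < r \<Longrightarrow> r \<le> s \<Longrightarrow> kderiv 0 s \<le> kderiv 0 r"
  using kderiv_abs_antimono[of r s 0] kderiv_0_nonneg by simp

text \<open>Monotonicity of \<open>\<bar>K\<^bsup>(n+1)\<^esup>\<bar>\<close> and the mean value theorem on \<open>[r/2, r]\<close> give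
  \<open>(r/2) \<bar>K\<^bsup>(n+1)\<^esup>(r)\<bar> \<le> \<bar>K\<^bsup>(n)\<^esup>(r/2)\<bar>\<close>, so each derivative costs one power of \<open>r\<close>.\<close>

lemma kderiv_bound: "\<exists>C>0. \<forall>r>0. \<bar>kderiv n r\<bar> \<le> C * r powr (\<kappa> - 1 - n)"
proof (induction n)
  case 0
  have "\<bar>kderiv 0 r\<bar> \<le> (\<bar>c\<bar> + 1) * r powr (\<kappa> - 1)" if "r > 0" for r
  proof -
    have "\<bar>kderiv 0 r\<bar> = K r" using that by (simp add: kderiv_abs) (simp add: kderiv_def)
    also have "\<dots> \<le> c * r powr (\<kappa> - 1)" using K_le that by blast
    also have "\<dots> \<le> (\<bar>c\<bar> + 1) * r powr (\<kappa> - 1)" by (intro mult_right_mono) auto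
    finally show ?thesis .
  qed
  then show ?case by (intro exI[of _ "\<bar>c\<bar> + 1"]) auto
next
  case (Suc n)
  then obtain C where C: "C > 0" "\<And>r. r > 0 \<Longrightarrow> \<bar>kderiv n r\<bar> \<le> C * r powr (\<kappa> - 1 - n)" by blast
  define C' where "C' = 2 * C * (1/2) powr (\<kappa> - 1 - n)"
  have "\<bar>kderiv (Suc n) r\<bar> \<le> C' * r powr (\<kappa> - 1 - Suc n)" if r: "r > 0" for r
  proof -
    obtain z where z: "r/2 < z" "z < r" "kderiv n r - kderiv n (r/2) = (r - r/2) * kderiv (Suc n) z"
      using kderiv_mvt[of "r/2" r n] r by auto
    have "r / 2 * \<bar>kderiv (Suc n) r\<bar> \<le> r / 2 * \<bar>kderiv (Suc n) z\<bar>"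
      using z r by (intro mult_left_mono kderiv_abs_antimono) auto
    also have "\<dots> = \<bar>(r - r/2) * kderiv (Suc n) z\<bar>" using r by (simp add: abs_mult)
    also have "\<dots> = \<bar>kderiv n r - kderiv n (r/2)\<bar>" by (simp only: z(3))
    also have "\<dots> = \<bar>\<bar>kderiv n r\<bar> - \<bar>kderiv n (r/2)\<bar>\<bar>"
      by (simp add: kderiv_abs abs_mult flip: right_diff_distrib)
    also have "\<dots> \<le> \<bar>kderiv n (r/2)\<bar>" using kderiv_abs_antimono[of "r/2" r n] r by auto
    also have "\<dots> \<le> C * (r/2) powr (\<kappa> - 1 - n)" using C r by auto
    also have "\<dots> = r / 2 * (C' * r powr (\<kappa> - 1 - Suc n))"
    proof -
      have "r powr (\<kappa> - 1 - n) = r * r powr (\<kappa> - 1 - Suc n)"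
        using r powr_add[of r 1 "\<kappa> - 1 - Suc n"] by (simp add: algebra_simps)
      moreover have "(r/2) powr (\<kappa> - 1 - n) = r powr (\<kappa> - 1 - n) * (1/2) powr (\<kappa> - 1 - n)"
        using r by (subst powr_mult[symmetric]) auto
      ultimately show ?thesis by (simp add: C'_def)
    qed
    finally show ?thesis using r by simp
  qed
  moreover have "C' > 0" using C by (simp add: C'_def)
  ultimately show ?case by blast
qed

text \<open>The increment is bounded both by the size of the function and, by the mean value theorem, by
  \<open>h\<close> times the size of its derivative; interpolation trades powers of \<open>h\<close> for powers of \<open>r\<close>.\<close>

lemma kderiv_increment:
  assumes "0 \<le> \<rho>" "\<rho> \<le> 1"
  shows "\<exists>C>0. \<forall>r>0. \<forall>h>0. \<bar>kderiv n (r + h) - kderiv n r\<bar> \<le> C * (h powr \<rho> * r powr (\<kappa> - 1 - n - \<rho>))"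
proof -
  obtain C1 where C1: "C1 > 0" "\<And>r. r > 0 \<Longrightarrow> \<bar>kderiv n r\<bar> \<le> C1 * r powr (\<kappa> - 1 - n)"
    using kderiv_bound by blast
  obtain C2 where C2: "C2 > 0" "\<And>r. r > 0 \<Longrightarrow> \<bar>kderiv (Suc n) r\<bar> \<le> C2 * r powr (\<kappa> - 1 - Suc n)"
    using kderiv_bound by blast
  define C where "C = max C1 C2"
  have "\<bar>kderiv n (r + h) - kderiv n r\<bar> \<le> C * (h powr \<rho> * r powr (\<kappa> - 1 - n - \<rho>))"
    if r: "r > 0" and h: "h > 0" for r h
  proof -
    have "\<bar>kderiv n (r + h) - kderiv n r\<bar> \<le> (C * r powr (\<kappa> - 1 - n)) * (h powr \<rho> * r powr (- \<rho>))"
    proof (rule le_mult_powr_interpolate)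
      have "\<bar>kderiv n (r + h) - kderiv n r\<bar> = \<bar>\<bar>kderiv n (r + h)\<bar> - \<bar>kderiv n r\<bar>\<bar>"
        by (simp add: kderiv_abs abs_mult flip: right_diff_distrib)
      also have "\<dots> \<le> \<bar>kderiv n r\<bar>" using kderiv_abs_antimono[of r "r + h" n] r h by auto
      also have "\<dots> \<le> C1 * r powr (\<kappa> - 1 - n)" using C1 r by blast
      also have "\<dots> \<le> C * r powr (\<kappa> - 1 - n)" by (intro mult_right_mono) (auto simp: C_def)
      finally show "\<bar>kderiv n (r + h) - kderiv n r\<bar> \<le> C * r powr (\<kappa> - 1 - n)" .
      obtain z where z: "r < z" "z < r + h" "kderiv n (r + h) - kderiv n r = (r + h - r) * kderiv (Suc n) z"
        using kderiv_mvt[of r "r + h" n] r h by auto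
      have "\<bar>kderiv n (r + h) - kderiv n r\<bar> = h * \<bar>kderiv (Suc n) z\<bar>" using z h by (simp add: abs_mult)
      also have "\<dots> \<le> h * \<bar>kderiv (Suc n) r\<bar>" using z h r by (intro mult_left_mono kderiv_abs_antimono) auto
      also have "\<dots> \<le> h * (C2 * r powr (\<kappa> - 1 - Suc n))"
        using C2 r h by (intro mult_left_mono) auto
      also have "\<dots> \<le> h * (C * r powr (\<kappa> - 1 - Suc n))"
        using h by (intro mult_left_mono mult_right_mono) (auto simp: C_def)
      also have "r powr (\<kappa> - 1 - Suc n) = r powr (\<kappa> - 1 - n) / r"
        using r powr_diff[of r "\<kappa> - 1 - n" 1] by (simp add: algebra_simps)
      finally show "\<bar>kderiv n (r + h) - kderiv n r\<bar> \<le> C * r powr (\<kappa> - 1 - n) * (h / r)"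
        by (simp add: mult_ac)
    qed (use r h assms C1 C2 in \<open>auto simp: C_def max_def\<close>)
    also have "\<dots> = C * (h powr \<rho> * r powr (\<kappa> - 1 - n - \<rho>))"
      using r by (simp add: powr_diff powr_minus divide_inverse)
    finally show ?thesis .
  qed
  moreover have "C > 0" using C1 by (simp add: C_def)
  ultimately show ?thesis by blast
qed

lemma kderiv_taylor:
  assumes "0 \<le> \<rho>" "\<rho> \<le> 1"
  shows "\<exists>C>0. \<forall>r>0. \<forall>h>0. \<bar>kderiv n (r + h) - kderiv n r - h * kderiv (Suc n) r\<bar>
     \<le> C * (h powr (1 + \<rho>) * r powr (\<kappa> - 2 - n - \<rho>))"
proof -
  obtain C where C: "C > 0" "\<And>r h. r > 0 \<Longrightarrow> h > 0 \<Longrightarrow>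
     \<bar>kderiv (Suc n) (r + h) - kderiv (Suc n) r\<bar> \<le> C * (h powr \<rho> * r powr (\<kappa> - 1 - Suc n - \<rho>))"
    using kderiv_increment[OF assms, of "Suc n"] by blast
  have "\<bar>kderiv n (r + h) - kderiv n r - h * kderiv (Suc n) r\<bar> \<le> C * (h powr (1 + \<rho>) * r powr (\<kappa> - 2 - n - \<rho>))"
    if r: "r > 0" and h: "h > 0" for r h
  proof -
    obtain z where z: "r < z" "z < r + h" "kderiv n (r + h) - kderiv n r = (r + h - r) * kderiv (Suc n) z"
      using kderiv_mvt[of r "r + h" n] r h by auto
    have "\<bar>kderiv n (r + h) - kderiv n r - h * kderiv (Suc n) r\<bar> = h * \<bar>kderiv (Suc n) z - kderiv (Suc n) r\<bar>"
      using z h by (simp add: abs_mult flip: right_diff_distrib)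
    also have "\<dots> \<le> h * (C * ((z - r) powr \<rho> * r powr (\<kappa> - 1 - Suc n - \<rho>)))"
      using C(2)[of r "z - r"] z r h by (intro mult_left_mono) auto
    also have "\<dots> \<le> h * (C * (h powr \<rho> * r powr (\<kappa> - 1 - Suc n - \<rho>)))"
      using C z r h assms by (intro mult_left_mono mult_right_mono powr_mono2) auto
    also have "\<dots> = C * (h powr (1 + \<rho>) * r powr (\<kappa> - 2 - n - \<rho>))"
      using h by (simp add: powr_add algebra_simps)
    finally show ?thesis .
  qed
  then show ?thesis using C(1) by blast
qed

end

text \<open>As \<open>K\<close> is non-increasing, $r K(r)^2 \le \int_0^r K^2 \le C r^{2\gamma}$, which is the
  pointwise bound \<open>K r \<le> sqrt C * r powr (\<kappa> - 1)\<close> with \<open>\<kappa> = \<gamma> + 1/2 > 1/2\<close>.  The exponent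
  \<open>\<kappa>\<close> is the gain of regularity under convolution.\<close>

lemma condition_K_bounds:
  assumes "condition_K K"
  obtains C \<gamma> where "C > 0" "0 < \<gamma>"
    "\<And>h. h > 0 \<Longrightarrow> (LINT t:{0..h}|lborel. (K t)\<^sup>2) \<le> C * h powr (2 * \<gamma>)"
    "cm_kernel K (sqrt C) (\<gamma> + 1/2)"
proof -
  have L2: "L2_loc K" and cm: "completely_monotone K"
    using assms unfolding condition_K_def by blast+
  obtain \<gamma> where \<gamma>: "\<gamma> > 0" and *: "\<forall>T>0. \<exists>C>0. \<forall>h>0.
        (LINT t:{0..h}|lborel. (K t)\<^sup>2) + (LINT t:{0..T}|lborel. \<bar>K (t + h) - K t\<bar>\<^sup>2)
          \<le> C * h powr (2 * \<gamma>)"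
    using assms unfolding condition_K_def by (elim conjE exE) (rule that)
  obtain C where C: "C > 0" "\<And>h. h > 0 \<Longrightarrow>
        (LINT t:{0..h}|lborel. (K t)\<^sup>2) + (LINT t:{0..1}|lborel. \<bar>K (t + h) - K t\<bar>\<^sup>2)
          \<le> C * h powr (2 * \<gamma>)"
    using *[rule_format, of 1] by auto
  have sq: "(LINT t:{0..h}|lborel. (K t)\<^sup>2) \<le> C * h powr (2 * \<gamma>)" if "h > 0" for h
  proof -
    have "0 \<le> (LINT t:{0..1}|lborel. \<bar>K (t + h) - K t\<bar>\<^sup>2)"
      by (auto simp: set_lebesgue_integral_def intro!: integral_nonneg_AE)
    then show ?thesis using C(2)[OF that] by linarith
  qed
  have diff: "(deriv ^^ n) K differentiable (at r)" and sgn: "0 \<le> (-1) ^ n * (deriv ^^ n) K r"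
    if "r > 0" for r n
    using cm that unfolding completely_monotone_def by blast+
  have deriv: "(K has_real_derivative deriv K r) (at r)" if "r > 0" for r
    using diff[OF that, of 0] by (simp add: DERIV_deriv_iff_real_differentiable)
  have deriv_le: "deriv K r \<le> 0" and K0: "0 \<le> K r" if "r > 0" for r
    using sgn[OF that, of 1] sgn[OF that, of 0] by simp_all
  have anti: "K s \<le> K r" if "0 < r" "r \<le> s" for r s
  proof (rule DERIV_nonpos_imp_nonincreasing[of r s K])
    show "\<exists>y. (K has_real_derivative y) (at x) \<and> y \<le> 0" if "r \<le> x" "x \<le> s" for x
      using deriv[of x] deriv_le[of x] that \<open>0 < r\<close> by auto
  qed (rule that(2))
  have "K r \<le> sqrt C * r powr (\<gamma> + 1/2 - 1)" if r: "r > 0" for r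
  proof -
    have "r * (K r)\<^sup>2 = (LINT t:{0..r}|lborel. (K r)\<^sup>2)"
      using r by (simp add: set_lebesgue_integral_def)
    also have "\<dots> \<le> (LINT t:{0..r}|lborel. (K t)\<^sup>2)"
    proof (rule set_integral_mono_AE)
      show "set_integrable lborel {0..r} (\<lambda>t. (K r)\<^sup>2)"
        by (intro borel_integrable_atLeastAtMost' continuous_on_const)
      show "set_integrable lborel {0..r} (\<lambda>t. (K t)\<^sup>2)"
        using L2 r by (auto simp: L2_loc_def)
      show "AE x\<in>{0..r} in lborel. (K r)\<^sup>2 \<le> (K x)\<^sup>2"
        using AE_lborel_singleton[of 0]
        by eventually_elim (use anti K0 r in \<open>auto intro!: power_mono\<close>)
    qed
    also have "\<dots> \<le> C * r powr (2 * \<gamma>)" by (rule sq[OF r])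
    finally have "(K r)\<^sup>2 \<le> C * (r powr (2 * \<gamma>) / r)" using r by (simp add: field_simps)
    also have "r powr (2 * \<gamma>) / r = (r powr (\<gamma> + 1/2 - 1))\<^sup>2"
      using r powr_diff[of r "2 * \<gamma>" 1]
      by (simp add: power2_eq_square flip: powr_add)
    finally have "(K r)\<^sup>2 \<le> (sqrt C * r powr (\<gamma> + 1/2 - 1))\<^sup>2"
      using C(1) by (simp add: power_mult_distrib)
    then show ?thesis by (rule power2_le_imp_le) (use C(1) in auto)
  qed
  then have "cm_kernel K (sqrt C) (\<gamma> + 1/2)"
    using cm \<gamma> by (simp add: cm_kernel_def)
  with C(1) \<gamma> sq show ?thesis by (rule that)
qed

section \<open>Derivatives from one-sided expansions\<close>

lemma integral_bound_dominated:
  fixes f :: "real \<Rightarrow> complex"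
  assumes "f \<in> borel_measurable lborel" "AE s in lborel. norm (f s) \<le> g s"
    and "has_bochner_integral lborel g I"
  shows "integrable lborel f" "norm (integral\<^sup>L lborel f) \<le> I"
proof -
  have g: "integrable lborel g" "integral\<^sup>L lborel g = I"
    using assms(3) by (auto simp: has_bochner_integral_iff)
  show int: "integrable lborel f"
    by (rule Bochner_Integration.integrable_bound[OF g(1) assms(1)])
       (use assms(2) in eventually_elim, auto)
  have "norm (integral\<^sup>L lborel f) \<le> (\<integral>s. norm (f s) \<partial>lborel)"
    by (rule integral_norm_bound)
  also have "\<dots> \<le> integral\<^sup>L lborel g"
    using int g assms(2) by (intro integral_mono_AE) auto
  finally show "norm (integral\<^sup>L lborel f) \<le> I" using g by simp
qed

text \<open>A locally uniform first-order expansion to the right is enough for a two-sided derivative.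
  Comparing the expansion over \<open>[x, x + 2h]\<close> with those over its two halves shows that the
  candidate derivative \<open>D\<close> is \<open>\<rho>\<close>-Hoelder continuous, and then an expansion at the left end
  point of an interval yields one at the right end point.\<close>

lemma has_vector_derivative_if_right_taylor:
  fixes f D :: "real \<Rightarrow> complex"
  assumes \<rho>: "\<rho> > 0"
    and taylor: "\<And>p q. a < p \<Longrightarrow> p \<le> q \<Longrightarrow> \<exists>C\<ge>0. \<forall>t h. p \<le> t \<and> 0 < h \<and> t + h \<le> q \<longrightarrow>
       norm (f (t + h) - f t - h *\<^sub>R D t) \<le> C * h powr (1 + \<rho>)"
  shows "\<And>t. t > a \<Longrightarrow> (f has_vector_derivative D t) (at t)" "continuous_on {a<..} D"
proof -
  have main: "(f has_vector_derivative D t) (at t) \<and> isCont D t" if t: "t > a" for t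
  proof -
    define d where "d = (t - a) / 2"
    have d: "d > 0" using t by (simp add: d_def)
    \<comment> \<open>The window reaches further to the right, since intervals of length \<open>2h\<close> starting near \<open>t\<close> are needed.\<close>
    obtain C where C: "C \<ge> 0" "\<And>x h. t - d \<le> x \<Longrightarrow> 0 < h \<Longrightarrow> x + h \<le> t + 3 * d \<Longrightarrow>
       norm (f (x + h) - f x - h *\<^sub>R D x) \<le> C * h powr (1 + \<rho>)"
      using taylor[of "t - d" "t + 3 * d"] t d by (auto simp: d_def field_simps)
    define C' where "C' = C * (2 powr (1 + \<rho>) + 2)"
    have C': "C' \<ge> 0" using C by (simp add: C'_def)
    have D: "norm (D (x + h) - D x) \<le> C' * h powr \<rho>"
      if "t - d \<le> x" "0 < h" "x + 2 * h \<le> t + 3 * d" for x h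
    proof -
      have "h *\<^sub>R (D (x + h) - D x) =
         (f (x + 2 * h) - f x - (2 * h) *\<^sub>R D x) - (f (x + h) - f x - h *\<^sub>R D x)
          - (f ((x + h) + h) - f (x + h) - h *\<^sub>R D (x + h))"
        by (simp add: algebra_simps scaleR_2 flip: scaleR_scaleR)
      also have "norm \<dots> \<le> C * (2 * h) powr (1 + \<rho>) + C * h powr (1 + \<rho>) + C * h powr (1 + \<rho>)"
        using C(2)[of x "2 * h"] C(2)[of x h] C(2)[of "x + h" h] that
        by (intro order_trans[OF norm_triangle_ineq4[of "_ - _" "f ((x + h) + h) - _ - _"]] add_mono
            order_trans[OF norm_triangle_ineq4[of "_ - (2 * h) *\<^sub>R _"]]) auto
      also have "\<dots> = C' * h powr (1 + \<rho>)"
        using that by (simp add: C'_def powr_mult algebra_simps)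
      also have "\<dots> = h * (C' * h powr \<rho>)"
        using that by (simp add: powr_add)
      finally have "h * norm (D (x + h) - D x) \<le> h * (C' * h powr \<rho>)"
        using that by simp
      then show ?thesis using that by simp
    qed
    have Dabs: "norm (D y - D t) \<le> C' * \<bar>y - t\<bar> powr \<rho>" if "\<bar>y - t\<bar> < d" for y
    proof (cases y t rule: linorder_cases)
      case less then show ?thesis
        using D[of y "t - y"] that by (simp add: norm_minus_commute)
    next
      case greater then show ?thesis
        using D[of t "y - t"] that by simp
    qed simp
    define E where "E = C + C'"
    have fabs: "norm (f y - f t - (y - t) *\<^sub>R D t) \<le> E * \<bar>y - t\<bar> powr (1 + \<rho>)"
      if "\<bar>y - t\<bar> < d" for y
    proof (cases y t rule: linorder_cases)
      case less
      have "f y - f t - (y - t) *\<^sub>R D t =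
         (t - y) *\<^sub>R (D t - D y) - (f (y + (t - y)) - f y - (t - y) *\<^sub>R D y)"
        by (simp add: algebra_simps)
      also have "norm \<dots> \<le> (t - y) * (C' * \<bar>y - t\<bar> powr \<rho>) + C * (t - y) powr (1 + \<rho>)"
      proof -
        have "norm ((t - y) *\<^sub>R (D t - D y)) \<le> (t - y) * (C' * \<bar>y - t\<bar> powr \<rho>)"
          using less Dabs[OF that] by (simp add: norm_minus_commute)
        moreover have "norm (f (y + (t - y)) - f y - (t - y) *\<^sub>R D y) \<le> C * (t - y) powr (1 + \<rho>)"
          using C(2)[of y "t - y"] less that d by simp
        ultimately show ?thesis by (intro order_trans[OF norm_triangle_ineq4 add_mono])
      qed
      also have "\<dots> = E * \<bar>y - t\<bar> powr (1 + \<rho>)"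
        using less by (simp add: E_def powr_add algebra_simps)
      finally show ?thesis .
    next
      case greater
      have "norm (f y - f t - (y - t) *\<^sub>R D t) \<le> C * \<bar>y - t\<bar> powr (1 + \<rho>)"
        using C(2)[of t "y - t"] greater that by simp
      also have "\<dots> \<le> E * \<bar>y - t\<bar> powr (1 + \<rho>)"
        using C' by (intro mult_right_mono) (auto simp: E_def)
      finally show ?thesis .
    qed simp
    have lim: "((\<lambda>y. B * \<bar>y - t\<bar> powr \<rho>) \<longlongrightarrow> 0) (at t)" for B
      using \<rho> by (auto intro!: tendsto_eq_intros)
    have ev: "\<forall>\<^sub>F y in at t. \<bar>y - t\<bar> < d"
      using d unfolding eventually_at by (auto simp: dist_real_def)
    have "(D \<longlongrightarrow> D t) (at t)"
      by (rule Lim_null[THEN iffD2], rule Lim_null_comparison[OF _ lim[of C']])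
         (use ev Dabs in \<open>auto elim!: eventually_mono\<close>)
    moreover have "(f has_vector_derivative D t) (at t)"
      unfolding has_vector_derivative_def has_derivative_within
    proof (intro conjI bounded_linear_scaleR_left)
      show "((\<lambda>y. (1 / norm (y - t)) *\<^sub>R (f y - (f t + (y - t) *\<^sub>R D t))) \<longlongrightarrow> 0) (at t)"
      proof (rule Lim_null_comparison[OF _ lim[of E]])
        have "norm ((1 / norm (y - t)) *\<^sub>R (f y - (f t + (y - t) *\<^sub>R D t))) \<le> E * \<bar>y - t\<bar> powr \<rho>"
          if "\<bar>y - t\<bar> < d" "y \<noteq> t" for y
        proof -
          have "norm ((1 / norm (y - t)) *\<^sub>R (f y - (f t + (y - t) *\<^sub>R D t)))
              = norm (f y - f t - (y - t) *\<^sub>R D t) / \<bar>y - t\<bar>"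
            by (simp add: diff_diff_eq)
          also have "\<dots> \<le> (E * \<bar>y - t\<bar> powr (1 + \<rho>)) / \<bar>y - t\<bar>"
            by (intro divide_right_mono fabs that(1)) auto
          also have "\<dots> = E * \<bar>y - t\<bar> powr \<rho>"
            using that(2) by (simp add: powr_add)
          finally show ?thesis .
        qed
        then show "\<forall>\<^sub>F y in at t. norm ((1 / norm (y - t)) *\<^sub>R (f y - (f t + (y - t) *\<^sub>R D t))) \<le> E * \<bar>y - t\<bar> powr \<rho>"
          using ev by (auto simp: eventually_at_filter elim!: eventually_mono)
      qed
    qed
    ultimately show ?thesis by (simp add: isCont_def)
  qed
  show "\<And>t. t > a \<Longrightarrow> (f has_vector_derivative D t) (at t)" using main by blast
  show "continuous_on {a<..} D" using main by (auto intro!: continuous_at_imp_continuous_on)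
qed

section \<open>The increment of a convolution\<close>

context cm_kernel
begin

definition kconv :: "(real \<Rightarrow> complex) \<Rightarrow> real set \<Rightarrow> real \<Rightarrow> complex" where
  "kconv u A t = (LINT s:A|lborel. complex_of_real (kderiv 0 (t - s)) * u s)"

text \<open>The convolution of the kernel with the constant function \<open>1\<close> on \<open>(a, \<infinity>)\<close>.\<close>

definition kint :: "real \<Rightarrow> real \<Rightarrow> real" where
  "kint a t = (LINT s:{a<..}|lborel. kderiv 0 (t - s))"

lemma integrable_kderiv_Iic: "integrable lborel (\<lambda>r. indicator {..<x} r * kderiv 0 r)"
proof -
  obtain C where C: "C > 0" "\<And>r. r > 0 \<Longrightarrow> \<bar>kderiv 0 r\<bar> \<le> C * r powr (\<kappa> - 1)"
    using kderiv_bound[of 0] by auto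
  show ?thesis
  proof (rule Bochner_Integration.integrable_bound)
    show "integrable lborel (\<lambda>r. C * (indicator {0<..<max 0 x} r * r powr (\<kappa> - 1)))"
      using has_bochner_integral_powr_from_0[of "\<kappa> - 1" "max 0 x"] \<kappa>_pos
      by (intro integrable_mult_right) (auto simp: has_bochner_integral_iff)
    have "norm (indicator {..<x} r * kderiv 0 r) \<le> norm (C * (indicator {0<..<max 0 x} r * r powr (\<kappa> - 1)))" for r
      using C(1) C(2)[of r] by (cases "r > 0") (auto simp: indicator_def)
    then show "AE r in lborel. norm (indicator {..<x} r * kderiv 0 r)
       \<le> norm (C * (indicator {0<..<max 0 x} r * r powr (\<kappa> - 1)))" by simp
  qed measurable
qed

lemma kint_eq: "kint a t = (\<integral>r. indicator {..<t - a} r * kderiv 0 r \<partial>lborel)"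
  and integrable_kint: "set_integrable lborel {a<..} (\<lambda>s. kderiv 0 (t - s))"
proof -
  have eq: "(\<lambda>s. indicator {a<..} s *\<^sub>R kderiv 0 (t - s)) = (\<lambda>s. indicator {..<t - a} (t + (-1) * s) * kderiv 0 (t + (-1) * s))"
    by (auto simp: fun_eq_iff indicator_def)
  show "kint a t = (\<integral>r. indicator {..<t - a} r * kderiv 0 r \<partial>lborel)"
    unfolding kint_def set_lebesgue_integral_def eq
    by (subst lborel_integral_real_affine[of "-1" _ t]) auto
  show "set_integrable lborel {a<..} (\<lambda>s. kderiv 0 (t - s))"
    unfolding set_integrable_def eq
    using lborel_integrable_real_affine[OF integrable_kderiv_Iic, of "-1" "t - a" t] by simp
qed

lemma kint_increment:
  assumes "a < t" "0 < h"
  shows "h * kderiv 0 (t - a + h) \<le> kint a (t + h) - kint a t" "kint a (t + h) - kint a t \<le> h * kderiv 0 (t - a)"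
proof -
  define x where "x = t - a"
  have x: "x > 0" using assms by (simp add: x_def)
  have "kint a (t + h) - kint a t = (\<integral>r. indicator {..<x + h} r * kderiv 0 r - indicator {..<x} r * kderiv 0 r \<partial>lborel)"
  proof -
    have eq: "t + h - a = x + h" "t - a = x" by (simp_all add: x_def)
    show ?thesis unfolding kint_eq eq
      by (rule Bochner_Integration.integral_diff[symmetric]) (rule integrable_kderiv_Iic)+
  qed
  also have "\<dots> = (\<integral>r. indicator {x..<x + h} r * kderiv 0 r \<partial>lborel)"
    using assms by (intro Bochner_Integration.integral_cong) (auto simp: indicator_def)
  finally have eq: "kint a (t + h) - kint a t = (\<integral>r. indicator {x..<x + h} r * kderiv 0 r \<partial>lborel)" .
  have const: "has_bochner_integral lborel (\<lambda>r. indicator {x..<x + h} r * w) (h * w)" for w :: real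
    using assms by (intro has_bochner_integral_mult_left) (auto simp: has_bochner_integral_iff)
  have int: "integrable lborel (\<lambda>r. indicator {x..<x + h} r * kderiv 0 r)"
    by (rule Bochner_Integration.integrable_bound[OF integrable_kderiv_Iic[of "x + h"]])
       (auto simp: indicator_def)
  have "h * kderiv 0 (x + h) = (\<integral>r. indicator {x..<x + h} r * kderiv 0 (x + h) \<partial>lborel)"
    using const by (metis has_bochner_integral_integral_eq)
  also have "\<dots> \<le> (\<integral>r. indicator {x..<x + h} r * kderiv 0 r \<partial>lborel)"
    using const int x by (intro integral_mono) (auto simp: has_bochner_integral_iff indicator_def intro!: kderiv_0_antimono)
  finally show "h * kderiv 0 (t - a + h) \<le> kint a (t + h) - kint a t" by (simp add: eq x_def)
  have "(\<integral>r. indicator {x..<x + h} r * kderiv 0 r \<partial>lborel) \<le> (\<integral>r. indicator {x..<x + h} r * kderiv 0 x \<partial>lborel)"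
    using const int x by (intro integral_mono) (auto simp: has_bochner_integral_iff indicator_def intro!: kderiv_0_antimono)
  also have "\<dots> = h * kderiv 0 x"
    using const by (metis has_bochner_integral_integral_eq)
  finally show "kint a (t + h) - kint a t \<le> h * kderiv 0 (t - a)" by (simp add: eq x_def)
qed

lemma kconv_bounded:
  assumes "\<And>r. r > 0 \<Longrightarrow> \<bar>kderiv 0 r\<bar> \<le> C * r powr (\<kappa> - 1)" "C \<ge> 0" "M \<ge> 0" "a \<le> t"
    and [measurable]: "set_borel_measurable lborel {a<..} u"
    and bd: "AE s in lborel. a < s \<and> s < t \<longrightarrow> norm (u s) \<le> M"
  shows "set_integrable lborel {a<..} (\<lambda>s. complex_of_real (kderiv 0 (t - s)) * u s)"
    "norm (kconv u {a<..} t) \<le> M * C * ((t - a) powr \<kappa> / \<kappa>)"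
proof -
  have [measurable]: "(\<lambda>s. indicator {a<..} s *\<^sub>R u s) \<in> borel_measurable lborel"
    using assms(5) by (simp add: set_borel_measurable_def)
  have eq: "(\<lambda>s. indicator {a<..} s *\<^sub>R (complex_of_real (kderiv 0 (t - s)) * u s)) =
      (\<lambda>s. complex_of_real (kderiv 0 (t - s)) * (indicator {a<..} s *\<^sub>R u s))"
    by (auto simp: fun_eq_iff)
  have "AE s in lborel. norm (indicator {a<..} s *\<^sub>R (complex_of_real (kderiv 0 (t - s)) * u s))
      \<le> M * C * (indicator {a<..<t} s * (t - s) powr (\<kappa> - 1))"
    using bd
  proof eventually_elim
    case (elim s)
    show ?case
    proof (cases "a < s \<and> s < t")
      case True
      then have "\<bar>kderiv 0 (t - s)\<bar> * norm (u s) \<le> (C * (t - s) powr (\<kappa> - 1)) * M"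
        using elim assms(2,3) by (intro mult_mono assms(1)) auto
      then show ?thesis using True by (simp add: norm_mult mult_ac)
    qed (auto simp: indicator_def)
  qed
  then have dom: "AE s in lborel. norm (complex_of_real (kderiv 0 (t - s)) * (indicator {a<..} s *\<^sub>R u s))
      \<le> M * C * (indicator {a<..<t} s * (t - s) powr (\<kappa> - 1))"
    by eventually_elim (simp add: norm_mult mult_ac)
  have hb: "has_bochner_integral lborel (\<lambda>s. M * C * (indicator {a<..<t} s * (t - s) powr (\<kappa> - 1)))
      (M * C * ((t - a) powr (\<kappa> - 1 + 1) / (\<kappa> - 1 + 1)))"
    using \<kappa>_pos \<open>a \<le> t\<close> by (intro has_bochner_integral_mult_right has_bochner_integral_powr_reflected) auto
  have meas: "(\<lambda>s. complex_of_real (kderiv 0 (t - s)) * (indicator {a<..} s *\<^sub>R u s)) \<in> borel_measurable lborel"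
    by measurable
  show "set_integrable lborel {a<..} (\<lambda>s. complex_of_real (kderiv 0 (t - s)) * u s)"
    "norm (kconv u {a<..} t) \<le> M * C * ((t - a) powr \<kappa> / \<kappa>)"
    unfolding set_integrable_def kconv_def set_lebesgue_integral_def eq
    using integral_bound_dominated[OF meas dom hb] by simp_all
qed

text \<open>The basic estimate.  With $W$ the convolution of $u$ on \<open>(a, \<infinity>)\<close>, the increment
  $W(t+h) - W(t)$ is split by writing $u = z + (u - z)$, where \<open>z\<close> plays the role of \<open>u t\<close>.  The
  constant \<open>z\<close> contributes the increment of \<open>kint\<close>.  In the rest the factor $|s-t|^\theta$ tames
  the singularity of the kernel increment at $s = t$: the part over $(a, t)$ is controlled by the
  power bound \<open>e_early\<close>, and the part over $(t, t+h)$ by the size of the kernel.  The function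
  \<open>e\<close> is what one wants to subtract from the kernel increment: \<open>0\<close> for Hoelder estimates, and
  \<open>h\<close> times the derivative of the kernel for first-order expansions.\<close>

lemma kconv_increment_core:
  assumes C: "\<And>r. r > 0 \<Longrightarrow> \<bar>kderiv 0 r\<bar> \<le> C * r powr (\<kappa> - 1)" "C \<ge> 0"
    and "M \<ge> 0" "a < t" "0 < h" "0 \<le> \<theta>" "A \<ge> 0" "b + \<theta> > -1"
    and u: "set_borel_measurable lborel {a<..} u"
    and e [measurable]: "e \<in> borel_measurable borel"
    and e_late: "\<And>s. t \<le> s \<Longrightarrow> e s = 0"
    and e_early: "\<And>s. a < s \<Longrightarrow> s < t \<Longrightarrow> \<bar>kderiv 0 (t + h - s) - kderiv 0 (t - s) - e s\<bar> \<le> A * (t - s) powr b"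
    and bd: "AE s in lborel. a < s \<and> s < t + h \<longrightarrow> norm (u s - z) \<le> M * \<bar>s - t\<bar> powr \<theta>"
  shows "set_integrable lborel {a<..} (\<lambda>s. complex_of_real (e s) * (u s - z))" (is ?int)
    and "norm (kconv u {a<..} (t + h) - kconv u {a<..} t - (kint a (t + h) - kint a t) *\<^sub>R z
        - (LINT s:{a<..}|lborel. complex_of_real (e s) * (u s - z)))
      \<le> M * A * ((t - a) powr (b + \<theta> + 1) / (b + \<theta> + 1)) + M * C * (h powr (\<theta> + \<kappa>) / \<kappa>)" (is "norm ?lhs \<le> _")
proof -
  have um [measurable]: "(\<lambda>s. indicator {a<..} s *\<^sub>R u s) \<in> borel_measurable lborel"
    using u by (simp add: set_borel_measurable_def)
  define M' where "M' = norm z + M * (t + h - a) powr \<theta>"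
  have M': "M' \<ge> 0" using assms by (simp add: M'_def)
  have uM: "AE s in lborel. a < s \<and> s < t + h \<longrightarrow> norm (u s) \<le> M'"
    using bd
  proof eventually_elim
    case (elim s)
    have "norm (u s) \<le> M'" if s: "a < s" "s < t + h"
    proof -
      have "norm (u s) \<le> norm z + norm (u s - z)" by (metis add.commute diff_add_cancel norm_triangle_ineq)
      also have "norm (u s - z) \<le> M * \<bar>s - t\<bar> powr \<theta>" using elim s by blast
      also have "\<dots> \<le> M * (t + h - a) powr \<theta>"
        using assms s by (intro mult_left_mono powr_mono2) auto
      finally show ?thesis by (simp add: M'_def)
    qed
    then show ?case by blast
  qed
  have int1: "set_integrable lborel {a<..} (\<lambda>s. complex_of_real (kderiv 0 (t + h - s)) * u s)"
    using uM assms M' by (intro kconv_bounded(1)[OF C, of M']) auto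
  have int0: "set_integrable lborel {a<..} (\<lambda>s. complex_of_real (kderiv 0 (t - s)) * u s)"
    using uM assms M' by (intro kconv_bounded(1)[OF C, of M']) (auto elim!: eventually_mono)
  have intz: "set_integrable lborel {a<..} (\<lambda>s. complex_of_real (kderiv 0 (y - s)) * z)" for y
  proof (rule set_integrable_mult_left)
    have "(\<lambda>s. indicator {a<..} s *\<^sub>R complex_of_real (kderiv 0 (y - s))) =
        (\<lambda>s. complex_of_real (indicator {a<..} s *\<^sub>R kderiv 0 (y - s)))"
      by (auto simp: fun_eq_iff indicator_def)
    then show "set_integrable lborel {a<..} (\<lambda>s. complex_of_real (kderiv 0 (y - s)))"
      using integrable_of_real[OF integrable_kint[of a y, unfolded set_integrable_def]]
      by (simp add: set_integrable_def)
  qed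
  have kintz: "(LINT s:{a<..}|lborel. complex_of_real (kderiv 0 (y - s)) * z) = kint a y *\<^sub>R z" for y
    by (simp add: kint_def set_integral_complex_of_real scaleR_conv_of_real)
  let ?E = "\<lambda>s. complex_of_real (kderiv 0 (t + h - s) - kderiv 0 (t - s) - e s) * (u s - z)"
  have eqE: "(\<lambda>s. indicator {a<..} s *\<^sub>R ?E s) = (\<lambda>s. complex_of_real (kderiv 0 (t + h - s) - kderiv 0 (t - s) - e s) *
      (indicator {a<..} s *\<^sub>R u s - indicator {a<..} s *\<^sub>R z))"
    by (auto simp: fun_eq_iff indicator_def)
  have meas: "(\<lambda>s. indicator {a<..} s *\<^sub>R ?E s) \<in> borel_measurable lborel"
    unfolding eqE by measurable
  have dom: "AE s in lborel. norm (indicator {a<..} s *\<^sub>R ?E s) \<le>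
     M * A * (indicator {a<..<t} s * (t - s) powr (b + \<theta>)) +
     (M * C * h powr \<theta>) * (indicator {t<..<t + h} s * (t + h - s) powr (\<kappa> - 1))"
    using bd AE_lborel_singleton[of t]
  proof eventually_elim
    case (elim s)
    consider "s \<le> a" | "a < s" "s < t" | "t < s" "s < t + h" | "t + h \<le> s"
      using elim by linarith
    then show ?case
    proof cases
      case 2
      have "norm (?E s) \<le> (A * (t - s) powr b) * (M * \<bar>s - t\<bar> powr \<theta>)"
        unfolding norm_mult norm_of_real using elim 2 assms by (intro mult_mono e_early) auto
      also have "\<dots> = M * A * (t - s) powr (b + \<theta>)"
        using 2 by (simp add: powr_add mult_ac)
      finally show ?thesis using 2 by simp
    next
      case 3
      have "norm (?E s) = \<bar>kderiv 0 (t + h - s)\<bar> * norm (u s - z)"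
        using 3 e_late by (simp add: norm_mult)
      also have "\<dots> \<le> (C * (t + h - s) powr (\<kappa> - 1)) * (M * h powr \<theta>)"
      proof (rule mult_mono)
        have "norm (u s - z) \<le> M * \<bar>s - t\<bar> powr \<theta>" using elim 3 assms by auto
        also have "\<dots> \<le> M * h powr \<theta>" using assms 3 by (intro mult_left_mono powr_mono2) auto
        finally show "norm (u s - z) \<le> M * h powr \<theta>" .
      qed (use 3 C in auto)
      finally show ?thesis using 3 assms by (simp add: mult_ac)
    next
      case 4 then show ?thesis using e_late[of s] assms by simp
    qed (use assms in auto)
  qed
  have hb: "has_bochner_integral lborel (\<lambda>s. M * A * (indicator {a<..<t} s * (t - s) powr (b + \<theta>)) +
     (M * C * h powr \<theta>) * (indicator {t<..<t + h} s * (t + h - s) powr (\<kappa> - 1)))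
     (M * A * ((t - a) powr (b + \<theta> + 1) / (b + \<theta> + 1)) + (M * C * h powr \<theta>) * ((t + h - t) powr (\<kappa> - 1 + 1) / (\<kappa> - 1 + 1)))"
    using assms \<kappa>_pos
    by (intro has_bochner_integral_add has_bochner_integral_mult_right has_bochner_integral_powr_reflected) auto
  have intE: "set_integrable lborel {a<..} ?E"
    and bdE: "norm (LINT s:{a<..}|lborel. ?E s) \<le>
      M * A * ((t - a) powr (b + \<theta> + 1) / (b + \<theta> + 1)) + M * C * (h powr (\<theta> + \<kappa>) / \<kappa>)"
    unfolding set_integrable_def set_lebesgue_integral_def
    using integral_bound_dominated[OF meas dom hb] by (auto simp: powr_add mult_ac)
  let ?F = "\<lambda>s. complex_of_real (kderiv 0 (t + h - s)) * u s - complex_of_real (kderiv 0 (t - s)) * u s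
     - (complex_of_real (kderiv 0 (t + h - s)) * z - complex_of_real (kderiv 0 (t - s)) * z)"
  have intF: "set_integrable lborel {a<..} ?F"
    by (intro set_integral_diff(1) int1 int0 intz)
  have ee: "(\<lambda>s. complex_of_real (e s) * (u s - z)) = (\<lambda>s. ?F s - ?E s)"
    by (auto simp: fun_eq_iff algebra_simps)
  show ?int unfolding ee by (intro set_integral_diff(1) intE intF)
  have "(LINT s:{a<..}|lborel. complex_of_real (e s) * (u s - z)) = 
     (LINT s:{a<..}|lborel. ?F s) - (LINT s:{a<..}|lborel. ?E s)"
    unfolding ee by (intro set_integral_diff(2) intE intF)
  also have "(LINT s:{a<..}|lborel. ?F s) = kconv u {a<..} (t + h) - kconv u {a<..} t
      - (kint a (t + h) *\<^sub>R z - kint a t *\<^sub>R z)"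
    unfolding kconv_def kintz[symmetric] set_integral_diff(2)[OF set_integral_diff(1)[OF int1 int0] set_integral_diff(1)[OF intz intz]]
      set_integral_diff(2)[OF int1 int0] set_integral_diff(2)[OF intz intz] ..
  finally have "(LINT s:{a<..}|lborel. complex_of_real (e s) * (u s - z)) = kconv u {a<..} (t + h) - kconv u {a<..} t
      - (kint a (t + h) *\<^sub>R z - kint a t *\<^sub>R z) - (LINT s:{a<..}|lborel. ?E s)" .
  moreover have lhs_eq: "p - q - r - i = j" if "i = p - q - r - j" for p q r i j :: complex
    using that by simp
  ultimately have "?lhs = (LINT s:{a<..}|lborel. ?E s)"
    unfolding scaleR_diff_left by (intro lhs_eq)
  then show "norm ?lhs \<le> M * A * ((t - a) powr (b + \<theta> + 1) / (b + \<theta> + 1)) + M * C * (h powr (\<theta> + \<kappa>) / \<kappa>)"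
    using bdE by (simp only:)
qed

end

section \<open>Gain of regularity under convolution\<close>

text \<open>For a positive exponent the Hoelder estimate itself yields continuity.\<close>

lemma C_holder_above_0I:
  assumes "0 < \<rho>"
    and H: "\<And>p q. a < p \<Longrightarrow> p \<le> q \<Longrightarrow> \<exists>C. \<forall>s t. p \<le> s \<and> s < t \<and> t \<le> q \<longrightarrow> norm (f t - f s) \<le> C * (t - s) powr \<rho>"
  shows "C_holder_above a 0 \<rho> f"
proof -
  have H': "\<exists>C. \<forall>s\<in>{p..q}. \<forall>t\<in>{p..q}. norm (f s - f t) \<le> C * \<bar>s - t\<bar> powr \<rho>"
    if pq: "a < p" "p \<le> q" for p q
  proof -
    obtain C where C: "\<And>s t. p \<le> s \<Longrightarrow> s < t \<Longrightarrow> t \<le> q \<Longrightarrow> norm (f t - f s) \<le> C * (t - s) powr \<rho>"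
      using H[OF pq] by blast
    have "norm (f s - f t) \<le> C * \<bar>s - t\<bar> powr \<rho>" if "s \<in> {p..q}" "t \<in> {p..q}" for s t
      using C[of s t] C[of t s] that by (cases s t rule: linorder_cases) (auto simp: norm_minus_commute)
    then show ?thesis by blast
  qed
  have "isCont f t" if t: "t > a" for t
  proof -
    define d where "d = (t - a) / 2"
    have d: "d > 0" "a < t - d" "t - d \<le> t + d" using t by (auto simp: d_def field_simps)
    obtain C where C: "\<forall>x\<in>{t - d..t + d}. \<forall>y\<in>{t - d..t + d}. norm (f x - f y) \<le> C * \<bar>x - y\<bar> powr \<rho>"
      using H'[OF d(2,3)] by blast
    have lim: "((\<lambda>y. C * \<bar>y - t\<bar> powr \<rho>) \<longlongrightarrow> 0) (at t)"
      using \<open>0 < \<rho>\<close> by (auto intro!: tendsto_eq_intros)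
    have "\<forall>\<^sub>F y in at t. norm (f y - f t) \<le> C * \<bar>y - t\<bar> powr \<rho>"
    proof -
      have "norm (f y - f t) \<le> C * \<bar>y - t\<bar> powr \<rho>" if "\<bar>y - t\<bar> < d" for y
        using C[rule_format, of y t] that d(1) by (auto simp: abs_less_iff)
      then show ?thesis
        unfolding eventually_at using d(1) by (intro exI[of _ d]) (auto simp: dist_real_def)
    qed
    then have "((\<lambda>y. f y - f t) \<longlongrightarrow> 0) (at t)"
      using lim by (rule Lim_null_comparison)
    then show ?thesis unfolding isCont_def by (rule Lim_null[THEN iffD2])
  qed
  then show ?thesis
    using H' by (auto simp: C_holder_above_def intro!: continuous_at_imp_continuous_on)
qed

lemma powr_le_mult_powr:
  fixes h H :: real
  assumes "0 < h" "h \<le> H" "\<rho> \<le> \<theta>"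
  shows "h powr \<theta> \<le> H powr (\<theta> - \<rho>) * h powr \<rho>"
proof -
  have "h powr \<theta> = h powr (\<theta> - \<rho>) * h powr \<rho>" by (simp flip: powr_add)
  also have "\<dots> \<le> H powr (\<theta> - \<rho>) * h powr \<rho>" using assms by (intro mult_right_mono powr_mono2) auto
  finally show ?thesis .
qed

context cm_kernel
begin

lemma kderiv_lip:
  assumes "0 < d" "d \<le> x" "d \<le> y"
  shows "\<bar>kderiv n y - kderiv n x\<bar> \<le> \<bar>y - x\<bar> * \<bar>kderiv (Suc n) d\<bar>"
proof -
  have *: "\<bar>kderiv n y - kderiv n x\<bar> \<le> \<bar>y - x\<bar> * \<bar>kderiv (Suc n) d\<bar>" if xy: "d \<le> x" "x < y" for x y
  proof -
    obtain z where z: "x < z" "z < y" "kderiv n y - kderiv n x = (y - x) * kderiv (Suc n) z"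
      by (rule kderiv_mvt[of x y n]) (use xy assms in auto)
    then show ?thesis
      using kderiv_abs_antimono[of d z "Suc n"] xy assms by (auto simp: abs_mult intro!: mult_left_mono)
  qed
  show ?thesis
    using *[of x y] *[of y x] assms by (cases x y rule: linorder_cases) (auto simp: abs_minus_commute)
qed

lemma kderiv_taylor_away:
  assumes "0 < d" "d \<le> x" "d \<le> y"
  shows "\<bar>kderiv n y - kderiv n x - (y - x) * kderiv (Suc n) x\<bar> \<le> (y - x)\<^sup>2 * \<bar>kderiv (Suc (Suc n)) d\<bar>"
proof -
  have *: "\<exists>z. min x y \<le> z \<and> z \<le> max x y \<and> kderiv n y - kderiv n x = (y - x) * kderiv (Suc n) z"
  proof (cases x y rule: linorder_cases)
    case less
    then show ?thesis using kderiv_mvt[of x y n] assms by (metis max.absorb2 min.absorb1 order_less_imp_le order_less_le_trans)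
  next
    case equal then show ?thesis by auto
  next
    case greater
    then obtain z where z: "y < z" "z < x" "kderiv n x - kderiv n y = (x - y) * kderiv (Suc n) z"
      using kderiv_mvt[of y x n] assms by auto
    then show ?thesis using greater by (intro exI[of _ z]) (auto simp: algebra_simps)
  qed
  then obtain z where z: "min x y \<le> z" "z \<le> max x y" "kderiv n y - kderiv n x = (y - x) * kderiv (Suc n) z" by blast
  have "\<bar>kderiv n y - kderiv n x - (y - x) * kderiv (Suc n) x\<bar> = \<bar>y - x\<bar> * \<bar>kderiv (Suc n) z - kderiv (Suc n) x\<bar>"
    by (simp add: z(3) abs_mult flip: right_diff_distrib)
  also have "\<dots> \<le> \<bar>y - x\<bar> * (\<bar>z - x\<bar> * \<bar>kderiv (Suc (Suc n)) d\<bar>)"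
    using z assms by (intro mult_left_mono kderiv_lip) auto
  also have "\<dots> \<le> \<bar>y - x\<bar> * (\<bar>y - x\<bar> * \<bar>kderiv (Suc (Suc n)) d\<bar>)"
    using z by (intro mult_left_mono mult_right_mono) auto
  also have "\<dots> = (y - x)\<^sup>2 * \<bar>kderiv (Suc (Suc n)) d\<bar>"
    by (metis abs_mult_self_eq mult.assoc power2_eq_square)
  finally show ?thesis .
qed

text \<open>Hoelder exponent \<open>\<theta>\<close> is improved to any \<open>\<rho> < \<theta> + \<kappa>\<close> with \<open>\<rho> \<le> 1\<close>.  The hypothesis
  on \<open>u\<close> is phrased almost everywhere and with a free centre \<open>z\<close>, so that it also covers functions
  that are merely locally bounded: \<open>\<theta> = 0\<close> and \<open>z = 0\<close>.\<close>

lemma kconv_holder_base: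
  assumes meas: "set_borel_measurable lborel {a<..} u"
    and osc: "\<And>p q. a < p \<Longrightarrow> p \<le> q \<Longrightarrow> \<exists>M\<ge>0. \<forall>t\<in>{p..q}. \<exists>z. norm z \<le> M \<and>
        (AE s in lborel. a < s \<and> s < q \<longrightarrow> norm (u s - z) \<le> M * \<bar>s - t\<bar> powr \<theta>)"
    and \<theta>: "0 \<le> \<theta>" and \<rho>: "0 < \<rho>" "\<rho> \<le> 1" "\<rho> < \<theta> + \<kappa>"
  shows "C_holder_above a 0 \<rho> (kconv u {a<..})"
proof (rule C_holder_above_0I[OF \<rho>(1)])
  fix p q assume pq: "a < p" "p \<le> q"
  obtain C where C: "C > 0" "\<And>r. r > 0 \<Longrightarrow> \<bar>kderiv 0 r\<bar> \<le> C * r powr (\<kappa> - 1)"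
    using kderiv_bound[of 0] by auto
  obtain A where A: "A > 0" "\<And>r h. r > 0 \<Longrightarrow> h > 0 \<Longrightarrow> \<bar>kderiv 0 (r + h) - kderiv 0 r\<bar> \<le> A * (h powr \<rho> * r powr (\<kappa> - 1 - \<rho>))"
    using kderiv_increment[of \<rho> 0] \<rho> by auto
  obtain M where M: "M \<ge> 0" "\<And>t. t \<in> {p..q} \<Longrightarrow> \<exists>z. norm z \<le> M \<and>
        (AE s in lborel. a < s \<and> s < q \<longrightarrow> norm (u s - z) \<le> M * \<bar>s - t\<bar> powr \<theta>)"
    using osc[OF pq] by blast
  define X where "X = \<theta> + \<kappa> - \<rho>"
  have X: "X > 0" using \<rho> by (simp add: X_def)
  define B where "B = M * kderiv 0 (p - a) * (q - p) powr (1 - \<rho>) + M * A * ((q - a) powr X / X) + M * C * ((q - p) powr X / \<kappa>)"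
  have "norm (kconv u {a<..} y - kconv u {a<..} t) \<le> B * (y - t) powr \<rho>" if t: "p \<le> t" "t < y" "y \<le> q" for t y
  proof -
    obtain z where z: "norm z \<le> M" "AE s in lborel. a < s \<and> s < q \<longrightarrow> norm (u s - z) \<le> M * \<bar>s - t\<bar> powr \<theta>"
      using M(2)[of t] t by auto
    define h where "h = y - t"
    have h: "h > 0" "h \<le> q - p" and y: "y = t + h" using t by (auto simp: h_def)
    have "norm (kconv u {a<..} (t + h) - kconv u {a<..} t - (kint a (t + h) - kint a t) *\<^sub>R z
        - (LINT s:{a<..}|lborel. complex_of_real 0 * (u s - z)))
      \<le> M * (A * h powr \<rho>) * ((t - a) powr (\<kappa> - 1 - \<rho> + \<theta> + 1) / (\<kappa> - 1 - \<rho> + \<theta> + 1)) + M * C * (h powr (\<theta> + \<kappa>) / \<kappa>)"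
    proof -
      have C0: "C \<ge> 0" using C by simp
      have at: "a < t" using t pq by simp
      have Ah: "0 \<le> A * h powr \<rho>" using A by simp
      have b: "-1 < \<kappa> - 1 - \<rho> + \<theta>" using \<rho> by simp
      have early: "\<bar>kderiv 0 (t + h - s) - kderiv 0 (t - s) - 0\<bar> \<le> A * h powr \<rho> * (t - s) powr (\<kappa> - 1 - \<rho>)"
        if "a < s" "s < t" for s
        using A(2)[of "t - s" h] that h by (simp add: algebra_simps)
      have ae: "AE s in lborel. a < s \<and> s < t + h \<longrightarrow> norm (u s - z) \<le> M * \<bar>s - t\<bar> powr \<theta>"
        using z(2) by eventually_elim (use t y in auto)
      show ?thesis
        by (rule kconv_increment_core(2)[OF C(2) C0 M(1) at h(1) \<theta> Ah b meas borel_measurable_const refl early ae])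
    qed
    also have "\<kappa> - 1 - \<rho> + \<theta> + 1 = X" by (simp add: X_def)
    finally have 1: "norm (kconv u {a<..} (t + h) - kconv u {a<..} t - (kint a (t + h) - kint a t) *\<^sub>R z)
      \<le> M * (A * h powr \<rho>) * ((t - a) powr X / X) + M * C * (h powr (\<theta> + \<kappa>) / \<kappa>)" by simp
    have k: "0 \<le> kint a (t + h) - kint a t" "kint a (t + h) - kint a t \<le> h * kderiv 0 (p - a)"
    proof -
      show "0 \<le> kint a (t + h) - kint a t"
        using kint_increment(1)[of a t h] t pq h kderiv_0_nonneg[of "t - a + h"]
        by (smt (verit) mult_nonneg_nonneg)
      have "kint a (t + h) - kint a t \<le> h * kderiv 0 (t - a)"
        using kint_increment(2)[of a t h] t pq h by auto
      also have "\<dots> \<le> h * kderiv 0 (p - a)"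
        using t pq h by (intro mult_left_mono kderiv_0_antimono) auto
      finally show "kint a (t + h) - kint a t \<le> h * kderiv 0 (p - a)" .
    qed
    have "norm (kconv u {a<..} (t + h) - kconv u {a<..} t) \<le>
       norm ((kint a (t + h) - kint a t) *\<^sub>R z) + norm (kconv u {a<..} (t + h) - kconv u {a<..} t - (kint a (t + h) - kint a t) *\<^sub>R z)"
      by (metis add.commute diff_add_cancel norm_triangle_ineq)
    also have "norm ((kint a (t + h) - kint a t) *\<^sub>R z) \<le> (h * kderiv 0 (p - a)) * M"
      using k z(1) kderiv_0_nonneg h by (simp add: mult_mono)
    also have "(h * kderiv 0 (p - a)) * M \<le> M * kderiv 0 (p - a) * ((q - p) powr (1 - \<rho>) * h powr \<rho>)"
    proof -
      have "h \<le> (q - p) powr (1 - \<rho>) * h powr \<rho>"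
        using powr_le_mult_powr[of h "q - p" \<rho> 1] h \<rho> by simp
      then have "(M * kderiv 0 (p - a)) * h \<le> (M * kderiv 0 (p - a)) * ((q - p) powr (1 - \<rho>) * h powr \<rho>)"
        using M(1) kderiv_0_nonneg by (intro mult_left_mono) auto
      then show ?thesis by (simp add: mult_ac)
    qed
    also note 1
    also have "M * (A * h powr \<rho>) * ((t - a) powr X / X) \<le> M * (A * h powr \<rho>) * ((q - a) powr X / X)"
      using M(1) A(1) X t pq by (intro mult_left_mono divide_right_mono powr_mono2) auto
    also have "M * C * (h powr (\<theta> + \<kappa>) / \<kappa>) \<le> M * C * (((q - p) powr X * h powr \<rho>) / \<kappa>)"
      using powr_le_mult_powr[of h "q - p" \<rho> "\<theta> + \<kappa>"] M(1) C(1) \<kappa>_pos h \<rho>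
      by (intro mult_left_mono divide_right_mono) (auto simp: X_def)
    also have "M * kderiv 0 (p - a) * ((q - p) powr (1 - \<rho>) * h powr \<rho>) +
       (M * (A * h powr \<rho>) * ((q - a) powr X / X) + M * C * (((q - p) powr X * h powr \<rho>) / \<kappa>)) = B * h powr \<rho>"
      by (simp add: B_def algebra_simps)
    finally show ?thesis by (simp add: y)
  qed
  then show "\<exists>C. \<forall>s t. p \<le> s \<and> s < t \<and> t \<le> q \<longrightarrow> norm (kconv u {a<..} t - kconv u {a<..} s) \<le> C * (t - s) powr \<rho>"
    by blast
qed

lemma set_borel_measurable_if_continuous_on_above:
  assumes "continuous_on {a0<..} u" "a0 \<le> a"
  shows "set_borel_measurable lborel {a<..} (u :: real \<Rightarrow> complex)"
proof -
  have "continuous_on {a<..} u"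
    using assms(2) by (intro continuous_on_subset[OF assms(1)]) auto
  then show ?thesis
    using borel_measurable_continuous_on_indicator[of "{a<..}" u] by (simp add: set_borel_measurable_def)
qed

text \<open>If \<open>\<theta> + \<kappa> > 1\<close>, the convolution is continuously differentiable.  The formal derivative
  \<open>\<integral> K'(t - s) u(s) ds\<close> need not converge, but does so after subtracting \<open>u t\<close>, since
  $|K'(t-s)|\,|u(s)-u(t)|$ is of order $(t-s)^{\kappa-2+\theta}$; the subtracted constant contributes
  \<open>K (t - a) u t\<close>.\<close>

lemma kconv_taylor_base:
  assumes u: "C_holder_above a0 0 \<theta> u" and "a0 < a" and \<theta>: "0 \<le> \<theta>" "\<theta> + \<kappa> > 1"
  defines "D \<equiv> \<lambda>t. kderiv 0 (t - a) *\<^sub>R u t + (LINT s:{a<..}|lborel. complex_of_real (kderiv 1 (t - s)) * (u s - u t))"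
  shows "\<And>t. t > a \<Longrightarrow> (kconv u {a<..} has_vector_derivative D t) (at t)"
    "continuous_on {a<..} D"
    "\<And>t. t > a \<Longrightarrow> set_integrable lborel {a<..} (\<lambda>s. complex_of_real (kderiv 1 (t - s)) * (u s - u t))"
proof -
  \<comment> \<open>The order \<open>1 + \<rho>\<close> of the remainder: any \<open>\<rho>\<close> with \<open>0 < \<rho> \<le> 1\<close> and \<open>\<rho> < \<theta> + \<kappa> - 1\<close> will do.\<close>
  define \<rho> where "\<rho> = min 1 ((\<theta> + \<kappa> - 1) / 2)"
  have "\<rho> \<le> (\<theta> + \<kappa> - 1) / 2" unfolding \<rho>_def by (rule min.cobounded2)
  then have "\<rho> < \<theta> + \<kappa> - 1" using \<theta> by (simp add: field_simps)
  then have \<rho>: "0 < \<rho>" "\<rho> \<le> 1" "\<rho> < \<theta> + \<kappa> - 1" using \<theta> by (simp_all add: \<rho>_def)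
  have cont: "continuous_on {a0<..} u" using u by (rule continuous_on_if_C_holder_above)
  then have meas: "set_borel_measurable lborel {a<..} u"
    using \<open>a0 < a\<close> by (intro set_borel_measurable_if_continuous_on_above) auto
  obtain C where C: "C > 0" "\<And>r. r > 0 \<Longrightarrow> \<bar>kderiv 0 r\<bar> \<le> C * r powr (\<kappa> - 1)"
    using kderiv_bound[of 0] by auto
  obtain A where A: "A > 0" "\<And>r h. r > 0 \<Longrightarrow> h > 0 \<Longrightarrow>
      \<bar>kderiv 0 (r + h) - kderiv 0 r - h * kderiv 1 r\<bar> \<le> A * (h powr (1 + \<rho>) * r powr (\<kappa> - 2 - \<rho>))"
    using kderiv_taylor[of \<rho> 0] \<rho> by auto
  define X where "X = \<theta> + \<kappa> - 1 - \<rho>"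
  have X: "X > 0" using \<rho> by (simp add: X_def)
  {
    fix p q assume pq: "a < p" "p \<le> q"
    obtain M1 where M1: "M1 > 0" "\<And>s. s \<in> {a..q} \<Longrightarrow> norm (u s) \<le> M1"
      using bounded_on_Icc_above[OF cont \<open>a0 < a\<close>] by blast
    obtain M2 where M2: "M2 \<ge> 0" "\<And>s t. s \<in> {a..q} \<Longrightarrow> t \<in> {a..q} \<Longrightarrow> norm (u s - u t) \<le> M2 * \<bar>s - t\<bar> powr \<theta>"
      using C_holder_above_0E[OF u \<open>a0 < a\<close>] by blast
    define B where "B = M1 * \<bar>kderiv 1 (p - a)\<bar> * (q - p) powr (1 - \<rho>) + M2 * A * ((q - a) powr X / X) + M2 * C * ((q - p) powr X / \<kappa>)"
    have B: "B \<ge> 0" using M1 M2 A C X \<kappa>_pos by (auto simp: B_def intro!: add_nonneg_nonneg)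
    have main: "set_integrable lborel {a<..} (\<lambda>s. complex_of_real (h * kderiv 1 (t - s)) * (u s - u t)) \<and>
       norm (kconv u {a<..} (t + h) - kconv u {a<..} t - h *\<^sub>R D t) \<le> B * h powr (1 + \<rho>)"
      if t: "p \<le> t" "0 < h" "t + h \<le> q" for t h
    proof
      have C0: "C \<ge> 0" using C by simp
      have at: "a < t" "t \<le> q" using t pq by auto
      have early: "\<bar>kderiv 0 (t + h - s) - kderiv 0 (t - s) - h * kderiv 1 (t - s)\<bar> \<le> A * h powr (1 + \<rho>) * (t - s) powr (\<kappa> - 2 - \<rho>)"
        if "a < s" "s < t" for s
        using A(2)[of "t - s" h] that t by (simp add: algebra_simps)
      have ae: "AE s in lborel. a < s \<and> s < t + h \<longrightarrow> norm (u s - u t) \<le> M2 * \<bar>s - t\<bar> powr \<theta>"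
      proof (rule AE_I2, intro impI)
        fix s assume "a < s \<and> s < t + h"
        then show "norm (u s - u t) \<le> M2 * \<bar>s - t\<bar> powr \<theta>"
          using t at by (intro M2(2)) simp_all
      qed
      have Ah: "0 \<le> A * h powr (1 + \<rho>)" using A by simp
      have b: "-1 < \<kappa> - 2 - \<rho> + \<theta>" using \<rho> by simp
      have late: "h * kderiv 1 (t - s) = 0" if "t \<le> s" for s using that by simp
      have em: "(\<lambda>s. h * kderiv 1 (t - s)) \<in> borel_measurable borel" by measurable
      note core = kconv_increment_core[OF C(2) C0 M2(1) at(1) t(2) \<theta>(1) Ah b meas em late early ae]
      show "set_integrable lborel {a<..} (\<lambda>s. complex_of_real (h * kderiv 1 (t - s)) * (u s - u t))"
        using core(1) .
      have eq: "(LINT s:{a<..}|lborel. complex_of_real (h * kderiv 1 (t - s)) * (u s - u t)) =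
          h *\<^sub>R (LINT s:{a<..}|lborel. complex_of_real (kderiv 1 (t - s)) * (u s - u t))"
        by (simp add: scaleR_conv_of_real mult.assoc)
      have X': "\<kappa> - 2 - \<rho> + \<theta> + 1 = X" by (simp add: X_def)
      define Y where "Y = kconv u {a<..} (t + h) - kconv u {a<..} t - (kint a (t + h) - kint a t) *\<^sub>R u t
          - h *\<^sub>R (LINT s:{a<..}|lborel. complex_of_real (kderiv 1 (t - s)) * (u s - u t))"
      have Y: "norm Y \<le> M2 * (A * h powr (1 + \<rho>)) * ((t - a) powr X / X) + M2 * C * (h powr (\<theta> + \<kappa>) / \<kappa>)"
        using core(2) unfolding eq X' Y_def .
      have k: "\<bar>kint a (t + h) - kint a t - h * kderiv 0 (t - a)\<bar> \<le> h * (h * \<bar>kderiv 1 (p - a)\<bar>)"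
      proof -
        have "\<bar>kint a (t + h) - kint a t - h * kderiv 0 (t - a)\<bar> \<le> h * \<bar>kderiv 0 (t - a + h) - kderiv 0 (t - a)\<bar>"
        proof -
          have "h * \<bar>kderiv 0 (t - a + h) - kderiv 0 (t - a)\<bar> = h * kderiv 0 (t - a) - h * kderiv 0 (t - a + h)"
            using kderiv_0_antimono[of "t - a" "t - a + h"] at t by (simp add: algebra_simps)
          then show ?thesis using kint_increment[of a t h] at t by linarith
        qed
        also have "\<dots> \<le> h * (\<bar>t - a + h - (t - a)\<bar> * \<bar>kderiv (Suc 0) (p - a)\<bar>)"
          using t pq by (intro mult_left_mono kderiv_lip) auto
        finally show ?thesis using t by simp
      qed
      have "kconv u {a<..} (t + h) - kconv u {a<..} t - h *\<^sub>R D t = (kint a (t + h) - kint a t - h * kderiv 0 (t - a)) *\<^sub>R u t + Y"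
        unfolding D_def Y_def by (simp only: scaleR_add_right scaleR_diff_left scaleR_scaleR) simp
      also have "norm \<dots> \<le> norm ((kint a (t + h) - kint a t - h * kderiv 0 (t - a)) *\<^sub>R u t) + norm Y"
        by (rule norm_triangle_ineq)
      also have "norm ((kint a (t + h) - kint a t - h * kderiv 0 (t - a)) *\<^sub>R u t) \<le> (h * (h * \<bar>kderiv 1 (p - a)\<bar>)) * M1"
        unfolding norm_scaleR using k M1(2)[of t] at t by (intro mult_mono) auto
      also have "\<dots> \<le> M1 * \<bar>kderiv 1 (p - a)\<bar> * ((q - p) powr (1 - \<rho>) * h powr (1 + \<rho>))"
      proof -
        have "h * h \<le> (q - p) powr (1 - \<rho>) * h powr (1 + \<rho>)"
          using powr_le_mult_powr[of h "q - p" "1 + \<rho>" 2] t \<rho> by (simp add: power2_eq_square)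
        then have "(M1 * \<bar>kderiv 1 (p - a)\<bar>) * (h * h) \<le> (M1 * \<bar>kderiv 1 (p - a)\<bar>) * ((q - p) powr (1 - \<rho>) * h powr (1 + \<rho>))"
          using M1(1) by (intro mult_left_mono) auto
        then show ?thesis by (simp add: mult_ac)
      qed
      also note Y
      also have "M2 * (A * h powr (1 + \<rho>)) * ((t - a) powr X / X) \<le> M2 * (A * h powr (1 + \<rho>)) * ((q - a) powr X / X)"
        using M2(1) A(1) X at by (intro mult_left_mono divide_right_mono powr_mono2) auto
      also have "M2 * C * (h powr (\<theta> + \<kappa>) / \<kappa>) \<le> M2 * C * (((q - p) powr X * h powr (1 + \<rho>)) / \<kappa>)"
        using powr_le_mult_powr[of h "q - p" "1 + \<rho>" "\<theta> + \<kappa>"] M2(1) C(1) \<kappa>_pos t \<rho>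
        by (intro mult_left_mono divide_right_mono) (auto simp: X_def algebra_simps)
      also have "M1 * \<bar>kderiv 1 (p - a)\<bar> * ((q - p) powr (1 - \<rho>) * h powr (1 + \<rho>)) +
         (M2 * (A * h powr (1 + \<rho>)) * ((q - a) powr X / X) + M2 * C * (((q - p) powr X * h powr (1 + \<rho>)) / \<kappa>)) = B * h powr (1 + \<rho>)"
        by (simp add: B_def algebra_simps)
      finally show "norm (kconv u {a<..} (t + h) - kconv u {a<..} t - h *\<^sub>R D t) \<le> B * h powr (1 + \<rho>)" by simp
    qed
    then have "\<exists>C\<ge>0. \<forall>t h. p \<le> t \<and> 0 < h \<and> t + h \<le> q \<longrightarrow>
       norm (kconv u {a<..} (t + h) - kconv u {a<..} t - h *\<^sub>R D t) \<le> C * h powr (1 + \<rho>)" using B by blast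
    moreover have "set_integrable lborel {a<..} (\<lambda>s. complex_of_real (1 * kderiv 1 (t - s)) * (u s - u t))"
      if "p \<le> t" "t + 1 \<le> q" for t
      using main[of t 1, OF that(1) zero_less_one that(2)] by (rule conjunct1)
    ultimately have "\<exists>C\<ge>0. \<forall>t h. p \<le> t \<and> 0 < h \<and> t + h \<le> q \<longrightarrow>
       norm (kconv u {a<..} (t + h) - kconv u {a<..} t - h *\<^sub>R D t) \<le> C * h powr (1 + \<rho>)"
      "\<And>t. p \<le> t \<Longrightarrow> t + 1 \<le> q \<Longrightarrow> set_integrable lborel {a<..} (\<lambda>s. complex_of_real (1 * kderiv 1 (t - s)) * (u s - u t))"
      by blast+
  } note main = this
  have T: "\<exists>C\<ge>0. \<forall>t h. p \<le> t \<and> 0 < h \<and> t + h \<le> q \<longrightarrow>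
       norm (kconv u {a<..} (t + h) - kconv u {a<..} t - h *\<^sub>R D t) \<le> C * h powr (1 + \<rho>)"
    if "a < p" "p \<le> q" for p q by (rule main(1)[OF that])
  show "(kconv u {a<..} has_vector_derivative D t) (at t)" if "t > a" for t
    by (rule has_vector_derivative_if_right_taylor(1)[OF \<rho>(1) T that])
  show "continuous_on {a<..} D"
    by (rule has_vector_derivative_if_right_taylor(2)[OF \<rho>(1) T])
  show "set_integrable lborel {a<..} (\<lambda>s. complex_of_real (kderiv 1 (t - s)) * (u s - u t))" if "t > a" for t
    using main(2)[of t "t + 1" t] that by simp
qed

text \<open>For continuously differentiable \<open>u\<close> the derivative of the convolution takes the usual form.
  The function \<open>F s = - K (t - s) (u s - u t)\<close> is continuous up to \<open>s = t\<close>, where it vanishes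
  because \<open>u\<close> is Lipschitz, and its derivative is the difference of the two integrands.\<close>

lemma kconv_deriv_by_parts:
  assumes der: "\<And>s. s > a0 \<Longrightarrow> (u has_vector_derivative u' s) (at s)"
    and cont': "continuous_on {a0<..} u'" and "a0 < a" "a < t"
    and int1: "set_integrable lborel {a<..} (\<lambda>s. complex_of_real (kderiv 1 (t - s)) * (u s - u t))"
  shows "kderiv 0 (t - a) *\<^sub>R u t + (LINT s:{a<..}|lborel. complex_of_real (kderiv 1 (t - s)) * (u s - u t))
    = kderiv 0 (t - a) *\<^sub>R u a + kconv u' {a<..} t"
proof -
  obtain C where C: "C > 0" "\<And>r. r > 0 \<Longrightarrow> \<bar>kderiv 0 r\<bar> \<le> C * r powr (\<kappa> - 1)"
    using kderiv_bound[of 0] by auto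
  have u1: "C_holder_above a0 0 1 u" by (rule C_holder_above_0_if_C1[OF der cont']) auto
  obtain L where L: "L \<ge> 0" "\<And>s x. s \<in> {a..t} \<Longrightarrow> x \<in> {a..t} \<Longrightarrow> norm (u s - u x) \<le> L * \<bar>s - x\<bar> powr 1"
    using C_holder_above_0E[OF u1 \<open>a0 < a\<close>] by blast
  obtain M where M: "M > 0" "\<And>s. s \<in> {a..t} \<Longrightarrow> norm (u' s) \<le> M"
    using bounded_on_Icc_above[OF cont' \<open>a0 < a\<close>] by blast
  have int2: "set_integrable lborel {a<..} (\<lambda>s. complex_of_real (kderiv 0 (t - s)) * u' s)"
  proof (rule kconv_bounded(1)[OF C(2)])
    show "set_borel_measurable lborel {a<..} u'"
      using cont' \<open>a0 < a\<close> by (intro set_borel_measurable_if_continuous_on_above) auto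
    show "AE s in lborel. a < s \<and> s < t \<longrightarrow> norm (u' s) \<le> M" by (rule AE_I2) (use M in auto)
  qed (use C M \<open>a < t\<close> in auto)
  define \<Phi> where "\<Phi> s = complex_of_real (kderiv 1 (t - s)) * (u s - u t) - complex_of_real (kderiv 0 (t - s)) * u' s" for s
  define F where "F s = - (complex_of_real (kderiv 0 (t - s)) * (u s - u t))" for s
  have int: "set_integrable lborel {a<..} \<Phi>" unfolding \<Phi>_def by (intro set_integral_diff(1) int1 int2)
  have zero: "\<Phi> s = 0" if "s \<ge> t" for s using that by (simp add: \<Phi>_def)
  have der_F: "(F has_vector_derivative \<Phi> s) (at s)" if "a < s" "s < t" for s
  proof -
    have "((\<lambda>s. kderiv 0 (t - s)) has_real_derivative (kderiv (Suc 0) (t - s) * (0 - 1))) (at s)"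
      using that by (intro DERIV_chain2[where f = "kderiv 0" and g = "\<lambda>s. t - s"] kderiv_has_real_derivative derivative_intros) auto
    then have "((\<lambda>s. complex_of_real (kderiv 0 (t - s))) has_vector_derivative (of_real (- kderiv 1 (t - s)))) (at s)"
      by (intro has_vector_derivative_of_real) (simp add: has_real_derivative_iff_has_vector_derivative)
    then have "((\<lambda>s. - (complex_of_real (kderiv 0 (t - s)) * (u s - u t))) has_vector_derivative
       - (complex_of_real (kderiv 0 (t - s)) * (u' s - 0) + of_real (- kderiv 1 (t - s)) * (u s - u t))) (at s)"
      using that \<open>a0 < a\<close>
      by (intro has_vector_derivative_minus has_vector_derivative_mult has_vector_derivative_diff has_vector_derivative_const der) auto
    then show ?thesis unfolding F_def[abs_def] \<Phi>_def by (simp add: algebra_simps)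
  qed
  have "continuous_on {a..t} F"
    unfolding continuous_on_eq_continuous_within
  proof
    fix s assume s: "s \<in> {a..t}"
    show "continuous (at s within {a..t}) F"
    proof (cases "s = t")
      case False
      have "isCont (\<lambda>s. kderiv 0 (t - s)) s"
        using s False by (intro continuous_intros isCont_o2[of _ "\<lambda>s. t - s" "kderiv 0"] DERIV_isCont[OF kderiv_has_real_derivative]) auto
      moreover have "isCont u s" using der[of s] s \<open>a0 < a\<close> by (auto intro: has_vector_derivative_continuous)
      ultimately have "isCont F s" unfolding F_def[abs_def] by (intro continuous_intros)
      then show ?thesis by (rule continuous_at_imp_continuous_at_within)
    next
      case True
      have "((\<lambda>s. C * L * (t - s) powr \<kappa>) \<longlongrightarrow> C * L * (t - t) powr \<kappa>) (at t within {a..t})"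
        using \<kappa>_pos by (intro tendsto_intros) (auto simp: eventually_at_filter)
      then have lim: "((\<lambda>s. C * L * (t - s) powr \<kappa>) \<longlongrightarrow> 0) (at t within {a..t})" by simp
      have "norm (F s - 0) \<le> C * L * (t - s) powr \<kappa>" if "s \<in> {a..t}" "s \<noteq> t" for s
      proof -
        have "norm (F s - 0) \<le> (C * (t - s) powr (\<kappa> - 1)) * (L * \<bar>s - t\<bar> powr 1)"
          unfolding F_def diff_0_right norm_minus_cancel norm_mult norm_of_real
          using that C(1) \<open>a < t\<close> by (intro mult_mono C(2) L(2)) auto
        also have "\<dots> = C * L * (t - s) powr \<kappa>"
          using that powr_add[of "t - s" "\<kappa> - 1" 1] by (simp add: abs_if mult_ac)
        finally show ?thesis .
      qed
      then have "(F \<longlongrightarrow> 0) (at t within {a..t})"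
        by (intro Lim_null_comparison[OF _ lim]) (auto simp: eventually_at_filter)
      then show ?thesis by (simp add: True continuous_within F_def)
    qed
  qed
  then have "(\<Phi> has_integral F t - F a) {a..t}"
    using der_F \<open>a < t\<close> by (intro fundamental_theorem_of_calculus_interior) auto
  then have "integral {a..t} \<Phi> = - F a" by (simp add: integral_unique F_def)
  moreover have "(LINT s:{a<..}|lborel. \<Phi> s) = integral {a..t} \<Phi>"
  proof -
    have AEa: "AE s in lborel. s \<noteq> a" by (rule AE_lborel_singleton)
    have intA: "set_integrable lborel {a<..t} \<Phi>" by (rule set_integrable_subset[OF int]) auto
    have "(LINT s:{a<..}|lborel. \<Phi> s) = (LINT s:{a<..t}|lborel. \<Phi> s)"
      unfolding set_lebesgue_integral_def
      by (intro Bochner_Integration.integral_cong) (auto simp: indicator_def zero)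
    also have "\<dots> = integral {a<..t} \<Phi>" by (rule set_borel_integral_eq_integral(2)[OF intA])
    also have "\<dots> = integral {a..t} \<Phi>"
    proof (rule integral_spike_set)
      show "negligible {x \<in> {a<..t} - {a..t}. \<Phi> x \<noteq> 0}" by (rule negligible_subset[of "{a}"]) auto
      show "negligible {x \<in> {a..t} - {a<..t}. \<Phi> x \<noteq> 0}" by (rule negligible_subset[of "{a}"]) auto
    qed
    finally show ?thesis .
  qed
  moreover have "(LINT s:{a<..}|lborel. \<Phi> s) =
      (LINT s:{a<..}|lborel. complex_of_real (kderiv 1 (t - s)) * (u s - u t)) - kconv u' {a<..} t"
    unfolding \<Phi>_def kconv_def by (rule set_integral_diff(2)[OF int1 int2])
  ultimately have "(LINT s:{a<..}|lborel. complex_of_real (kderiv 1 (t - s)) * (u s - u t)) - kconv u' {a<..} t = - F a"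
    by simp
  then show ?thesis
    by (simp add: F_def scaleR_conv_of_real algebra_simps)
qed

lemma C_holder_above_kderiv_shift:
  assumes "\<theta> \<le> 1"
  shows "C_holder_above a m \<theta> (\<lambda>t. kderiv 0 (t - a) *\<^sub>R w)"
proof (rule C_holder_above_smooth_family[where F = "\<lambda>n t. kderiv n (t - a) *\<^sub>R w" and n = 0, simplified])
  fix n and t :: real assume "a < t"
  then have "((\<lambda>t. kderiv n (t - a)) has_real_derivative (kderiv (Suc n) (t - a) * 1)) (at t)"
    by (intro DERIV_chain2[OF kderiv_has_real_derivative]) (auto intro!: derivative_eq_intros)
  then have "((\<lambda>t. kderiv n (t - a)) has_real_derivative kderiv (Suc n) (t - a)) (at t)" by simp
  then show "((\<lambda>t. kderiv n (t - a) *\<^sub>R w) has_vector_derivative kderiv (Suc n) (t - a) *\<^sub>R w) (at t)"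
    by (auto intro!: derivative_eq_intros)
qed (rule assms)

text \<open>The boundary term \<open>K (t - a) u a\<close> is smooth after \<open>a\<close>, so this reduces statements about
  $C^{m+1}$ to statements about $C^m$.\<close>

lemma kconv_C1_step:
  assumes u: "C_holder_above a0 (Suc m) \<theta> u" and "a0 < a"
  obtains u' where "C_holder_above a0 m \<theta> u'"
    "\<And>t. t > a \<Longrightarrow> (kconv u {a<..} has_vector_derivative (kderiv 0 (t - a) *\<^sub>R u a + kconv u' {a<..} t)) (at t)"
proof -
  obtain u' where u': "\<And>t. t > a0 \<Longrightarrow> (u has_vector_derivative u' t) (at t)" "C_holder_above a0 m \<theta> u'"
    using u by (rule C_holder_above_SucE) blast
  have cont': "continuous_on {a0<..} u'" using u'(2) by (rule continuous_on_if_C_holder_above)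
  have u1: "C_holder_above a0 0 1 u" by (rule C_holder_above_0_if_C1[OF u'(1) cont']) auto
  have \<kappa>1: "1 + \<kappa> > 1" using \<kappa>_pos by simp
  note T = kconv_taylor_base[OF u1 \<open>a0 < a\<close> zero_le_one \<kappa>1]
  show ?thesis
  proof (rule that[OF u'(2)])
    fix t assume t: "t > a"
    show "(kconv u {a<..} has_vector_derivative (kderiv 0 (t - a) *\<^sub>R u a + kconv u' {a<..} t)) (at t)"
      by (rule has_vector_derivative_eq_rhs[OF T(1)[OF t] kconv_deriv_by_parts[OF u'(1) cont' \<open>a0 < a\<close> t T(3)[OF t]]])
  qed
qed

lemma kconv_gain_holder:
  assumes "C_holder_above a0 m \<theta> u" "a0 < a" "0 \<le> \<theta>" "0 < \<rho>" "\<rho> \<le> 1" "\<rho> < \<theta> + \<kappa>"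
  shows "C_holder_above a m \<rho> (kconv u {a<..})"
  using assms(1)
proof (induction m arbitrary: u)
  case 0
  have cont: "continuous_on {a0<..} u" using 0 by (rule continuous_on_if_C_holder_above)
  show ?case
  proof (rule kconv_holder_base[where \<theta> = \<theta>])
    show "set_borel_measurable lborel {a<..} u"
      using cont \<open>a0 < a\<close> by (intro set_borel_measurable_if_continuous_on_above) auto
    fix p q assume pq: "a < p" "p \<le> q"
    obtain M1 where M1: "M1 > 0" "\<And>s. s \<in> {a..q} \<Longrightarrow> norm (u s) \<le> M1"
      using bounded_on_Icc_above[OF cont \<open>a0 < a\<close>] by blast
    obtain M2 where M2: "M2 \<ge> 0" "\<And>s t. s \<in> {a..q} \<Longrightarrow> t \<in> {a..q} \<Longrightarrow> norm (u s - u t) \<le> M2 * \<bar>s - t\<bar> powr \<theta>"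
      using C_holder_above_0E[OF 0 \<open>a0 < a\<close>] by blast
    have "norm (u t) \<le> M1 + M2" if "t \<in> {p..q}" for t using M1(2)[of t] M2(1) that pq by auto
    moreover have "norm (u s - u t) \<le> (M1 + M2) * \<bar>s - t\<bar> powr \<theta>" if "a < s \<and> s < q" "t \<in> {p..q}" for s t
    proof -
      have "norm (u s - u t) \<le> M2 * \<bar>s - t\<bar> powr \<theta>" using that pq by (intro M2(2)) auto
      also have "\<dots> \<le> (M1 + M2) * \<bar>s - t\<bar> powr \<theta>" using M1(1) by (intro mult_right_mono) auto
      finally show ?thesis .
    qed
    moreover have "M1 + M2 \<ge> 0" using M1 M2 by simp
    ultimately show "\<exists>M\<ge>0. \<forall>t\<in>{p..q}. \<exists>z. norm z \<le> M \<and>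
        (AE s in lborel. a < s \<and> s < q \<longrightarrow> norm (u s - z) \<le> M * \<bar>s - t\<bar> powr \<theta>)"
      by (intro exI[of _ "M1 + M2"] conjI ballI exI[of _ "u _"] AE_I2 impI) blast+
  qed (use assms in auto)
next
  case (Suc m)
  obtain u' where u': "C_holder_above a0 m \<theta> u'"
    "\<And>t. t > a \<Longrightarrow> (kconv u {a<..} has_vector_derivative (kderiv 0 (t - a) *\<^sub>R u a + kconv u' {a<..} t)) (at t)"
    using kconv_C1_step[OF Suc.prems \<open>a0 < a\<close>] by blast
  have "C_holder_above a m \<rho> (\<lambda>t. kderiv 0 (t - a) *\<^sub>R u a + kconv u' {a<..} t)"
    by (intro C_holder_above_add C_holder_above_kderiv_shift Suc.IH u'(1) assms)
  with u'(2) show ?case by (rule C_holder_above_SucI)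
qed

lemma kconv_gain_derivative:
  assumes "C_holder_above a0 m \<theta> u" "a0 < a" "0 \<le> \<theta>" "\<theta> + \<kappa> > 1"
  shows "C_holder_above a (Suc m) 0 (kconv u {a<..})"
  using assms(1)
proof (induction m arbitrary: u)
  case 0
  let ?D = "\<lambda>t. kderiv 0 (t - a) *\<^sub>R u t + (LINT s:{a<..}|lborel. complex_of_real (kderiv 1 (t - s)) * (u s - u t))"
  note T = kconv_taylor_base[OF 0 assms(2-4)]
  have "C_holder_above a 0 0 ?D"
    using T(2) by (simp only: C_holder_above_0_0_iff)
  with T(1) show ?case by (rule C_holder_above_SucI)
next
  case (Suc m)
  obtain u' where u': "C_holder_above a0 m \<theta> u'"
    "\<And>t. t > a \<Longrightarrow> (kconv u {a<..} has_vector_derivative (kderiv 0 (t - a) *\<^sub>R u a + kconv u' {a<..} t)) (at t)"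
    using kconv_C1_step[OF Suc.prems \<open>a0 < a\<close>] by blast
  have "C_holder_above a (Suc m) 0 (\<lambda>t. kderiv 0 (t - a) *\<^sub>R u a + kconv u' {a<..} t)"
    by (intro C_holder_above_add C_holder_above_kderiv_shift Suc.IH u'(1)) auto
  with u'(2) show ?case by (rule C_holder_above_SucI)
qed

lemma set_integrable_kderiv_past:
  assumes int: "set_integrable lborel A u" and A: "A \<in> sets borel" "A \<subseteq> {..a}" and t: "t > a"
  shows "set_integrable lborel A (\<lambda>s. complex_of_real (kderiv n (t - s)) * u s)"
proof -
  have [measurable]: "(\<lambda>s. indicator A s *\<^sub>R u s) \<in> borel_measurable lborel"
    using int by (auto simp: set_integrable_def)
  have eq: "(\<lambda>s. indicator A s *\<^sub>R (complex_of_real (kderiv n (t - s)) * u s)) =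
    (\<lambda>s. complex_of_real (kderiv n (t - s)) * (indicator A s *\<^sub>R u s))"
    by (auto simp: fun_eq_iff)
  show ?thesis
  proof (rule set_integrable_bound[of _ _ "\<lambda>s. \<bar>kderiv n (t - a)\<bar> *\<^sub>R u s"])
    show "set_integrable lborel A (\<lambda>s. \<bar>kderiv n (t - a)\<bar> *\<^sub>R u s)" using int by blast
    show "set_borel_measurable lborel A (\<lambda>s. complex_of_real (kderiv n (t - s)) * u s)"
      unfolding set_borel_measurable_def eq by measurable
    have "\<bar>kderiv n (t - s)\<bar> \<le> \<bar>kderiv n (t - a)\<bar>" if "s \<in> A" for s
      using that A t by (intro kderiv_abs_antimono) auto
    then show "AE s in lborel. s \<in> A \<longrightarrow> norm (complex_of_real (kderiv n (t - s)) * u s) \<le> norm (\<bar>kderiv n (t - a)\<bar> *\<^sub>R u s)"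
      by (auto simp: norm_mult intro!: mult_right_mono)
  qed
qed

text \<open>After \<open>a\<close> the kernel is evaluated away from its singularity, where all its derivatives are
  bounded, so one may differentiate under the integral for any integrable \<open>u\<close>.\<close>

lemma kconv_past_smooth:
  assumes int: "set_integrable lborel A u" and A: "A \<in> sets borel" "A \<subseteq> {..a}" and "\<theta> \<le> 1"
  shows "C_holder_above a m \<theta> (kconv u A)"
proof -
  define F where "F n t = (LINT s:A|lborel. complex_of_real (kderiv n (t - s)) * u s)" for n t
  note intn = set_integrable_kderiv_past[OF int A]
  have der: "(F n has_vector_derivative F (Suc n) t) (at t)" if t: "t > a" for n t
  proof -
    define d where "d = (t - a) / 2"
    have d: "d > 0" and d2: "t = a + 2 * d" using t by (simp_all add: d_def field_simps)
    define B where "B = \<bar>kderiv (Suc (Suc n)) d\<bar> * (LINT s:A|lborel. norm (u s))"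
    have bd: "norm (F n y - F n t - (y - t) *\<^sub>R F (Suc n) t) \<le> (y - t)\<^sup>2 * B" if y: "\<bar>y - t\<bar> < d" for y
    proof -
      have yd: "a + d < y" using y d2 by linarith
      then have ya: "y > a" using d by simp
      define E where "E s = complex_of_real (kderiv n (y - s)) * u s - complex_of_real (kderiv n (t - s)) * u s
         - (y - t) *\<^sub>R (complex_of_real (kderiv (Suc n) (t - s)) * u s)" for s
      have intE: "set_integrable lborel A E"
        unfolding E_def[abs_def] by (intro set_integral_diff(1) intn ya t set_integrable_scaleR_right)
      have intE': "set_integrable lborel A (\<lambda>s. norm (E s))" using intE by (rule set_integrable_norm)
      have intu: "set_integrable lborel A (\<lambda>s. ((y - t)\<^sup>2 * \<bar>kderiv (Suc (Suc n)) d\<bar>) * norm (u s))"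
        by (rule set_integrable_mult_right, rule set_integrable_norm[OF int])
      have bound: "norm (E s) \<le> ((y - t)\<^sup>2 * \<bar>kderiv (Suc (Suc n)) d\<bar>) * norm (u s)" if s: "s \<in> A" for s
      proof -
        have "E s = complex_of_real (kderiv n (y - s) - kderiv n (t - s) - (y - t) * kderiv (Suc n) (t - s)) * u s"
          by (simp add: E_def algebra_simps scaleR_conv_of_real)
        then have "norm (E s) = \<bar>kderiv n (y - s) - kderiv n (t - s) - ((y - s) - (t - s)) * kderiv (Suc n) (t - s)\<bar> * norm (u s)"
          by (simp only: norm_mult norm_of_real diff_diff_eq2 diff_add_cancel)
        also have "\<dots> \<le> (((y - s) - (t - s))\<^sup>2 * \<bar>kderiv (Suc (Suc n)) d\<bar>) * norm (u s)"
        proof (intro mult_right_mono kderiv_taylor_away d norm_ge_zero)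
          show "d \<le> t - s" "d \<le> y - s" using s A d d2 yd by auto
        qed
        finally show ?thesis by simp
      qed
      have "F n y - F n t - (y - t) *\<^sub>R F (Suc n) t = (LINT s:A|lborel. E s)"
        unfolding F_def E_def
        by (simp only: set_integral_diff(2)[OF set_integral_diff(1)[OF intn[OF ya] intn[OF t]] set_integrable_scaleR_right[OF intn[OF t]]]
              set_integral_diff(2)[OF intn[OF ya] intn[OF t]] set_integral_scaleR_right)
      also have "norm \<dots> \<le> (LINT s:A|lborel. norm (E s))"
        by (rule set_integral_norm_bound[OF intE])
      also have "\<dots> \<le> (LINT s:A|lborel. ((y - t)\<^sup>2 * \<bar>kderiv (Suc (Suc n)) d\<bar>) * norm (u s))"
        by (rule set_integral_mono[OF intE' intu bound])
      also have "\<dots> = (y - t)\<^sup>2 * B" by (simp add: B_def mult.assoc)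
      finally show ?thesis .
    qed
    show ?thesis
      unfolding has_vector_derivative_def has_derivative_within
    proof (intro conjI bounded_linear_scaleR_left)
      show "((\<lambda>y. (1 / norm (y - t)) *\<^sub>R (F n y - (F n t + (y - t) *\<^sub>R F (Suc n) t))) \<longlongrightarrow> 0) (at t)"
      proof (rule Lim_null_comparison)
        show "((\<lambda>y. \<bar>y - t\<bar> * B) \<longlongrightarrow> 0) (at t)" by (auto intro!: tendsto_eq_intros)
        have "norm ((1 / norm (y - t)) *\<^sub>R (F n y - (F n t + (y - t) *\<^sub>R F (Suc n) t))) \<le> \<bar>y - t\<bar> * B"
          if "\<bar>y - t\<bar> < d" "y \<noteq> t" for y
        proof -
          have "norm ((1 / norm (y - t)) *\<^sub>R (F n y - (F n t + (y - t) *\<^sub>R F (Suc n) t)))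
              = norm (F n y - F n t - (y - t) *\<^sub>R F (Suc n) t) / \<bar>y - t\<bar>"
            by (simp add: diff_diff_eq)
          also have "\<dots> \<le> ((y - t)\<^sup>2 * B) / \<bar>y - t\<bar>"
            by (intro divide_right_mono bd that(1)) auto
          also have "\<dots> = \<bar>y - t\<bar> * B"
          proof -
            have sq: "(y - t)\<^sup>2 = \<bar>y - t\<bar> * \<bar>y - t\<bar>" by (simp add: power2_eq_square)
            have "w * w * B / w = w * B" if "w \<noteq> 0" for w :: real using that by simp
            from this[of "\<bar>y - t\<bar>"] show ?thesis unfolding sq using \<open>y \<noteq> t\<close> by (simp only: abs_eq_0 right_minus_eq not_False_eq_True)
          qed
          finally show ?thesis .
        qed
        moreover have "\<forall>\<^sub>F y in at t. \<bar>y - t\<bar> < d"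
          using d unfolding eventually_at by (auto simp: dist_real_def)
        ultimately show "\<forall>\<^sub>F y in at t. norm ((1 / norm (y - t)) *\<^sub>R (F n y - (F n t + (y - t) *\<^sub>R F (Suc n) t))) \<le> \<bar>y - t\<bar> * B"
          by (auto simp: eventually_at_filter elim!: eventually_mono)
      qed
    qed
  qed
  have "C_holder_above a m \<theta> (F 0)"
    by (rule C_holder_above_smooth_family[of a F, OF der \<open>\<theta> \<le> 1\<close>])
  also have "F 0 = kconv u A" by (simp add: F_def kconv_def fun_eq_iff)
  finally show ?thesis .
qed

end

section \<open>Local boundedness of solutions\<close>

text \<open>Young's inequality for $L^2 * L^1$: Cauchy--Schwarz with respect to the measure with density
  \<open>a\<close>, followed by Tonelli.\<close>

lemma nn_integral_young:
  fixes k a :: "real \<Rightarrow> ennreal"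
  assumes [measurable]: "k \<in> borel_measurable borel" "a \<in> borel_measurable borel"
  shows "(\<integral>\<^sup>+t. (\<integral>\<^sup>+s. k (t - s) * a s \<partial>lborel)\<^sup>2 \<partial>lborel) \<le> (\<integral>\<^sup>+r. (k r)\<^sup>2 \<partial>lborel) * (\<integral>\<^sup>+s. a s \<partial>lborel)\<^sup>2"
proof -
  have cs: "(\<integral>\<^sup>+s. k (t - s) * a s \<partial>lborel)\<^sup>2 \<le> (\<integral>\<^sup>+s. a s * (k (t - s))\<^sup>2 \<partial>lborel) * (\<integral>\<^sup>+s. a s \<partial>lborel)" for t
    using Cauchy_Schwarz_nn_integral[of "\<lambda>s. k (t - s)" "density lborel a" "\<lambda>_. 1"]
    by (simp add: nn_integral_density emeasure_density mult.commute)
  have shift: "(\<integral>\<^sup>+t. (k (t - s))\<^sup>2 \<partial>lborel) = (\<integral>\<^sup>+r. (k r)\<^sup>2 \<partial>lborel)" for s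
    using nn_integral_real_affine[of "\<lambda>r. (k r)\<^sup>2" 1 "-s"] by (simp add: add.commute)
  have "(\<integral>\<^sup>+t. (\<integral>\<^sup>+s. k (t - s) * a s \<partial>lborel)\<^sup>2 \<partial>lborel)
      \<le> (\<integral>\<^sup>+t. (\<integral>\<^sup>+s. a s * (k (t - s))\<^sup>2 \<partial>lborel) * (\<integral>\<^sup>+s. a s \<partial>lborel) \<partial>lborel)"
    by (intro nn_integral_mono cs)
  also have "\<dots> = (\<integral>\<^sup>+t. (\<integral>\<^sup>+s. a s * (k (t - s))\<^sup>2 \<partial>lborel) \<partial>lborel) * (\<integral>\<^sup>+s. a s \<partial>lborel)"
    by (subst nn_integral_multc) auto
  also have "(\<integral>\<^sup>+t. (\<integral>\<^sup>+s. a s * (k (t - s))\<^sup>2 \<partial>lborel) \<partial>lborel) = (\<integral>\<^sup>+s. (\<integral>\<^sup>+t. a s * (k (t - s))\<^sup>2 \<partial>lborel) \<partial>lborel)"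
    by (rule lborel_pair.Fubini') measurable
  also have "\<dots> = (\<integral>\<^sup>+s. a s * (\<integral>\<^sup>+r. (k r)\<^sup>2 \<partial>lborel) \<partial>lborel)"
    by (intro nn_integral_cong) (simp add: nn_integral_cmult shift)
  also have "\<dots> = (\<integral>\<^sup>+s. a s \<partial>lborel) * (\<integral>\<^sup>+r. (k r)\<^sup>2 \<partial>lborel)"
    by (subst nn_integral_multc) auto
  finally show ?thesis by (simp add: power2_eq_square mult_ac)
qed

text \<open>By Young's inequality and Cauchy--Schwarz, $\|d\|_2 \le \|k\|_2 \|w d\|_1 \le \|k\|_2 \|w\|_2
  \|d\|_2$, and the factor in front of the last norm is less than \<open>1\<close>.\<close>

lemma nn_integral_absorption:
  fixes k w d :: "real \<Rightarrow> ennreal"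
  assumes [measurable]: "k \<in> borel_measurable borel" "w \<in> borel_measurable borel" "d \<in> borel_measurable borel"
    and le: "AE t in lborel. d t \<le> (\<integral>\<^sup>+s. k (t - s) * (w s * d s) \<partial>lborel)"
    and small: "(\<integral>\<^sup>+r. (k r)\<^sup>2 \<partial>lborel) * (\<integral>\<^sup>+s. (w s)\<^sup>2 \<partial>lborel) < 1"
    and fin: "(\<integral>\<^sup>+t. (d t)\<^sup>2 \<partial>lborel) < \<infinity>"
  shows "AE t in lborel. d t = 0"
proof -
  let ?D = "\<integral>\<^sup>+t. (d t)\<^sup>2 \<partial>lborel" and ?q = "(\<integral>\<^sup>+r. (k r)\<^sup>2 \<partial>lborel) * (\<integral>\<^sup>+s. (w s)\<^sup>2 \<partial>lborel)"
  have "?D \<le> (\<integral>\<^sup>+t. (\<integral>\<^sup>+s. k (t - s) * (w s * d s) \<partial>lborel)\<^sup>2 \<partial>lborel)"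
    using le by (intro nn_integral_mono_AE) (auto elim!: eventually_mono intro: power_mono)
  also have "\<dots> \<le> (\<integral>\<^sup>+r. (k r)\<^sup>2 \<partial>lborel) * (\<integral>\<^sup>+s. w s * d s \<partial>lborel)\<^sup>2"
    by (rule nn_integral_young) measurable
  also have "\<dots> \<le> (\<integral>\<^sup>+r. (k r)\<^sup>2 \<partial>lborel) * ((\<integral>\<^sup>+s. (w s)\<^sup>2 \<partial>lborel) * ?D)"
    by (intro mult_left_mono Cauchy_Schwarz_nn_integral) auto
  finally have "?D \<le> ?q * ?D" by (simp add: mult_ac)
  have "?D = 0"
  proof (rule ccontr)
    assume "?D \<noteq> 0"
    then have "?q * ?D < 1 * ?D"
      using small fin by (intro ennreal_mult_strict_right_mono) (auto simp: zero_less_iff_neq_zero)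
    with \<open>?D \<le> ?q * ?D\<close> show False by simp
  qed
  then show ?thesis by (subst (asm) nn_integral_0_iff_AE) auto
qed

text \<open>The radial (nearest point) projection onto the closed disc of radius \<open>r\<close>.\<close>

definition ball_proj :: "real \<Rightarrow> complex \<Rightarrow> complex" where
  "ball_proj r z = (if norm z \<le> r then z else (r / norm z) *\<^sub>R z)"

lemma ball_proj_measurable [measurable]: "ball_proj r \<in> borel_measurable borel"
  unfolding ball_proj_def[abs_def] by measurable

lemma norm_ball_proj_le: "r \<ge> 0 \<Longrightarrow> norm (ball_proj r z) \<le> r"
  and norm_ball_proj_le_norm: "r \<ge> 0 \<Longrightarrow> norm (ball_proj r z) \<le> norm z"
  by (auto simp: ball_proj_def)

lemma norm_diff_ball_proj:
  assumes "r \<ge> 0" shows "norm (z - ball_proj r z) = max 0 (norm z - r)"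
proof (cases "norm z \<le> r")
  case False
  then have "z - ball_proj r z = ((norm z - r) / norm z) *\<^sub>R z"
    using assms by (auto simp: ball_proj_def diff_divide_distrib scaleR_diff_left)
  then show ?thesis using False assms by auto
qed (auto simp: ball_proj_def)

lemma norm_riccati_le: "norm (riccati \<beta> \<sigma> z) \<le> \<bar>\<beta>\<bar> * norm z + \<sigma>\<^sup>2 / 2 * (norm z)\<^sup>2"
proof -
  have "norm (riccati \<beta> \<sigma> z) \<le> norm (complex_of_real \<beta> * z) + norm (complex_of_real (\<sigma>\<^sup>2 / 2) * z\<^sup>2)"
    unfolding riccati_def by (rule norm_triangle_ineq)
  also have "\<dots> = \<bar>\<beta>\<bar> * norm z + \<sigma>\<^sup>2 / 2 * (norm z)\<^sup>2"
    unfolding norm_mult norm_of_real norm_power by simp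
  finally show ?thesis .
qed

lemma norm_riccati_diff_le:
  assumes "norm y \<le> norm z"
  shows "norm (riccati \<beta> \<sigma> z - riccati \<beta> \<sigma> y) \<le> (\<bar>\<beta>\<bar> + \<sigma>\<^sup>2 * norm z) * norm (z - y)"
proof -
  have "b * z + c * z\<^sup>2 - (b * y + c * y\<^sup>2) = (b + c * (z + y)) * (z - y)" for b c :: complex
    by (simp add: algebra_simps power2_eq_square)
  then have "riccati \<beta> \<sigma> z - riccati \<beta> \<sigma> y = (complex_of_real \<beta> + complex_of_real (\<sigma>\<^sup>2 / 2) * (z + y)) * (z - y)"
    unfolding riccati_def .
  also have "norm \<dots> \<le> (\<bar>\<beta>\<bar> + \<sigma>\<^sup>2 / 2 * (norm z + norm z)) * norm (z - y)"
    unfolding norm_mult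
  proof (rule mult_right_mono)
    have "norm (complex_of_real \<beta> + complex_of_real (\<sigma>\<^sup>2 / 2) * (z + y))
       \<le> norm (complex_of_real \<beta>) + norm (complex_of_real (\<sigma>\<^sup>2 / 2) * (z + y))" by (rule norm_triangle_ineq)
    also have "\<dots> = \<bar>\<beta>\<bar> + \<sigma>\<^sup>2 / 2 * norm (z + y)" unfolding norm_mult norm_of_real by simp
    also have "\<dots> \<le> \<bar>\<beta>\<bar> + \<sigma>\<^sup>2 / 2 * (norm z + norm z)"
      using norm_triangle_ineq[of z y] assms by (intro add_left_mono mult_left_mono) auto
    finally show "norm (complex_of_real \<beta> + complex_of_real (\<sigma>\<^sup>2 / 2) * (z + y)) \<le> \<bar>\<beta>\<bar> + \<sigma>\<^sup>2 / 2 * (norm z + norm z)" .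
  qed auto
  finally show ?thesis by simp
qed

lemma riccati_measurable [measurable]: "riccati \<beta> \<sigma> \<in> borel_measurable borel"
  unfolding riccati_def[abs_def] by measurable

lemma ennreal_norm_set_integral_le:
  fixes f :: "real \<Rightarrow> complex"
  shows "ennreal (norm (LINT s:A|lborel. f s)) \<le> (\<integral>\<^sup>+s. indicator A s * ennreal (norm (f s)) \<partial>lborel)"
proof (cases "set_integrable lborel A f")
  case True
  then have "ennreal (norm (LINT s:A|lborel. f s)) \<le> (\<integral>\<^sup>+s. ennreal (norm (indicator A s *\<^sub>R f s)) \<partial>lborel)"
    unfolding set_integrable_def set_lebesgue_integral_def by (rule integral_norm_bound_ennreal)
  also have "\<dots> = (\<integral>\<^sup>+s. indicator A s * ennreal (norm (f s)) \<partial>lborel)"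
    by (intro nn_integral_cong) (auto simp: indicator_def)
  finally show ?thesis .
next
  case False
  then show ?thesis
    by (simp add: set_lebesgue_integral_def set_integrable_def not_integrable_integral_eq)
qed

context cm_kernel
begin

text \<open>Let \<open>P\<close> be the projection onto the disc \<open>B\<close> of radius \<open>2M\<close> and let \<open>y t\<close> be the right-hand
  side of the equation with \<open>\<phi>\<close> replaced by \<open>P \<phi>\<close> after time \<open>\<epsilon>\<close>.  By the choice of \<open>M\<close> and the
  smallness of the interval, \<open>y t \<in> B\<close>.  Hence the distance of \<open>\<phi> t\<close> to \<open>B\<close>, which is
  \<open>d t = \<bar>\<phi> t - P (\<phi> t)\<bar>\<close>, is at most \<open>\<bar>\<phi> t - y t\<bar>\<close>, and therefore at most the convolution of
  \<open>K\<close> with \<open>(\<bar>\<beta>\<bar> + \<sigma>\<^sup>2 \<bar>\<phi>\<bar>) d\<close>.  Absorption in $L^2$ forces \<open>d = 0\<close>.\<close>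

lemma bounded_on_short_interval:
  fixes \<phi> g :: "real \<Rightarrow> complex"
  assumes \<phi> [measurable]: "\<phi> \<in> borel_measurable borel" and pos: "0 < \<epsilon>" "0 < \<delta>" "0 \<le> x" "0 \<le> G0"
    and C: "\<And>r. r > 0 \<Longrightarrow> \<bar>kderiv 0 r\<bar> \<le> C * r powr (\<kappa> - 1)" "C \<ge> 0"
    and eq: "AE t in lborel. \<epsilon> < t \<and> t < \<epsilon> + \<delta> \<longrightarrow> \<phi> t = g t + kconv (\<lambda>s. riccati \<beta> \<sigma> (\<phi> s)) {0<..} t"
    and int: "AE t in lborel. \<epsilon> < t \<and> t < \<epsilon> + \<delta> \<longrightarrow>
        set_integrable lborel {0<..} (\<lambda>s. complex_of_real (kderiv 0 (t - s)) * riccati \<beta> \<sigma> (\<phi> s))"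
    and gb: "\<And>t. \<epsilon> < t \<Longrightarrow> t < \<epsilon> + \<delta> \<Longrightarrow> norm (g t) \<le> G0"
    and past: "(\<integral>\<^sup>+s. indicator {0<..\<epsilon>} s * ennreal (kderiv 0 (\<epsilon> - s) * norm (riccati \<beta> \<sigma> (\<phi> s))) \<partial>lborel) \<le> ennreal x"
    and M: "M = G0 + x" and M_small: "C * (\<delta> powr \<kappa> / \<kappa>) * (2 * \<bar>\<beta>\<bar> + 2 * \<sigma>\<^sup>2 * M) \<le> 1"
    and L2: "(\<integral>\<^sup>+s. indicator {\<epsilon><..<\<epsilon> + \<delta>} s * ennreal ((norm (\<phi> s))\<^sup>2) \<partial>lborel) < \<infinity>"
    and small: "(\<integral>\<^sup>+r. (ennreal (indicator {..\<delta>} r * kderiv 0 r))\<^sup>2 \<partial>lborel) *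
        (\<integral>\<^sup>+s. (ennreal (indicator {\<epsilon><..<\<epsilon> + \<delta>} s * (\<bar>\<beta>\<bar> + \<sigma>\<^sup>2 * norm (\<phi> s))))\<^sup>2 \<partial>lborel) < 1"
  shows "AE t in lborel. \<epsilon> < t \<and> t < \<epsilon> + \<delta> \<longrightarrow> norm (\<phi> t) \<le> 2 * M"
proof -
  let ?R = "riccati \<beta> \<sigma>" and ?I = "{\<epsilon><..<\<epsilon> + \<delta>}" and ?P = "ball_proj (2 * M)"
  have M0: "0 \<le> M" using pos M by simp
  define d where "d t = indicator ?I t * max 0 (norm (\<phi> t) - 2 * M)" for t
  define w where "w s = indicator ?I s * (\<bar>\<beta>\<bar> + \<sigma>\<^sup>2 * norm (\<phi> s))" for s
  define k where "k r = indicator {..\<delta>} r * kderiv 0 r" for r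
  have [measurable]: "d \<in> borel_measurable borel" "w \<in> borel_measurable borel" "k \<in> borel_measurable borel"
    unfolding d_def[abs_def] w_def[abs_def] k_def[abs_def] by measurable
  have nonneg: "d t \<ge> 0" "w t \<ge> 0" "k t \<ge> 0" for t
    using kderiv_0_nonneg by (auto simp: d_def w_def k_def indicator_def)
  have "AE t in lborel. ennreal (d t) = 0"
  proof (rule nn_integral_absorption[of "\<lambda>r. ennreal (k r)" "\<lambda>s. ennreal (w s)"])
    show "(\<integral>\<^sup>+r. (ennreal (k r))\<^sup>2 \<partial>lborel) * (\<integral>\<^sup>+s. (ennreal (w s))\<^sup>2 \<partial>lborel) < 1"
      using small unfolding k_def w_def .
    have "(\<integral>\<^sup>+t. (ennreal (d t))\<^sup>2 \<partial>lborel) \<le> (\<integral>\<^sup>+s. indicator ?I s * ennreal ((norm (\<phi> s))\<^sup>2) \<partial>lborel)"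
    proof (rule nn_integral_mono)
      fix s
      have "(max 0 (norm (\<phi> s) - 2 * M))\<^sup>2 \<le> (norm (\<phi> s))\<^sup>2"
        using M0 by (intro power_mono) auto
      then show "(ennreal (d s))\<^sup>2 \<le> indicator ?I s * ennreal ((norm (\<phi> s))\<^sup>2)"
        by (auto simp: d_def indicator_def ennreal_power intro!: ennreal_leI)
    qed
    from this L2 show "(\<integral>\<^sup>+t. (ennreal (d t))\<^sup>2 \<partial>lborel) < \<infinity>" by (rule le_less_trans)
    show "AE t in lborel. ennreal (d t) \<le> (\<integral>\<^sup>+s. ennreal (k (t - s)) * (ennreal (w s) * ennreal (d s)) \<partial>lborel)"
      using eq int
    proof eventually_elim
      case (elim t)
      show ?case
      proof (cases "t \<in> ?I")
        case False
        then show ?thesis by (simp add: d_def)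
      next
        case True
        then have t: "\<epsilon> < t" "t < \<epsilon> + \<delta>" by auto
        have int0: "set_integrable lborel {0<..} (\<lambda>s. complex_of_real (kderiv 0 (t - s)) * ?R (\<phi> s))"
          using elim(2) t by blast
        have int1: "set_integrable lborel {0<..\<epsilon>} (\<lambda>s. complex_of_real (kderiv 0 (t - s)) * ?R (\<phi> s))"
          by (rule set_integrable_subset[OF int0]) auto
        have int2: "set_integrable lborel {\<epsilon><..} (\<lambda>s. complex_of_real (kderiv 0 (t - s)) * ?R (\<phi> s))"
          by (rule set_integrable_subset[OF int0]) (use pos in auto)
        \<comment> \<open>A bound for the nonlinearity on the disc of radius \<open>2M\<close>.\<close>
        define B where "B = \<bar>\<beta>\<bar> * (2 * M) + \<sigma>\<^sup>2 / 2 * (2 * M)\<^sup>2"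
        have RP: "norm (?R (?P z)) \<le> B" for z
        proof -
          have "norm (?R (?P z)) \<le> \<bar>\<beta>\<bar> * norm (?P z) + \<sigma>\<^sup>2 / 2 * (norm (?P z))\<^sup>2" by (rule norm_riccati_le)
          also have "\<dots> \<le> B" unfolding B_def using M0
            by (intro add_mono mult_left_mono power_mono norm_ball_proj_le) auto
          finally show ?thesis .
        qed
        have B0: "B \<ge> 0" using RP[of 0] norm_ge_zero order_trans by blast
        have Rm: "set_borel_measurable lborel {\<epsilon><..} (\<lambda>s. ?R (?P (\<phi> s)))"
          unfolding set_borel_measurable_def by measurable
        have ae: "AE s in lborel. \<epsilon> < s \<and> s < t \<longrightarrow> norm (?R (?P (\<phi> s))) \<le> B"
          by (rule AE_I2) (use RP in blast)
        note cvb = kconv_bounded[OF C B0 less_imp_le[OF t(1)] Rm ae]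
        have int3: "set_integrable lborel {\<epsilon><..} (\<lambda>s. complex_of_real (kderiv 0 (t - s)) * ?R (?P (\<phi> s)))"
          by (rule cvb(1))
        have b3: "norm (kconv (\<lambda>s. ?R (?P (\<phi> s))) {\<epsilon><..} t) \<le> B * C * ((t - \<epsilon>) powr \<kappa> / \<kappa>)"
          by (rule cvb(2))
        also have "\<dots> \<le> B * C * (\<delta> powr \<kappa> / \<kappa>)"
          using B0 C(2) t \<kappa>_pos by (intro mult_left_mono divide_right_mono powr_mono2) auto
        also have "\<dots> = M * (C * (\<delta> powr \<kappa> / \<kappa>) * (2 * \<bar>\<beta>\<bar> + 2 * \<sigma>\<^sup>2 * M))"
          by (simp add: B_def power2_eq_square algebra_simps)
        also have "\<dots> \<le> M * 1" using M_small M0 by (intro mult_left_mono) auto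
        finally have b3: "norm (kconv (\<lambda>s. ?R (?P (\<phi> s))) {\<epsilon><..} t) \<le> M" by simp
        have b1: "norm (kconv (\<lambda>s. ?R (\<phi> s)) {0<..\<epsilon>} t) \<le> x"
        proof -
          have "ennreal (norm (kconv (\<lambda>s. ?R (\<phi> s)) {0<..\<epsilon>} t))
             \<le> (\<integral>\<^sup>+s. indicator {0<..\<epsilon>} s * ennreal (norm (complex_of_real (kderiv 0 (t - s)) * ?R (\<phi> s))) \<partial>lborel)"
            unfolding kconv_def by (rule ennreal_norm_set_integral_le)
          also have "\<dots> \<le> (\<integral>\<^sup>+s. indicator {0<..\<epsilon>} s * ennreal (kderiv 0 (\<epsilon> - s) * norm (?R (\<phi> s))) \<partial>lborel)"
          proof (rule nn_integral_mono_AE)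
            have "AE s in lborel. s \<noteq> \<epsilon>" by (rule AE_lborel_singleton)
            then show "AE s in lborel. indicator {0<..\<epsilon>} s * ennreal (norm (complex_of_real (kderiv 0 (t - s)) * ?R (\<phi> s)))
               \<le> indicator {0<..\<epsilon>} s * ennreal (kderiv 0 (\<epsilon> - s) * norm (?R (\<phi> s)))"
            proof eventually_elim
              case (elim s)
              show ?case
              proof (cases "s \<in> {0<..\<epsilon>}")
                case True
                then have "kderiv 0 (t - s) \<le> kderiv 0 (\<epsilon> - s)" using t elim by (intro kderiv_0_antimono) auto
                then show ?thesis using True kderiv_0_nonneg
                  by (auto simp: norm_mult intro!: ennreal_leI mult_right_mono)
              qed auto
            qed
          qed
          also have "\<dots> \<le> ennreal x" by (rule past)
          finally show ?thesis using pos by (simp add: ennreal_le_iff)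
        qed
        define y where "y = g t + kconv (\<lambda>s. ?R (\<phi> s)) {0<..\<epsilon>} t + kconv (\<lambda>s. ?R (?P (\<phi> s))) {\<epsilon><..} t"
        have y: "norm y \<le> 2 * M"
        proof -
          have "norm y \<le> norm (g t) + norm (kconv (\<lambda>s. ?R (\<phi> s)) {0<..\<epsilon>} t) + norm (kconv (\<lambda>s. ?R (?P (\<phi> s))) {\<epsilon><..} t)"
            unfolding y_def by (meson add_right_mono norm_triangle_ineq order_trans)
          also have "\<dots> \<le> G0 + x + M" by (intro add_mono gb t b1 b3)
          finally show ?thesis using M by simp
        qed
        have "kconv (\<lambda>s. ?R (\<phi> s)) ({0<..\<epsilon>} \<union> {\<epsilon><..}) t = kconv (\<lambda>s. ?R (\<phi> s)) {0<..\<epsilon>} t + kconv (\<lambda>s. ?R (\<phi> s)) {\<epsilon><..} t"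
          unfolding kconv_def by (rule set_integral_Un[OF _ int1 int2]) auto
        moreover have "{0<..\<epsilon>} \<union> {\<epsilon><..} = {0<..}" using pos by auto
        ultimately have split: "kconv (\<lambda>s. ?R (\<phi> s)) {0<..} t = kconv (\<lambda>s. ?R (\<phi> s)) {0<..\<epsilon>} t + kconv (\<lambda>s. ?R (\<phi> s)) {\<epsilon><..} t"
          by (simp only:)
        have "\<phi> t = g t + kconv (\<lambda>s. ?R (\<phi> s)) {0<..} t" using elim(1) t by blast
        then have "\<phi> t - y = kconv (\<lambda>s. ?R (\<phi> s)) {\<epsilon><..} t - kconv (\<lambda>s. ?R (?P (\<phi> s))) {\<epsilon><..} t"
          unfolding y_def split by simp
        then have "\<phi> t - y = (LINT s:{\<epsilon><..}|lborel. complex_of_real (kderiv 0 (t - s)) * ?R (\<phi> s) - complex_of_real (kderiv 0 (t - s)) * ?R (?P (\<phi> s)))"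
          unfolding set_integral_diff(2)[OF int2 int3] kconv_def .
        then have "ennreal (norm (\<phi> t - y)) \<le> (\<integral>\<^sup>+s. indicator {\<epsilon><..} s * ennreal (norm (complex_of_real (kderiv 0 (t - s)) * ?R (\<phi> s) - complex_of_real (kderiv 0 (t - s)) * ?R (?P (\<phi> s)))) \<partial>lborel)"
          by (simp only: ennreal_norm_set_integral_le)
        also have "\<dots> \<le> (\<integral>\<^sup>+s. ennreal (k (t - s)) * (ennreal (w s) * ennreal (d s)) \<partial>lborel)"
        proof (rule nn_integral_mono)
          fix s
          show "indicator {\<epsilon><..} s * ennreal (norm (complex_of_real (kderiv 0 (t - s)) * ?R (\<phi> s) - complex_of_real (kderiv 0 (t - s)) * ?R (?P (\<phi> s))))
             \<le> ennreal (k (t - s)) * (ennreal (w s) * ennreal (d s))"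
          proof (cases "\<epsilon> < s \<and> s < t")
            case True
            have "norm (complex_of_real (kderiv 0 (t - s)) * ?R (\<phi> s) - complex_of_real (kderiv 0 (t - s)) * ?R (?P (\<phi> s)))
                = kderiv 0 (t - s) * norm (?R (\<phi> s) - ?R (?P (\<phi> s)))"
              using kderiv_0_nonneg by (simp add: norm_mult flip: right_diff_distrib)
            also have "\<dots> \<le> kderiv 0 (t - s) * ((\<bar>\<beta>\<bar> + \<sigma>\<^sup>2 * norm (\<phi> s)) * norm (\<phi> s - ?P (\<phi> s)))"
              using M0 kderiv_0_nonneg by (intro mult_left_mono norm_riccati_diff_le norm_ball_proj_le_norm) auto
            also have "\<dots> = k (t - s) * (w s * d s)"
              using True t M0 by (simp add: k_def w_def d_def norm_diff_ball_proj)
            finally show ?thesis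
              using True nonneg by (simp add: ennreal_leI flip: ennreal_mult)
          next
            case False
            then show ?thesis by (auto simp: indicator_def)
          qed
        qed
        finally have "ennreal (norm (\<phi> t - y)) \<le> (\<integral>\<^sup>+s. ennreal (k (t - s)) * (ennreal (w s) * ennreal (d s)) \<partial>lborel)" .
        moreover have "d t \<le> norm (\<phi> t - y)"
          using True y norm_triangle_sub[of "\<phi> t" y] by (auto simp: d_def)
        ultimately show ?thesis by (meson ennreal_leI order_trans)
      qed
    qed
  qed measurable
  then show ?thesis
    by eventually_elim (use nonneg(1) in \<open>auto simp: d_def indicator_def max_def split: if_splits\<close>)
qed

end

lemma tendsto_powr_at_right_0:
  assumes "a > 0" shows "((\<lambda>x::real. x powr a) \<longlongrightarrow> 0) (at_right 0)"
  using assms tendsto_powr'[of "\<lambda>x. x" 0 "at_right 0" "\<lambda>_. a" a]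
  by (auto simp: eventually_at_filter tendsto_ident_at)

lemma finite_ennrealE:
  assumes "x < (\<infinity> :: ennreal)"
  obtains r where "r \<ge> 0" "x = ennreal r"
  using assms by (cases x) auto

lemma nn_integral_Ioc_finite:
  fixes \<phi> :: "real \<Rightarrow> complex"
  assumes [measurable]: "\<phi> \<in> borel_measurable borel" and "a \<ge> 0" "b \<ge> 0"
    and fin: "(\<integral>\<^sup>+s. indicator {0<..T} s * ennreal ((norm (\<phi> s))\<^sup>2) \<partial>lborel) < \<infinity>"
    and f: "\<And>s. f s \<le> a + b * (norm (\<phi> s))\<^sup>2"
  shows "(\<integral>\<^sup>+s. indicator {0<..T} s * ennreal (f s) \<partial>lborel) < \<infinity>"
proof -
  have "(\<integral>\<^sup>+s. indicator {0<..T} s * ennreal (f s) \<partial>lborel) \<le>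
     (\<integral>\<^sup>+s. ennreal a * indicator {0<..T} s + ennreal b * (indicator {0<..T} s * ennreal ((norm (\<phi> s))\<^sup>2)) \<partial>lborel)"
  proof (rule nn_integral_mono)
    fix s
    have "ennreal (f s) \<le> ennreal a + ennreal b * ennreal ((norm (\<phi> s))\<^sup>2)"
      using f[of s] assms(2,3) by (simp add: ennreal_leI flip: ennreal_mult ennreal_plus)
    then show "indicator {0<..T} s * ennreal (f s) \<le>
       ennreal a * indicator {0<..T} s + ennreal b * (indicator {0<..T} s * ennreal ((norm (\<phi> s))\<^sup>2))"
      by (auto simp: indicator_def)
  qed
  also have "\<dots> = ennreal a * emeasure lborel {0<..T} + ennreal b * (\<integral>\<^sup>+s. indicator {0<..T} s * ennreal ((norm (\<phi> s))\<^sup>2) \<partial>lborel)"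
    by (subst nn_integral_add) (auto simp: nn_integral_cmult nn_integral_cmult_indicator)
  also have "\<dots> < \<infinity>"
  proof -
    have "emeasure lborel {0<..T} < \<infinity>" by (cases "0 \<le> T") auto
    then show ?thesis using fin by (auto simp: ennreal_mult_less_top)
  qed
  finally show ?thesis .
qed

text \<open>The nonlinearity is quadratic, so it maps $L^2$ to $L^1$ on bounded intervals.\<close>

lemma nn_integral_riccati_finite:
  fixes \<phi> :: "real \<Rightarrow> complex"
  assumes \<phi>: "\<phi> \<in> borel_measurable borel"
    and L2: "(\<integral>\<^sup>+s. indicator {0<..T} s * ennreal ((norm (\<phi> s))\<^sup>2) \<partial>lborel) < \<infinity>"
  shows "(\<integral>\<^sup>+s. indicator {0<..T} s * ennreal (norm (riccati \<beta> \<sigma> (\<phi> s))) \<partial>lborel) < \<infinity>"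
proof (rule nn_integral_Ioc_finite[OF \<phi> _ _ L2])
  show "norm (riccati \<beta> \<sigma> (\<phi> s)) \<le> \<bar>\<beta>\<bar> + (\<bar>\<beta>\<bar> + \<sigma>\<^sup>2) * (norm (\<phi> s))\<^sup>2" for s
  proof -
    define n where "n = norm (\<phi> s)"
    have "2 * n \<le> 1 + n\<^sup>2" using zero_le_power2[of "n - 1"] by (simp add: power2_diff)
    moreover have "0 \<le> n" by (simp add: n_def)
    ultimately have "n \<le> 1 + n\<^sup>2" by linarith
    then have "\<bar>\<beta>\<bar> * n \<le> \<bar>\<beta>\<bar> * (1 + n\<^sup>2)" by (intro mult_left_mono) auto
    moreover have "0 \<le> \<sigma>\<^sup>2 * n\<^sup>2" by simp
    moreover have "norm (riccati \<beta> \<sigma> (\<phi> s)) \<le> \<bar>\<beta>\<bar> * n + \<sigma>\<^sup>2 / 2 * n\<^sup>2" unfolding n_def by (rule norm_riccati_le)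
    moreover have "\<sigma>\<^sup>2 / 2 * n\<^sup>2 = \<sigma>\<^sup>2 * n\<^sup>2 / 2" by simp
    ultimately have "norm (riccati \<beta> \<sigma> (\<phi> s)) \<le> \<bar>\<beta>\<bar> * (1 + n\<^sup>2) + \<sigma>\<^sup>2 * n\<^sup>2" by linarith
    then show ?thesis unfolding n_def[symmetric] by (simp add: algebra_simps)
  qed
qed auto

lemma bounded_Icc_if_steps:
  fixes \<phi> :: "real \<Rightarrow> complex"
  assumes "\<delta> > 0" and step: "\<And>t0. p \<le> t0 \<Longrightarrow> t0 \<le> q \<Longrightarrow> AE t in lborel. t0 < t \<and> t < t0 + \<delta> \<longrightarrow> norm (\<phi> t) \<le> M"
  shows "AE t in lborel. p \<le> t \<and> t \<le> q \<longrightarrow> norm (\<phi> t) \<le> M"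
proof -
  define x where "x n = p + real n * \<delta>" for n
  have "AE t in lborel. x n < t \<and> t < x n + \<delta> \<longrightarrow> p \<le> x n \<longrightarrow> x n \<le> q \<longrightarrow> norm (\<phi> t) \<le> M" for n
    using step[of "x n"] by (cases "p \<le> x n \<and> x n \<le> q") (auto elim!: eventually_mono)
  then have "AE t in lborel. \<forall>n. x n < t \<and> t < x n + \<delta> \<longrightarrow> p \<le> x n \<longrightarrow> x n \<le> q \<longrightarrow> norm (\<phi> t) \<le> M"
    by (simp add: AE_all_countable)
  moreover have "AE t in lborel. \<forall>n. t \<noteq> x n"
    by (simp add: AE_all_countable AE_lborel_singleton)
  ultimately show ?thesis
  proof eventually_elim
    case (elim t)
    show ?case
    proof
      assume t: "p \<le> t \<and> t \<le> q"
      define n where "n = nat \<lfloor>(t - p) / \<delta>\<rfloor>"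
      have r: "real n = of_int \<lfloor>(t - p) / \<delta>\<rfloor>" using t assms(1) by (simp add: n_def)
      have "real n \<le> (t - p) / \<delta>" "(t - p) / \<delta> < real n + 1" unfolding r by linarith+
      then have "x n \<le> t" "t < x n + \<delta>" using assms(1) by (auto simp: x_def field_simps)
      moreover have "p \<le> x n" using assms(1) by (simp add: x_def)
      ultimately show "norm (\<phi> t) \<le> M" using elim t by (metis order.trans order_le_neq_trans)
    qed
  qed
qed

context cm_kernel
begin

text \<open>The convolution of \<open>K\<close> restricted to \<open>(0, T]\<close> with \<open>\<bar>u\<bar>\<close> restricted to \<open>(0, T]\<close>; for \<open>t \<le> T\<close>
  it is \<open>\<integral>\<^sub>0\<^sup>t K(t - s) \<bar>u(s)\<bar> ds\<close>.\<close>

definition past_mass :: "(real \<Rightarrow> complex) \<Rightarrow> real \<Rightarrow> real \<Rightarrow> ennreal" where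
  "past_mass u T t = (\<integral>\<^sup>+s. ennreal (indicator {..T} (t - s) * kderiv 0 (t - s)) * (indicator {0<..T} s * ennreal (norm (u s))) \<partial>lborel)"

lemma past_mass_measurable [measurable]:
  assumes [measurable]: "u \<in> borel_measurable borel"
  shows "past_mass u T \<in> borel_measurable borel"
proof -
  have "(\<lambda>t. \<integral>\<^sup>+s. ennreal (indicator {..T} (t - s) * kderiv 0 (t - s)) * (indicator {0<..T} s * ennreal (norm (u s))) \<partial>lborel) \<in> borel_measurable lborel"
    by measurable
  then show ?thesis unfolding past_mass_def[abs_def] by simp
qed

lemma past_mass_L2:
  assumes [measurable]: "u \<in> borel_measurable borel"
    and u: "(\<integral>\<^sup>+s. indicator {0<..T} s * ennreal (norm (u s)) \<partial>lborel) < \<infinity>"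
    and k: "(\<integral>\<^sup>+r. (ennreal (indicator {..T} r * kderiv 0 r))\<^sup>2 \<partial>lborel) < \<infinity>"
  shows "(\<integral>\<^sup>+t. (past_mass u T t)\<^sup>2 \<partial>lborel) < \<infinity>"
proof -
  have "(\<integral>\<^sup>+t. (past_mass u T t)\<^sup>2 \<partial>lborel) \<le> (\<integral>\<^sup>+r. (ennreal (indicator {..T} r * kderiv 0 r))\<^sup>2 \<partial>lborel) *
      (\<integral>\<^sup>+s. indicator {0<..T} s * ennreal (norm (u s)) \<partial>lborel)\<^sup>2"
    unfolding past_mass_def by (rule nn_integral_young) measurable
  also have "\<dots> < \<infinity>" using u k by (simp add: ennreal_mult_less_top power2_eq_square)
  finally show ?thesis .
qed

lemma integrable_if_past_mass_finite:
  assumes [measurable]: "u \<in> borel_measurable borel" and t: "0 < t" "t \<le> T" and fin: "past_mass u T t < \<infinity>"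
  shows "set_integrable lborel {0<..} (\<lambda>s. complex_of_real (kderiv 0 (t - s)) * u s)"
  unfolding set_integrable_def
proof (rule integrableI_bounded)
  show "(\<lambda>s. indicator {0<..} s *\<^sub>R (complex_of_real (kderiv 0 (t - s)) * u s)) \<in> borel_measurable lborel"
    by measurable
  have "(\<integral>\<^sup>+s. ennreal (norm (indicator {0<..} s *\<^sub>R (complex_of_real (kderiv 0 (t - s)) * u s))) \<partial>lborel) \<le> past_mass u T t"
    unfolding past_mass_def
  proof (rule nn_integral_mono)
    fix s
    show "ennreal (norm (indicator {0<..} s *\<^sub>R (complex_of_real (kderiv 0 (t - s)) * u s)))
       \<le> ennreal (indicator {..T} (t - s) * kderiv 0 (t - s)) * (indicator {0<..T} s * ennreal (norm (u s)))"
      using t kderiv_0_nonneg by (cases "0 < s \<and> s < t") (auto simp: indicator_def norm_mult ennreal_mult)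
  qed
  then show "(\<integral>\<^sup>+s. ennreal (norm (indicator {0<..} s *\<^sub>R (complex_of_real (kderiv 0 (t - s)) * u s))) \<partial>lborel) < \<infinity>"
    using fin by (rule le_less_trans)
qed

lemma AE_integrable_convolution:
  assumes [measurable]: "u \<in> borel_measurable borel"
    and u: "\<And>T. T > 0 \<Longrightarrow> (\<integral>\<^sup>+s. indicator {0<..T} s * ennreal (norm (u s)) \<partial>lborel) < \<infinity>"
    and k: "\<And>T. T > 0 \<Longrightarrow> (\<integral>\<^sup>+r. (ennreal (indicator {..T} r * kderiv 0 r))\<^sup>2 \<partial>lborel) < \<infinity>"
  shows "AE t in lborel. 0 < t \<longrightarrow> set_integrable lborel {0<..} (\<lambda>s. complex_of_real (kderiv 0 (t - s)) * u s)"
proof -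
  have "AE t in lborel. past_mass u (real (Suc n)) t \<noteq> \<infinity>" for n
  proof -
    have "AE t in lborel. (past_mass u (real (Suc n)) t)\<^sup>2 \<noteq> \<infinity>"
      using past_mass_L2[OF assms(1) u k, of "real (Suc n)"]
      by (intro nn_integral_PInf_AE) auto
    then show ?thesis by (auto elim!: eventually_mono simp: power2_eq_square)
  qed
  then have "AE t in lborel. \<forall>n. past_mass u (real (Suc n)) t \<noteq> \<infinity>" by (simp add: AE_all_countable)
  then show ?thesis
  proof eventually_elim
    case (elim t)
    obtain n where "t \<le> real n" using real_arch_simple by blast
    then show ?case
      using elim integrable_if_past_mass_finite[OF assms(1), of t "real (Suc n)"]
      by (auto simp: less_top)
  qed
qed

text \<open>Near a time \<open>t0\<close> the equation is restarted at some \<open>\<epsilon> \<in> [t0 - \<delta>, t0]\<close>.  The contribution of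
  the past of \<open>\<epsilon>\<close> is at most \<open>H = past_mass u T \<epsilon>\<close> for all later times, because \<open>K\<close> is
  non-increasing.  As $H \in L^2$, Chebyshev's inequality provides an \<open>\<epsilon>\<close> with $H(\epsilon) \le
  \mathrm{const}\cdot\delta^{-1/2}$.  On the other hand a bound \<open>M\<close> can be propagated over
  a time of length \<open>\<delta>\<close> if $\delta^\kappa M$ is small.  Since \<open>\<kappa> > 1/2\<close>, both requirements are met for
  small \<open>\<delta>\<close>, which can be chosen independently of \<open>t0\<close>.\<close>

lemma solution_locally_bounded:
  fixes \<phi> g :: "real \<Rightarrow> complex"
  assumes \<phi> [measurable]: "\<phi> \<in> borel_measurable borel"
    and L2: "\<And>T. T > 0 \<Longrightarrow> (\<integral>\<^sup>+s. indicator {0<..T} s * ennreal ((norm (\<phi> s))\<^sup>2) \<partial>lborel) < \<infinity>"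
    and eq: "AE t in lborel. 0 < t \<longrightarrow> \<phi> t = g t + kconv (\<lambda>s. riccati \<beta> \<sigma> (\<phi> s)) {0<..} t"
    and g: "continuous_on {0<..} g"
    and kL2: "\<And>\<delta>. \<delta> > 0 \<Longrightarrow> (\<integral>\<^sup>+r. (ennreal (indicator {..\<delta>} r * kderiv 0 r))\<^sup>2 \<partial>lborel) \<le> ennreal (C0 * \<delta> powr (2 * \<gamma>))"
    and \<gamma>: "0 < \<gamma>" "\<kappa> = \<gamma> + 1/2" "C0 \<ge> 0" and pq: "0 < p" "p \<le> q"
  shows "\<exists>M. AE t in lborel. p \<le> t \<and> t \<le> q \<longrightarrow> norm (\<phi> t) \<le> M"
proof -
  let ?R = "riccati \<beta> \<sigma>" and ?u = "\<lambda>s. riccati \<beta> \<sigma> (\<phi> s)"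
  obtain C where "C > 0" "\<And>r. r > 0 \<Longrightarrow> \<bar>kderiv 0 r\<bar> \<le> C * r powr (\<kappa> - 1)"
    using kderiv_bound[of 0] by auto
  then have C: "\<And>r. r > 0 \<Longrightarrow> \<bar>kderiv 0 r\<bar> \<le> C * r powr (\<kappa> - 1)" "C \<ge> 0" by auto
  have um [measurable]: "?u \<in> borel_measurable borel" by measurable
  have u1: "(\<integral>\<^sup>+s. indicator {0<..T} s * ennreal (norm (?u s)) \<partial>lborel) < \<infinity>" if "T > 0" for T
    by (rule nn_integral_riccati_finite[OF \<phi> L2[OF that]])
  have k_fin: "(\<integral>\<^sup>+r. (ennreal (indicator {..T} r * kderiv 0 r))\<^sup>2 \<partial>lborel) < \<infinity>" if "T > 0" for T
    using kL2[OF that] by (rule le_less_trans) simp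
  have int: "AE t in lborel. 0 < t \<longrightarrow> set_integrable lborel {0<..} (\<lambda>s. complex_of_real (kderiv 0 (t - s)) * ?u s)"
    by (rule AE_integrable_convolution[OF um u1 k_fin])
  \<comment> \<open>Room for the restart intervals of length \<open>2\<delta> < 2\<close> that begin no later than \<open>q\<close>.\<close>
  define T where "T = q + 2"
  have T: "T > 0" using pq by (simp add: T_def)
  have "(\<integral>\<^sup>+s. indicator {0<..T} s * ennreal ((\<bar>\<beta>\<bar> + \<sigma>\<^sup>2 * norm (\<phi> s))\<^sup>2) \<partial>lborel) < \<infinity>"
  proof (rule nn_integral_Ioc_finite[OF \<phi> _ _ L2[OF T]])
    show "(\<bar>\<beta>\<bar> + \<sigma>\<^sup>2 * norm (\<phi> s))\<^sup>2 \<le> 2 * \<beta>\<^sup>2 + 2 * (\<sigma>\<^sup>2)\<^sup>2 * (norm (\<phi> s))\<^sup>2" for s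
    proof -
      have "(x + y)\<^sup>2 \<le> 2 * x\<^sup>2 + 2 * y\<^sup>2" for x y :: real
        using zero_le_power2[of "x - y"] by (simp add: power2_sum power2_diff)
      from this[of "\<bar>\<beta>\<bar>" "\<sigma>\<^sup>2 * norm (\<phi> s)"] show ?thesis by (simp add: power_mult_distrib)
    qed
  qed auto
  then obtain W0 where W0: "W0 \<ge> 0" "(\<integral>\<^sup>+s. indicator {0<..T} s * ennreal ((\<bar>\<beta>\<bar> + \<sigma>\<^sup>2 * norm (\<phi> s))\<^sup>2) \<partial>lborel) = ennreal W0"
    by (rule finite_ennrealE)
  obtain A where A: "A \<ge> 0" "(\<integral>\<^sup>+t. (past_mass ?u T t)\<^sup>2 \<partial>lborel) = ennreal A"
    using past_mass_L2[OF um u1[OF T] k_fin[OF T]] by (rule finite_ennrealE)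
  obtain G0 where G0: "G0 > 0" "\<And>t. t \<in> {p/2..T} \<Longrightarrow> norm (g t) \<le> G0"
    using bounded_on_Icc_above[OF g, of "p/2" T] pq by auto
  have "\<exists>\<delta>>0. \<delta> < 1 \<and> \<delta> < p / 2 \<and> C0 * (2 * \<delta>) powr (2 * \<gamma>) * W0 < 1 \<and>
      C * ((2 * \<delta>) powr \<kappa> / \<kappa>) * (2 * \<bar>\<beta>\<bar> + 2 * \<sigma>\<^sup>2 * (G0 + sqrt ((A + 1) / \<delta>))) < 1"
  proof -
    \<comment> \<open>The last condition in powers of \<open>\<delta>\<close>; here \<open>\<delta> powr \<kappa> * \<delta> powr (-1/2) = \<delta> powr \<gamma>\<close>.\<close>
    define E where "E \<delta> = C * 2 powr \<kappa> / \<kappa> * ((2 * \<bar>\<beta>\<bar> + 2 * \<sigma>\<^sup>2 * G0) * \<delta> powr \<kappa> + 2 * \<sigma>\<^sup>2 * sqrt (A + 1) * \<delta> powr \<gamma>)" for \<delta>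
    have "(E \<longlongrightarrow> C * 2 powr \<kappa> / \<kappa> * ((2 * \<bar>\<beta>\<bar> + 2 * \<sigma>\<^sup>2 * G0) * 0 + 2 * \<sigma>\<^sup>2 * sqrt (A + 1) * 0)) (at_right 0)"
      unfolding E_def[abs_def] using \<kappa>_pos \<gamma> by (intro tendsto_intros tendsto_powr_at_right_0) auto
    then have "eventually (\<lambda>\<delta>. E \<delta> < 1) (at_right 0)" by (intro order_tendstoD) auto
    moreover have "((\<lambda>\<delta>. C0 * (2 powr (2 * \<gamma>) * \<delta> powr (2 * \<gamma>)) * W0) \<longlongrightarrow> C0 * (2 powr (2 * \<gamma>) * 0) * W0) (at_right 0)"
      using \<gamma> by (intro tendsto_intros tendsto_powr_at_right_0) auto
    then have "eventually (\<lambda>\<delta>. C0 * (2 powr (2 * \<gamma>) * \<delta> powr (2 * \<gamma>)) * W0 < 1) (at_right 0)"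
      by (intro order_tendstoD) auto
    moreover have "eventually (\<lambda>\<delta>. \<delta> < min 1 (p / 2)) (at_right 0)" "eventually (\<lambda>\<delta>::real. \<delta> > 0) (at_right 0)"
      unfolding eventually_at_right_field using pq
      by (intro exI[of _ "min 1 (p / 2)"]; simp)+
    ultimately have "eventually (\<lambda>\<delta>. \<delta> > 0 \<and> \<delta> < min 1 (p / 2) \<and> C0 * (2 powr (2 * \<gamma>) * \<delta> powr (2 * \<gamma>)) * W0 < 1 \<and> E \<delta> < 1) (at_right 0)"
      by eventually_elim auto
    then obtain \<delta> where \<delta>: "\<delta> > 0" "\<delta> < min 1 (p / 2)" "C0 * (2 powr (2 * \<gamma>) * \<delta> powr (2 * \<gamma>)) * W0 < 1" "E \<delta> < 1"
      using eventually_happens'[of "at_right (0::real)"] by (metis (no_types, lifting) trivial_limit_at_right_real)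
    have "\<delta> powr \<kappa> * sqrt ((A + 1) / \<delta>) = sqrt (A + 1) * \<delta> powr \<gamma>"
    proof -
      have "sqrt ((A + 1) / \<delta>) = sqrt (A + 1) / \<delta> powr (1/2)" using \<delta>(1) by (simp add: real_sqrt_divide powr_half_sqrt)
      moreover have "\<delta> powr \<kappa> = \<delta> powr \<gamma> * \<delta> powr (1/2)" unfolding \<gamma>(2) by (rule powr_add)
      ultimately show ?thesis using \<delta>(1) by simp
    qed
    then have "(2 * \<bar>\<beta>\<bar> + 2 * \<sigma>\<^sup>2 * G0) * \<delta> powr \<kappa> + 2 * \<sigma>\<^sup>2 * sqrt (A + 1) * \<delta> powr \<gamma> =
       \<delta> powr \<kappa> * (2 * \<bar>\<beta>\<bar> + 2 * \<sigma>\<^sup>2 * (G0 + sqrt ((A + 1) / \<delta>)))" by (simp add: algebra_simps)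
    then have "E \<delta> = C * ((2 * \<delta>) powr \<kappa> / \<kappa>) * (2 * \<bar>\<beta>\<bar> + 2 * \<sigma>\<^sup>2 * (G0 + sqrt ((A + 1) / \<delta>)))"
      using \<delta>(1) by (simp add: E_def powr_mult mult_ac)
    moreover have "(2 * \<delta>) powr (2 * \<gamma>) = 2 powr (2 * \<gamma>) * \<delta> powr (2 * \<gamma>)" using \<delta>(1) by (simp add: powr_mult)
    ultimately show ?thesis using \<delta> by (intro exI[of _ \<delta>]) auto
  qed
  then obtain \<delta> where \<delta>: "\<delta> > 0" "\<delta> < 1" "\<delta> < p / 2" and small: "C0 * (2 * \<delta>) powr (2 * \<gamma>) * W0 < 1"
    and M_small: "C * ((2 * \<delta>) powr \<kappa> / \<kappa>) * (2 * \<bar>\<beta>\<bar> + 2 * \<sigma>\<^sup>2 * (G0 + sqrt ((A + 1) / \<delta>))) < 1" by blast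
  define x where "x = sqrt ((A + 1) / \<delta>)"
  have x: "x \<ge> 0" "x\<^sup>2 * \<delta> = A + 1" using A \<delta> by (auto simp: x_def)
  have "AE t in lborel. t0 < t \<and> t < t0 + \<delta> \<longrightarrow> norm (\<phi> t) \<le> 2 * (G0 + x)" if t0: "p \<le> t0" "t0 \<le> q" for t0
  proof -
    have "\<exists>\<epsilon>\<in>{t0 - \<delta>..t0}. past_mass ?u T \<epsilon> \<le> ennreal x"
    proof (rule ccontr)
      assume "\<not> ?thesis"
      then have big: "ennreal x \<le> past_mass ?u T \<epsilon>" if "\<epsilon> \<in> {t0 - \<delta>..t0}" for \<epsilon>
        using that by (meson linear)
      \<comment> \<open>Otherwise the square of the past mass would integrate to at least \<open>A + 1\<close>.\<close>
      have "ennreal (A + 1) = ennreal (x\<^sup>2) * emeasure lborel {t0 - \<delta>..t0}"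
        using x \<delta> by (simp flip: ennreal_mult)
      also have "\<dots> = (\<integral>\<^sup>+\<epsilon>. ennreal (x\<^sup>2) * indicator {t0 - \<delta>..t0} \<epsilon> \<partial>lborel)"
        by (subst nn_integral_cmult_indicator) auto
      also have "\<dots> \<le> (\<integral>\<^sup>+\<epsilon>. (past_mass ?u T \<epsilon>)\<^sup>2 \<partial>lborel)"
      proof (rule nn_integral_mono)
        fix \<epsilon>
        show "ennreal (x\<^sup>2) * indicator {t0 - \<delta>..t0} \<epsilon> \<le> (past_mass ?u T \<epsilon>)\<^sup>2"
          using power_mono[OF big, of \<epsilon> 2] x(1) by (cases "\<epsilon> \<in> {t0 - \<delta>..t0}") (auto simp: ennreal_power)
      qed
      also have "\<dots> = ennreal A" by (rule A(2))
      finally show False using A(1) by (simp add: ennreal_le_iff)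
    qed
    then obtain \<epsilon> where \<epsilon>: "t0 - \<delta> \<le> \<epsilon>" "\<epsilon> \<le> t0" and H: "past_mass ?u T \<epsilon> \<le> ennreal x" by auto
    have \<epsilon>p: "p / 2 < \<epsilon>" "\<epsilon> > 0" "\<epsilon> + 2 * \<delta> \<le> T" using \<epsilon> \<delta> t0 pq by (auto simp: T_def)
    have "AE t in lborel. \<epsilon> < t \<and> t < \<epsilon> + 2 * \<delta> \<longrightarrow> norm (\<phi> t) \<le> 2 * (G0 + x)"
    proof (rule bounded_on_short_interval[OF \<phi> \<epsilon>p(2) _ x(1) _ C])
      show "AE t in lborel. \<epsilon> < t \<and> t < \<epsilon> + 2 * \<delta> \<longrightarrow> \<phi> t = g t + kconv ?u {0<..} t"
        using eq by eventually_elim (use \<epsilon>p in auto)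
      show "AE t in lborel. \<epsilon> < t \<and> t < \<epsilon> + 2 * \<delta> \<longrightarrow>
          set_integrable lborel {0<..} (\<lambda>s. complex_of_real (kderiv 0 (t - s)) * ?u s)"
        using int by eventually_elim (use \<epsilon>p in auto)
      show "norm (g t) \<le> G0" if "\<epsilon> < t" "t < \<epsilon> + 2 * \<delta>" for t using G0(2)[of t] that \<epsilon>p by auto
      have "(\<integral>\<^sup>+s. indicator {0<..\<epsilon>} s * ennreal (kderiv 0 (\<epsilon> - s) * norm (?u s)) \<partial>lborel) \<le> past_mass ?u T \<epsilon>"
        unfolding past_mass_def
      proof (rule nn_integral_mono)
        fix s
        show "indicator {0<..\<epsilon>} s * ennreal (kderiv 0 (\<epsilon> - s) * norm (?u s)) \<le>
          ennreal (indicator {..T} (\<epsilon> - s) * kderiv 0 (\<epsilon> - s)) * (indicator {0<..T} s * ennreal (norm (?u s)))"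
          using \<epsilon>p \<delta> kderiv_0_nonneg by (cases "0 < s \<and> s \<le> \<epsilon>") (auto simp: indicator_def ennreal_mult)
      qed
      then show "(\<integral>\<^sup>+s. indicator {0<..\<epsilon>} s * ennreal (kderiv 0 (\<epsilon> - s) * norm (?u s)) \<partial>lborel) \<le> ennreal x"
        using H by (rule order_trans)
      have "(\<integral>\<^sup>+s. indicator {\<epsilon><..<\<epsilon> + 2 * \<delta>} s * ennreal ((norm (\<phi> s))\<^sup>2) \<partial>lborel)
        \<le> (\<integral>\<^sup>+s. indicator {0<..T} s * ennreal ((norm (\<phi> s))\<^sup>2) \<partial>lborel)"
        using \<epsilon>p by (intro nn_integral_mono) (auto simp: indicator_def)
      then show "(\<integral>\<^sup>+s. indicator {\<epsilon><..<\<epsilon> + 2 * \<delta>} s * ennreal ((norm (\<phi> s))\<^sup>2) \<partial>lborel) < \<infinity>"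
        using L2[OF T] by (rule le_less_trans)
      have w: "(\<integral>\<^sup>+s. (ennreal (indicator {\<epsilon><..<\<epsilon> + 2 * \<delta>} s * (\<bar>\<beta>\<bar> + \<sigma>\<^sup>2 * norm (\<phi> s))))\<^sup>2 \<partial>lborel) \<le> ennreal W0"
        unfolding W0(2)[symmetric]
        using \<epsilon>p by (intro nn_integral_mono) (auto simp: indicator_def ennreal_power)
      have "(\<integral>\<^sup>+r. (ennreal (indicator {..2 * \<delta>} r * kderiv 0 r))\<^sup>2 \<partial>lborel) *
        (\<integral>\<^sup>+s. (ennreal (indicator {\<epsilon><..<\<epsilon> + 2 * \<delta>} s * (\<bar>\<beta>\<bar> + \<sigma>\<^sup>2 * norm (\<phi> s))))\<^sup>2 \<partial>lborel)
        \<le> ennreal (C0 * (2 * \<delta>) powr (2 * \<gamma>)) * ennreal W0"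
        using \<delta> by (intro mult_mono kL2 w) auto
      also have "\<dots> = ennreal (C0 * (2 * \<delta>) powr (2 * \<gamma>) * W0)"
        using \<gamma>(3) W0(1) by (simp add: ennreal_mult)
      also have "\<dots> < 1" using small by (simp flip: ennreal_1 add: ennreal_less_iff \<gamma>(3) W0(1))
      finally show "(\<integral>\<^sup>+r. (ennreal (indicator {..2 * \<delta>} r * kderiv 0 r))\<^sup>2 \<partial>lborel) *
        (\<integral>\<^sup>+s. (ennreal (indicator {\<epsilon><..<\<epsilon> + 2 * \<delta>} s * (\<bar>\<beta>\<bar> + \<sigma>\<^sup>2 * norm (\<phi> s))))\<^sup>2 \<partial>lborel) < 1" .
      show "C * ((2 * \<delta>) powr \<kappa> / \<kappa>) * (2 * \<bar>\<beta>\<bar> + 2 * \<sigma>\<^sup>2 * (G0 + x)) \<le> 1"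
        using M_small by (simp add: x_def)
    qed (use \<delta> G0 in auto)
    then show ?thesis by eventually_elim (use \<epsilon> in auto)
  qed
  from bounded_Icc_if_steps[OF \<delta>(1) this] show ?thesis by blast
qed

section \<open>The bootstrap\<close>

lemma kconv_split:
  assumes "0 < a" "a < t" and past: "set_integrable lborel {0<..a} u"
    and rest: "set_integrable lborel {a<..} (\<lambda>s. complex_of_real (kderiv 0 (t - s)) * u s)"
  shows "kconv u {0<..} t = kconv u {0<..a} t + kconv u {a<..} t"
proof -
  have "{0<..a} \<subseteq> {..a}" by auto
  then have "kconv u ({0<..a} \<union> {a<..}) t = kconv u {0<..a} t + kconv u {a<..} t"
    unfolding kconv_def using assms by (intro set_integral_Un set_integrable_kderiv_past rest) auto
  moreover have "{0<..a} \<union> {a<..} = {0<..}" using assms by auto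
  ultimately show ?thesis by simp
qed

text \<open>The convolution from \<open>0\<close> differs from the one from \<open>a\<close> by the smooth contribution of the past.\<close>

lemma C_holder_above_kconv_if_tails:
  assumes past: "\<And>a. a > 0 \<Longrightarrow> set_integrable lborel {0<..a} u"
    and rest: "\<And>a t. 0 < a \<Longrightarrow> a < t \<Longrightarrow> set_integrable lborel {a<..} (\<lambda>s. complex_of_real (kderiv 0 (t - s)) * u s)"
    and tail: "\<And>a. a > 0 \<Longrightarrow> C_holder_above a m \<theta> (kconv u {a<..})" and "\<theta> \<le> 1"
  shows "C_holder_above 0 m \<theta> (kconv u {0<..})"
proof (rule C_holder_above_local)
  fix a :: real assume a: "a > 0"
  have "C_holder_above a m \<theta> (\<lambda>t. kconv u {0<..a} t + kconv u {a<..} t)"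
    by (intro C_holder_above_add kconv_past_smooth past tail a \<open>\<theta> \<le> 1\<close>) auto
  then show "C_holder_above a m \<theta> (kconv u {0<..})"
    by (rule C_holder_above_cong[rotated]) (use a kconv_split[OF a _ past[OF a] rest[OF a]] in auto)
qed

lemma kconv_tail_integrable:
  assumes u: "set_borel_measurable lborel {a<..} u" and "a < t"
    and bd: "AE s in lborel. a < s \<and> s < t \<longrightarrow> norm (u s) \<le> M"
  shows "set_integrable lborel {a<..} (\<lambda>s. complex_of_real (kderiv 0 (t - s)) * u s)"
proof -
  obtain C where C: "C > 0" "\<And>r. r > 0 \<Longrightarrow> \<bar>kderiv 0 r\<bar> \<le> C * r powr (\<kappa> - 1)"
    using kderiv_bound[of 0] by auto
  have bd': "AE s in lborel. a < s \<and> s < t \<longrightarrow> norm (u s) \<le> \<bar>M\<bar>"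
    using bd by eventually_elim auto
  show ?thesis
    by (rule kconv_bounded(1)[OF C(2) less_imp_le[OF C(1)] abs_ge_zero less_imp_le[OF \<open>a < t\<close>] u bd'])
qed

text \<open>The first step of the bootstrap, from bounded to continuous.\<close>

lemma kconv_continuous_if_locally_bounded:
  assumes um: "u \<in> borel_measurable borel"
    and past: "\<And>a. a > 0 \<Longrightarrow> set_integrable lborel {0<..a} u"
    and bd: "\<And>p q. 0 < p \<Longrightarrow> p \<le> q \<Longrightarrow> \<exists>M. AE t in lborel. p \<le> t \<and> t \<le> q \<longrightarrow> norm (u t) \<le> M"
  shows "continuous_on {0<..} (kconv u {0<..})"
proof -
  have um': "set_borel_measurable lborel {a<..} u" for a
    unfolding set_borel_measurable_def using um by measurable
  \<comment> \<open>An arbitrary positive Hoelder exponent below \<open>\<kappa>\<close> yields continuity.\<close>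
  define \<rho> where "\<rho> = min 1 (\<kappa> / 2)"
  have \<rho>: "0 < \<rho>" "\<rho> \<le> 1" "\<rho> < 0 + \<kappa>" using \<kappa>_pos by (auto simp: \<rho>_def min_def)
  have "C_holder_above 0 0 \<rho> (kconv u {0<..})"
  proof (rule C_holder_above_kconv_if_tails[OF past])
    fix a t :: real assume a: "0 < a" and t: "a < t"
    obtain M where M: "AE s in lborel. a \<le> s \<and> s \<le> t \<longrightarrow> norm (u s) \<le> M" using bd[of a t] a t by auto
    show "set_integrable lborel {a<..} (\<lambda>s. complex_of_real (kderiv 0 (t - s)) * u s)"
    proof (rule kconv_tail_integrable[OF um' t])
      show "AE s in lborel. a < s \<and> s < t \<longrightarrow> norm (u s) \<le> M" using M by eventually_elim auto
    qed
  next
    fix a :: real assume a: "0 < a"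
    show "C_holder_above a 0 \<rho> (kconv u {a<..})"
    proof (rule kconv_holder_base[OF um' _ order_refl \<rho>])
      fix p q assume pq: "a < p" "p \<le> q"
      obtain M where M: "AE s in lborel. a \<le> s \<and> s \<le> q \<longrightarrow> norm (u s) \<le> M" using bd[of a q] a pq by auto
      have ae: "AE s in lborel. a < s \<and> s < q \<longrightarrow> norm (u s - 0) \<le> \<bar>M\<bar> * \<bar>s - t\<bar> powr 0" for t
        using M AE_lborel_singleton[of t] by eventually_elim auto
      show "\<exists>M\<ge>0. \<forall>t\<in>{p..q}. \<exists>z. norm z \<le> M \<and>
          (AE s in lborel. a < s \<and> s < q \<longrightarrow> norm (u s - z) \<le> M * \<bar>s - t\<bar> powr 0)"
      proof (rule exI[of _ "\<bar>M\<bar>"], intro conjI ballI)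
        fix t
        show "\<exists>z. norm z \<le> \<bar>M\<bar> \<and> (AE s in lborel. a < s \<and> s < q \<longrightarrow> norm (u s - z) \<le> \<bar>M\<bar> * \<bar>s - t\<bar> powr 0)"
          by (rule exI[of _ 0], intro conjI ae) simp
      qed simp
    qed
  qed (use \<rho> in auto)
  then show ?thesis by (rule continuous_on_if_C_holder_above)
qed

lemma kconv_tail_integrable_if_continuous:
  assumes cont: "continuous_on {0<..} u" and "0 < a" "a < t"
  shows "set_integrable lborel {a<..} (\<lambda>s. complex_of_real (kderiv 0 (t - s)) * u s)"
proof -
  obtain M where M: "\<And>s. s \<in> {a..t} \<Longrightarrow> norm (u s) \<le> M"
    using bounded_on_Icc_above[OF cont \<open>0 < a\<close>] by blast
  show ?thesis
  proof (rule kconv_tail_integrable)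
    show "set_borel_measurable lborel {a<..} u"
      using cont \<open>0 < a\<close> by (intro set_borel_measurable_if_continuous_on_above) auto
    show "AE s in lborel. a < s \<and> s < t \<longrightarrow> norm (u s) \<le> M" by (rule AE_I2) (use M in auto)
  qed fact
qed

lemma kconv_gain:
  assumes u: "C_holder_above 0 m \<theta> u" and "0 \<le> \<theta>"
    and past: "\<And>a. a > 0 \<Longrightarrow> set_integrable lborel {0<..a} u"
  shows "0 < \<rho> \<Longrightarrow> \<rho> \<le> 1 \<Longrightarrow> \<rho> < \<theta> + \<kappa> \<Longrightarrow> C_holder_above 0 m \<rho> (kconv u {0<..})"
    and "\<theta> + \<kappa> > 1 \<Longrightarrow> C_holder_above 0 (Suc m) 0 (kconv u {0<..})"
proof -
  note rest = kconv_tail_integrable_if_continuous[OF continuous_on_if_C_holder_above[OF u]]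
  show "C_holder_above 0 m \<rho> (kconv u {0<..})" if "0 < \<rho>" "\<rho> \<le> 1" "\<rho> < \<theta> + \<kappa>"
    by (rule C_holder_above_kconv_if_tails[OF past rest])
       (use that assms in \<open>auto intro!: kconv_gain_holder[OF u]\<close>)
  show "C_holder_above 0 (Suc m) 0 (kconv u {0<..})" if "\<theta> + \<kappa> > 1"
    by (rule C_holder_above_kconv_if_tails[OF past rest])
       (use that assms in \<open>auto intro!: kconv_gain_derivative[OF u]\<close>)
qed

context
  fixes \<beta> \<sigma> :: real and f g :: "real \<Rightarrow> complex"
  assumes \<kappa>_half: "\<kappa> > 1/2"
    and eq: "\<And>t. t > 0 \<Longrightarrow> f t = g t + kconv (\<lambda>s. riccati \<beta> \<sigma> (f s)) {0<..} t"
    and past: "\<And>a. a > 0 \<Longrightarrow> set_integrable lborel {0<..a} (\<lambda>s. riccati \<beta> \<sigma> (f s))"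
    and cont: "continuous_on {0<..} f"
begin

lemma solution_from_convolution:
  assumes "C_holder_above 0 m \<theta> g" "C_holder_above 0 m \<theta> (kconv (\<lambda>s. riccati \<beta> \<sigma> (f s)) {0<..})"
  shows "C_holder_above 0 m \<theta> f"
  by (rule C_holder_above_cong[OF _ C_holder_above_add[OF assms]]) (simp add: eq)

text \<open>One turn of the bootstrap raises the order by one: the convolution term gains the Hoelder
  exponent \<open>1/2\<close> first, and then, as \<open>1/2 + \<kappa> > 1\<close>, a full derivative.\<close>

lemma solution_C_m: "C_holder_above 0 m 0 g \<Longrightarrow> C_holder_above 0 m 0 f"
proof (induction m)
  case 0
  show ?case using cont by (simp add: C_holder_above_0_0_iff)
next
  case (Suc m)
  have g: "C_holder_above 0 m 0 g" "C_holder_above 0 m (1/2) g"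
    using Suc.prems by (auto intro: C_holder_above_lower)
  have f0: "C_holder_above 0 m 0 f" using g(1) by (rule Suc.IH)
  have "C_holder_above 0 m (1/2) (kconv (\<lambda>s. riccati \<beta> \<sigma> (f s)) {0<..})"
    by (rule kconv_gain(1)[OF C_holder_above_riccati[OF f0] _ past]) (use \<kappa>_half in auto)
  then have f1: "C_holder_above 0 m (1/2) f" by (rule solution_from_convolution[OF g(2)])
  have "C_holder_above 0 (Suc m) 0 (kconv (\<lambda>s. riccati \<beta> \<sigma> (f s)) {0<..})"
    by (rule kconv_gain(2)[OF C_holder_above_riccati[OF f1] _ past]) (use \<kappa>_half in auto)
  then show ?case by (rule solution_from_convolution[OF Suc.prems])
qed

text \<open>At fixed order, two turns of the bootstrap lead from exponent \<open>0\<close> to \<open>\<eta>/2 < 1/2\<close> and then to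
  \<open>\<eta> < \<eta>/2 + 1/2\<close>.\<close>

lemma solution_C_m_holder:
  assumes \<eta>: "0 < \<eta>" "\<eta> < 1" and g: "C_holder_above 0 m \<eta> g"
  shows "C_holder_above 0 m \<eta> f"
proof -
  have f0: "C_holder_above 0 m 0 f"
    using C_holder_above_weaken[OF g, of 0] \<eta> by (intro solution_C_m) auto
  have g2: "C_holder_above 0 m (\<eta>/2) g" using C_holder_above_weaken[OF g, of "\<eta>/2"] \<eta> by auto
  have "C_holder_above 0 m (\<eta>/2) (kconv (\<lambda>s. riccati \<beta> \<sigma> (f s)) {0<..})"
    by (rule kconv_gain(1)[OF C_holder_above_riccati[OF f0] _ past]) (use \<eta> \<kappa>_half in auto)
  then have f1: "C_holder_above 0 m (\<eta>/2) f" by (rule solution_from_convolution[OF g2])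
  have "C_holder_above 0 m \<eta> (kconv (\<lambda>s. riccati \<beta> \<sigma> (f s)) {0<..})"
    by (rule kconv_gain(1)[OF C_holder_above_riccati[OF f1] _ past]) (use \<eta> \<kappa>_half in auto)
  then show ?thesis by (rule solution_from_convolution[OF g])
qed

end

end

section \<open>The regular representative of the solution\<close>

text \<open>A continuous function that leaves the closed half-plane at \<open>t\<close> does so on an interval.\<close>

lemma Cminus_if_AE_Cminus:
  fixes f :: "real \<Rightarrow> complex"
  assumes cont: "continuous_on {0<..} f" and ae: "AE t in lborel. t > 0 \<longrightarrow> f t \<in> Cminus" and t: "t > 0"
  shows "f t \<in> Cminus"
proof (rule ccontr)
  assume "f t \<notin> Cminus"
  then have pos: "Re (f t) > 0" by (simp add: Cminus_def)
  have "isCont f t" using cont t by (auto simp: continuous_on_eq_continuous_at)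
  then have "((\<lambda>s. Re (f s)) \<longlongrightarrow> Re (f t)) (at t)" by (intro tendsto_Re) (simp add: isCont_def)
  then have "eventually (\<lambda>s. Re (f s) > 0) (at t)" using pos by (rule order_tendstoD)
  then obtain d where d: "d > 0" "\<And>s. s \<noteq> t \<Longrightarrow> dist s t < d \<Longrightarrow> Re (f s) > 0"
    by (auto simp: eventually_at)
  have "AE s in lborel. s \<notin> {t<..<t + d}"
    using ae
  proof eventually_elim
    case (elim s)
    show ?case using elim d(2)[of s] t by (auto simp: Cminus_def dist_real_def)
  qed
  then have "{t<..<t + d} \<in> null_sets lborel" by (subst AE_iff_null_sets) auto
  then have "emeasure lborel {t<..<t + d} = 0" by auto
  then show False using d(1) by simp
qed

lemma L2_loc_restrict:
  fixes \<psi> :: "real \<Rightarrow> complex"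
  assumes "L2_loc \<psi>"
  defines "\<phi> \<equiv> \<lambda>t. indicator {0<..} t *\<^sub>R \<psi> t"
  shows "\<phi> \<in> borel_measurable borel"
    and "\<And>T. T > 0 \<Longrightarrow> (\<integral>\<^sup>+s. indicator {0<..T} s * ennreal ((norm (\<phi> s))\<^sup>2) \<partial>lborel) < \<infinity>"
proof -
  have m [measurable]: "(\<lambda>t. indicator {0..real (Suc n)} t *\<^sub>R \<psi> t) \<in> borel_measurable borel" for n
  proof -
    have "0 < real (Suc n)" by simp
    from assms(1)[unfolded L2_loc_def, rule_format, OF this]
    show ?thesis by (simp add: set_borel_measurable_def)
  qed
  show "\<phi> \<in> borel_measurable borel"
  proof (rule borel_measurable_LIMSEQ_metric)
    show "(\<lambda>t. indicator {0<..} t *\<^sub>R (indicator {0..real (Suc n)} t *\<^sub>R \<psi> t)) \<in> borel_measurable borel" for n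
      by measurable
    fix t :: real
    obtain N where N: "t \<le> real N" using real_arch_simple by blast
    have "eventually (\<lambda>n. indicator {0<..} t *\<^sub>R (indicator {0..real (Suc n)} t *\<^sub>R \<psi> t) = \<phi> t) sequentially"
      using eventually_ge_at_top[of N]
      by eventually_elim (use N in \<open>auto simp: \<phi>_def indicator_def\<close>)
    then show "(\<lambda>n. indicator {0<..} t *\<^sub>R (indicator {0..real (Suc n)} t *\<^sub>R \<psi> t)) \<longlonglongrightarrow> \<phi> t"
      by (rule tendsto_eventually)
  qed
  fix T :: real assume "T > 0"
  then have int: "integrable lborel (\<lambda>t. indicator {0..T} t *\<^sub>R (norm (\<psi> t))\<^sup>2)"
    using assms(1) by (auto simp: L2_loc_def set_integrable_def)
  have "(\<integral>\<^sup>+s. indicator {0<..T} s * ennreal ((norm (\<phi> s))\<^sup>2) \<partial>lborel)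
      \<le> (\<integral>\<^sup>+s. ennreal (norm (indicator {0..T} s *\<^sub>R (norm (\<psi> s))\<^sup>2)) \<partial>lborel)"
    by (intro nn_integral_mono) (auto simp: \<phi>_def indicator_def)
  also have "\<dots> < \<infinity>" using int by (auto simp: integrable_iff_bounded)
  finally show "(\<integral>\<^sup>+s. indicator {0<..T} s * ennreal ((norm (\<phi> s))\<^sup>2) \<partial>lborel) < \<infinity>" .
qed

lemma (in cm_kernel) kderiv_L2_bound:
  assumes "L2_loc K" "\<delta> > 0" "(LINT t:{0..\<delta>}|lborel. (K t)\<^sup>2) \<le> B"
  shows "(\<integral>\<^sup>+r. (ennreal (indicator {..\<delta>} r * kderiv 0 r))\<^sup>2 \<partial>lborel) \<le> ennreal B"
proof -
  have int: "integrable lborel (\<lambda>t. indicator {0..\<delta>} t *\<^sub>R (K t)\<^sup>2)"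
    using assms(1,2) by (auto simp: L2_loc_def set_integrable_def)
  have "(\<integral>\<^sup>+r. (ennreal (indicator {..\<delta>} r * kderiv 0 r))\<^sup>2 \<partial>lborel)
     \<le> (\<integral>\<^sup>+r. ennreal (indicator {0..\<delta>} r *\<^sub>R (K r)\<^sup>2) \<partial>lborel)"
  proof (rule nn_integral_mono)
    fix r
    have "(ennreal (kderiv 0 r))\<^sup>2 = ennreal ((K r)\<^sup>2)" if "r > 0"
      using kderiv_0_nonneg[of r] that by (subst ennreal_power) (auto simp: kderiv_def)
    then show "(ennreal (indicator {..\<delta>} r * kderiv 0 r))\<^sup>2 \<le> ennreal (indicator {0..\<delta>} r *\<^sub>R (K r)\<^sup>2)"
      by (cases "0 < r \<and> r \<le> \<delta>") (auto simp: indicator_def)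
  qed
  also have "\<dots> = ennreal (LINT t:{0..\<delta>}|lborel. (K t)\<^sup>2)"
    unfolding set_lebesgue_integral_def by (rule nn_integral_eq_integral[OF int]) auto
  also have "\<dots> \<le> ennreal B" using assms(3) by (rule ennreal_leI)
  finally show ?thesis .
qed

lemma (in cm_kernel) convolution_eq_kconv:
  assumes "t > 0"
  shows "(LINT s:{0..t}|lborel. complex_of_real (K (t - s)) * riccati \<beta> \<sigma> (\<psi> s)) =
    kconv (\<lambda>s. riccati \<beta> \<sigma> (indicator {0<..} s *\<^sub>R \<psi> s)) {0<..} t"
  unfolding kconv_def set_lebesgue_integral_def
  by (rule integral_discrete_difference[of "{0, t}"]) (auto simp: indicator_def kderiv_def)

lemma (in cm_kernel) kconv_cong_AE:
  assumes [measurable]: "u \<in> borel_measurable borel" "v \<in> borel_measurable borel"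
    and "AE s in lborel. s > 0 \<longrightarrow> u s = v s"
  shows "kconv u {0<..} t = kconv v {0<..} t"
  unfolding kconv_def set_lebesgue_integral_def
proof (rule integral_cong_AE)
  show "AE s in lborel. indicator {0<..} s *\<^sub>R (complex_of_real (kderiv 0 (t - s)) * u s) =
      indicator {0<..} s *\<^sub>R (complex_of_real (kderiv 0 (t - s)) * v s)"
    using assms(3) by eventually_elim (auto simp: indicator_def)
qed measurable

text \<open>The representative is \<open>f = g + K * R(\<psi>)\<close>, defined pointwise by means of the continuous
  function \<open>g\<close>.  It depends on \<open>g\<close> only, not on the order of smoothness under consideration, so the
  same \<open>f\<close> serves for every order at once and also for smooth functions.\<close>

lemma regular_representative:
  assumes K: "condition_K K" and sol: "riccati_volterra_solution K \<beta> \<sigma> \<mu> \<psi>"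
    and g: "continuous_on {0<..} g" and fg: "AE t in lborel. t > 0 \<longrightarrow> conv_measure K \<mu> t = g t"
  obtains f where "\<And>t. t > 0 \<Longrightarrow> f t \<in> Cminus" "AE t in lborel. t > 0 \<longrightarrow> \<psi> t = f t"
    "\<And>m. C_class m g \<Longrightarrow> C_class m f"
    "\<And>m \<eta>. 0 < \<eta> \<Longrightarrow> \<eta> < 1 \<Longrightarrow> C_holder m \<eta> g \<Longrightarrow> C_holder m \<eta> f"
proof -
  obtain C \<gamma> where C: "C > 0" and \<gamma>: "0 < \<gamma>"
    and KL2: "\<And>h. h > 0 \<Longrightarrow> (LINT t:{0..h}|lborel. (K t)\<^sup>2) \<le> C * h powr (2 * \<gamma>)"
    and ker: "cm_kernel K (sqrt C) (\<gamma> + 1/2)"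
    using condition_K_bounds[OF K] by blast
  interpret cm_kernel K "sqrt C" "\<gamma> + 1/2" by (rule ker)
  have L2K: "L2_loc K" using K unfolding condition_K_def by blast
  have L2\<psi>: "L2_loc \<psi>" and \<psi>C: "AE t in lborel. t \<ge> 0 \<longrightarrow> \<psi> t \<in> Cminus"
    and \<psi>eq: "AE t in lborel. t \<ge> 0 \<longrightarrow> \<psi> t = conv_measure K \<mu> t
              + (LINT s:{0..t}|lborel. complex_of_real (K (t - s)) * riccati \<beta> \<sigma> (\<psi> s))"
    using sol unfolding riccati_volterra_solution_def by blast+
  \<comment> \<open>Cutting off negative times turns local measurability into measurability on the whole line.\<close>
  define \<phi> where "\<phi> t = indicator {0<..} t *\<^sub>R \<psi> t" for t
  define u where "u s = riccati \<beta> \<sigma> (\<phi> s)" for s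
  have \<phi>m [measurable]: "\<phi> \<in> borel_measurable borel"
    and \<phi>L2: "\<And>T. T > 0 \<Longrightarrow> (\<integral>\<^sup>+s. indicator {0<..T} s * ennreal ((norm (\<phi> s))\<^sup>2) \<partial>lborel) < \<infinity>"
    using L2_loc_restrict[OF L2\<psi>] unfolding \<phi>_def[abs_def] by blast+
  have um [measurable]: "u \<in> borel_measurable borel" unfolding u_def[abs_def] by measurable
  have \<phi>eq: "AE t in lborel. 0 < t \<longrightarrow> \<phi> t = g t + kconv u {0<..} t"
    using \<psi>eq fg
  proof eventually_elim
    case (elim t)
    show ?case
    proof
      assume t: "0 < t"
      then have "\<psi> t = g t + kconv u {0<..} t"
        using elim convolution_eq_kconv[OF t, of \<beta> \<sigma> \<psi>] by (simp add: u_def[abs_def] \<phi>_def[abs_def])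
      then show "\<phi> t = g t + kconv u {0<..} t" using t by (simp add: \<phi>_def)
    qed
  qed
  have bounded: "\<exists>M. AE t in lborel. p \<le> t \<and> t \<le> q \<longrightarrow> norm (\<phi> t) \<le> M" if "0 < p" "p \<le> q" for p q
    using solution_locally_bounded[OF \<phi>m \<phi>L2 \<phi>eq[unfolded u_def[abs_def]] g kderiv_L2_bound[OF L2K _ KL2] \<gamma> refl less_imp_le[OF C] that] by blast
  have past: "set_integrable lborel {0<..a} u" if "a > 0" for a
    unfolding set_integrable_def
  proof (rule integrableI_bounded)
    show "(\<lambda>s. indicator {0<..a} s *\<^sub>R u s) \<in> borel_measurable lborel" by measurable
    have "(\<integral>\<^sup>+s. ennreal (norm (indicator {0<..a} s *\<^sub>R u s)) \<partial>lborel) =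
       (\<integral>\<^sup>+s. indicator {0<..a} s * ennreal (norm (riccati \<beta> \<sigma> (\<phi> s))) \<partial>lborel)"
      by (intro nn_integral_cong) (auto simp: indicator_def u_def)
    also have "\<dots> < \<infinity>" by (rule nn_integral_riccati_finite[OF \<phi>m \<phi>L2[OF that]])
    finally show "(\<integral>\<^sup>+s. ennreal (norm (indicator {0<..a} s *\<^sub>R u s)) \<partial>lborel) < \<infinity>" .
  qed
  \<comment> \<open>The factor makes \<open>f\<close> Borel measurable on the whole line.\<close>
  define f where "f t = indicator {0<..} t *\<^sub>R (g t + kconv u {0<..} t)" for t
  have ubd: "\<exists>M. AE t in lborel. p \<le> t \<and> t \<le> q \<longrightarrow> norm (u t) \<le> M" if pq: "0 < p" "p \<le> q" for p q
  proof -
    obtain M where M: "AE t in lborel. p \<le> t \<and> t \<le> q \<longrightarrow> norm (\<phi> t) \<le> M" using bounded[OF pq] by blast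
    have "AE t in lborel. p \<le> t \<and> t \<le> q \<longrightarrow> norm (u t) \<le> \<bar>\<beta>\<bar> * M + \<sigma>\<^sup>2 / 2 * M\<^sup>2"
      using M
    proof eventually_elim
      case (elim t)
      show ?case
      proof
        assume "p \<le> t \<and> t \<le> q"
        with elim have M: "norm (\<phi> t) \<le> M" by blast
        have "norm (u t) \<le> \<bar>\<beta>\<bar> * norm (\<phi> t) + \<sigma>\<^sup>2 / 2 * (norm (\<phi> t))\<^sup>2" unfolding u_def by (rule norm_riccati_le)
        also have "\<dots> \<le> \<bar>\<beta>\<bar> * M + \<sigma>\<^sup>2 / 2 * M\<^sup>2" using M by (intro add_mono mult_left_mono power_mono) auto
        finally show "norm (u t) \<le> \<bar>\<beta>\<bar> * M + \<sigma>\<^sup>2 / 2 * M\<^sup>2" .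
      qed
    qed
    then show ?thesis by blast
  qed
  have cont_kconv: "continuous_on {0<..} (kconv u {0<..})"
    by (rule kconv_continuous_if_locally_bounded[OF um past ubd])
  have cont_gcv: "continuous_on {0<..} (\<lambda>t. g t + kconv u {0<..} t)"
    by (intro continuous_intros g cont_kconv)
  then have cont_f: "continuous_on {0<..} f"
    by (rule continuous_on_cong[THEN iffD1, rotated 2]) (auto simp: f_def)
  have fm [measurable]: "f \<in> borel_measurable borel"
    unfolding f_def[abs_def] by (rule borel_measurable_continuous_on_indicator[OF _ cont_gcv]) auto
  have \<phi>f: "AE t in lborel. t > 0 \<longrightarrow> \<phi> t = f t" using \<phi>eq by eventually_elim (auto simp: f_def)
  have kconv_eq: "kconv u {0<..} t = kconv (\<lambda>s. riccati \<beta> \<sigma> (f s)) {0<..} t" for t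
  proof (rule kconv_cong_AE)
    show "AE s in lborel. s > 0 \<longrightarrow> u s = riccati \<beta> \<sigma> (f s)" using \<phi>f by eventually_elim (simp add: u_def)
  qed measurable
  have past_f: "set_integrable lborel {0<..a} (\<lambda>s. riccati \<beta> \<sigma> (f s))" if "a > 0" for a
  proof -
    have "set_integrable lborel {0<..a} u \<longleftrightarrow> set_integrable lborel {0<..a} (\<lambda>s. riccati \<beta> \<sigma> (f s))"
    proof (rule set_integrable_cong_AE)
      show "AE s\<in>{0<..a} in lborel. u s = riccati \<beta> \<sigma> (f s)" using \<phi>f by eventually_elim (simp add: u_def)
    qed measurable
    then show ?thesis using past[OF that] by simp
  qed
  have half: "1/2 < \<gamma> + 1/2" using \<gamma> by simp
  have f_eq: "f t = g t + kconv (\<lambda>s. riccati \<beta> \<sigma> (f s)) {0<..} t" if "t > 0" for t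
    unfolding kconv_eq[symmetric] using that by (simp add: f_def)
  show ?thesis
  proof (rule that)
    show "AE t in lborel. t > 0 \<longrightarrow> \<psi> t = f t" using \<phi>f by eventually_elim (auto simp: \<phi>_def)
    then have "AE t in lborel. t > 0 \<longrightarrow> f t \<in> Cminus" using \<psi>C by eventually_elim auto
    then show "f t \<in> Cminus" if "t > 0" for t by (rule Cminus_if_AE_Cminus[OF cont_f _ that])
    show "C_class m f" if "C_class m g" for m
      using solution_C_m[OF half f_eq past_f cont_f] that unfolding C_class_iff_above by blast
    show "C_holder m \<eta> f" if "0 < \<eta>" "\<eta> < 1" "C_holder m \<eta> g" for m \<eta>
      using solution_C_m_holder[OF half f_eq past_f cont_f that(1,2)] that(3) unfolding C_holder_iff_above by blast
  qed
qed

text \<open>Each of the two regularity assumptions supplies a continuous representative of the convolution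
  with \<open>\<mu>\<close>, to which the preceding lemma applies.\<close>

theorem theorem1p1:
  fixes \<sigma> \<beta> \<alpha> :: real
    and K l :: "real \<Rightarrow> real"
    and \<mu> :: "real set \<Rightarrow> complex"
    and \<psi> :: "real \<Rightarrow> complex"
  assumes "\<sigma> > 0"
    and "condition_K K"
    and "0 < \<alpha>" and "\<alpha> < 1"
    and "slowly_varying_at_0 l"
    and "\<And>t. t > 0 \<Longrightarrow> K t = t powr (\<alpha> - 1) / Gamma \<alpha> * l t"
    and "loc_finite_measure \<mu>"
    and "\<And>A. A \<in> bounded_borel \<Longrightarrow> \<mu> A \<in> Cminus"
    and "riccati_volterra_solution K \<beta> \<sigma> \<mu> \<psi>"
  shows "(\<forall>m \<eta>. 0 < \<eta> \<and> \<eta> < 1 \<longrightarrow>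
            in_C_holder_Cminus m \<eta> (conv_measure K \<mu>) \<longrightarrow> in_C_holder_Cminus m \<eta> \<psi>)
         \<and> (in_C_infinity (conv_measure K \<mu>) \<longrightarrow> in_C_infinity \<psi>)"
proof (intro conjI allI impI)
  fix m \<eta> assume \<eta>: "0 < \<eta> \<and> \<eta> < 1" and "in_C_holder_Cminus m \<eta> (conv_measure K \<mu>)"
  then obtain g where g: "C_holder m \<eta> g" "AE t in lborel. t > 0 \<longrightarrow> conv_measure K \<mu> t = g t"
    unfolding in_C_holder_Cminus_def by blast
  have cont: "continuous_on {0<..} g"
    using g(1) unfolding C_holder_iff_above by (rule continuous_on_if_C_holder_above)
  obtain f where "\<And>t. t > 0 \<Longrightarrow> f t \<in> Cminus" "AE t in lborel. t > 0 \<longrightarrow> \<psi> t = f t" "C_holder m \<eta> f"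
    by (rule regular_representative[OF assms(2,9) cont g(2)]) (use \<eta> g(1) in blast)
  then show "in_C_holder_Cminus m \<eta> \<psi>" unfolding in_C_holder_Cminus_def by blast
next
  assume "in_C_infinity (conv_measure K \<mu>)"
  then obtain g where g: "\<And>m. C_class m g" "AE t in lborel. t > 0 \<longrightarrow> conv_measure K \<mu> t = g t"
    unfolding in_C_infinity_def by blast
  have cont: "continuous_on {0<..} g"
    using g(1)[of 0] by (simp add: C_class_def)
  obtain f where "AE t in lborel. t > 0 \<longrightarrow> \<psi> t = f t" "\<And>m. C_class m f"
    by (rule regular_representative[OF assms(2,9) cont g(2)]) (use g(1) in blast)
  then show "in_C_infinity \<psi>" unfolding in_C_infinity_def by blast
qed

end
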